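(* Let $\mathfrak{g}$ be a $Q$-good Lie algebra (with respect to $\pi: Q\to\mathbb{Z}$), let $\varphi:\mathfrak{n}\to\mathbb{C}$ be a homomorphism of Lie algebras, and suppose $(\mathfrak{g},\pi)$ is nonsingular with respect to $\varphi$. For a Whittaker module $V$ of type $\varphi$ put $A_V = A\cap U_V(\mathfrak{g})$, where $A=S(Z'')$ and $U_V(\mathfrak{g})=\{u\in U(\mathfrak{g}) : uV=0\}$. Then the correspondence $V\mapsto A_V$ sets up a bijection between the set of all isomorphism classes of Whittaker modules of type $\varphi$ and the set of all ideals of $A=S(Z'')$.
   Context: Setting. $Q$ is a free abelian group with a total order $\leq$ compatible with its group structure, and $\pi:Q\to\mathbb{Z}$ is a homomorphism of abelian groups that preserves the ordering ($\alpha\le\beta$ implies $\pi(\alpha)\le\pi(\beta)$). $\mathfrak{g}=\bigoplus_{\alpha\in Q}\mathfrak{g}_\alpha$ is a $Q$-graded Lie algebra over $\mathbb{C}$, i.e. $[\mathfrak{g}_\alpha,\mathfrak{g}_\beta]\subseteq\mathfrak{g}_{\alpha+\beta}$. $Z$ is the center of $\mathfrak{g}$; it is a graded ideal. Put $Q'=\{\alpha\in Q:\pi(\alpha)>0\}$, $Q''=\{\alpha\in Q:\pi(\alpha)\le 0\}$, $\mathfrak{n}=\bigoplus_{\alpha\in Q'}\mathfrak{g}_\alpha$, $\mathfrak{b}_-=\bigoplus_{\alpha\in Q''}\mathfrak{g}_\alpha$, so $\mathfrak{g}=\mathfrak{b}_-\oplus\mathfrak{n}$; write $\mathfrak{n}_\alpha=\mathfrak{g}_\alpha$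 for $\alpha\in Q'$. $\mathfrak{g}$ is called $Q$-good if $\dim\mathfrak{g}_\alpha\le 1$ for all $\alpha\in Q'$ and $\dim(\mathfrak{g}/Z)_\alpha\le 1$ for all $\alpha\in Q''$. Notation. $K=\{\alpha\in Q:\mathfrak{g}_\alpha\ne 0\}$, $K'=K\cap Q'$, $K''=K\cap Q''$, $R''=\{\alpha\in K'' : Z\cap\mathfrak{g}_\alpha=\mathfrak{g}_\alpha\}$, $Z''=Z\cap\mathfrak{b}_-$. For each $\alpha\in K\setminus R''$ fix a nonzero $x_\alpha\in\mathfrak{g}_\alpha$ with $x_\alpha\notin Z''$. $U(\cdot)$ is the universal enveloping algebra, and $S(Z'')$ is the symmetric algebra of $Z''$, viewed as the (central) subalgebra $U(Z'')$ of $U(\mathfrak{g})$. Whittaker modules. A vector $v$ in a $\mathfrak{g}$-module $V$ is a Whittaker vector of type $\varphi$ if $xv=\varphi(x)v$ for all $x\in\mathfrak{n}$. $V$ is a Whittaker module of type $\varphi$ if it is generated by some Whittaker vector of type $\varphi$ (called a cyclic Whittaker vector). The zero vector is allowed, so the zero module is a Whittaker module. Nonsingularity. $(\mathfrak{g},\pi)$ is nonsingular with respect to $\varphi$ if (1) the set $\{\alpha\in K':\varphi(x_\alpha)\ne 0\}$ admits a unique maximal element, denoted $\alpha_\varphi$; and (2) for every $\beta\in K''\setminus R''$ there exists $y\in\mathfrak{n}_{\alpha_\varphi-\beta}$ such that $\varphi([y,x_\beta])\ne 0$. *)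

theory Defs
  imports Complex_Main "HOL-Library.Poly_Mapping" "HOL-Algebra.Free_Abelian_Groups"
    "HOL-Algebra.Ideal"
begin

section \<open>Complex vector spaces and Lie algebras\<close>

class complex_vector = ab_group_add +
  fixes scaleC :: "complex \<Rightarrow> 'a \<Rightarrow> 'a" (infixr \<open>*\<^sub>C\<close> 75)
  assumes scaleC_add_right: "a *\<^sub>C (x + y) = a *\<^sub>C x + a *\<^sub>C y"
    and scaleC_add_left: "(a + b) *\<^sub>C x = a *\<^sub>C x + b *\<^sub>C x"
    and scaleC_scaleC: "a *\<^sub>C b *\<^sub>C x = (a * b) *\<^sub>C x"
    and scaleC_one: "1 *\<^sub>C x = x"

interpretation cvec: vector_space "scaleC :: complex \<Rightarrow> 'a \<Rightarrow> 'a::complex_vector"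
  by unfold_locales (simp_all add: scaleC_add_right scaleC_add_left scaleC_scaleC scaleC_one)

text \<open>The library constant \<open>dim\<close> is \<open>0\<close> on infinite-dimensional spaces, so an upper bound on the
  dimension of a subspace is stated through the existence of a basis.\<close>

definition dim_le :: "'a::complex_vector set \<Rightarrow> nat \<Rightarrow> bool" where
  "dim_le S n \<longleftrightarrow> (\<exists>B. cvec.independent B \<and> cvec.span B = S \<and> finite B \<and> card B \<le> n)"

class complex_lie_algebra = complex_vector +
  fixes lie_bracket :: "'a \<Rightarrow> 'a \<Rightarrow> 'a"
  assumes bracket_add_left: "lie_bracket (x + y) z = lie_bracket x z + lie_bracket y z"
    and bracket_add_right: "lie_bracket z (x + y) = lie_bracket z x + lie_bracket z y"
    and bracket_scale_left: "lie_bracket (c *\<^sub>C x) y = c *\<^sub>C lie_bracket x y"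
    and bracket_scale_right: "lie_bracket x (c *\<^sub>C y) = c *\<^sub>C lie_bracket x y"
    and bracket_self: "lie_bracket x x = 0"
    and jacobi: "lie_bracket x (lie_bracket y z) + lie_bracket y (lie_bracket z x)
                   + lie_bracket z (lie_bracket x y) = 0"

definition lie_center :: "'g::complex_lie_algebra set" where
  "lie_center = {z. \<forall>x. lie_bracket z x = 0}"

lemma subspace_lie_center: "cvec.subspace (lie_center :: 'g::complex_lie_algebra set)"
proof -
  have "lie_bracket (0::'g) x = 0" for x
    using bracket_add_left[of "0::'g" 0 x] by simp
  then show ?thesis
    by (auto simp: cvec.subspace_def lie_center_def bracket_add_left bracket_scale_left)
qed


subsection \<open>The quotient vector space by the center\<close>

quotient_type (overloaded) 'g mod_center = "'g::complex_lie_algebra" / "\<lambda>x y. x - y \<in> lie_center"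
proof (rule equivpI)
  note sub = subspace_lie_center
  show "reflp (\<lambda>x y::'g. x - y \<in> lie_center)"
    by (auto intro!: reflpI cvec.subspace_0[OF sub])
  show "symp (\<lambda>x y::'g. x - y \<in> lie_center)"
    using cvec.subspace_neg[OF sub] by (intro sympI) fastforce
  show "transp (\<lambda>x y::'g. x - y \<in> lie_center)"
    using cvec.subspace_add[OF sub] by (intro transpI) fastforce
qed

instantiation mod_center :: (complex_lie_algebra) complex_vector
begin

lift_definition zero_mod_center :: "'a mod_center" is 0 .

lift_definition plus_mod_center :: "'a mod_center \<Rightarrow> 'a mod_center \<Rightarrow> 'a mod_center" is "(+)"
  by (metis (no_types, lifting) add_diff_add cvec.subspace_add subspace_lie_center)

lift_definition uminus_mod_center :: "'a mod_center \<Rightarrow> 'a mod_center" is uminus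
  by (metis cvec.subspace_neg minus_diff_minus subspace_lie_center)

lift_definition minus_mod_center :: "'a mod_center \<Rightarrow> 'a mod_center \<Rightarrow> 'a mod_center" is "(-)"
proof -
  fix a b c d :: 'a
  assume "a - b \<in> lie_center" "c - d \<in> lie_center"
  moreover have "a - c - (b - d) = (a - b) - (c - d)" by simp
  ultimately show "a - c - (b - d) \<in> lie_center"
    using cvec.subspace_diff[OF subspace_lie_center] by metis
qed

lift_definition scaleC_mod_center :: "complex \<Rightarrow> 'a mod_center \<Rightarrow> 'a mod_center" is scaleC
  by (metis cvec.scale_right_diff_distrib cvec.subspace_scale subspace_lie_center)

instance
  by (standard; transfer;
      simp add: algebra_simps cvec.subspace_0[OF subspace_lie_center] cvec.scale_right_distrib
        cvec.scale_left_distrib)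

end


section \<open>The universal enveloping algebra\<close>

text \<open>Words over \<open>'a\<close>; a copy of lists carrying the concatenation monoid, so that
  finitely supported functions on words are the free associative algebra on the set \<open>'a\<close>.\<close>

datatype 'a fword = FWord (letters: "'a list")

instantiation fword :: (type) monoid_add
begin
definition zero_fword :: "'a fword" where "0 = FWord []"
definition plus_fword :: "'a fword \<Rightarrow> 'a fword \<Rightarrow> 'a fword" where
  "u + v = FWord (letters u @ letters v)"
instance by standard (auto simp: zero_fword_def plus_fword_def)
end

type_synonym 'a free_alg = "'a fword \<Rightarrow>\<^sub>0 complex"

definition fgen :: "'a \<Rightarrow> 'a free_alg" where
  "fgen x = Poly_Mapping.single (FWord [x]) 1"

definition fconst :: "complex \<Rightarrow> 'a free_alg" where
  "fconst c = Poly_Mapping.single 0 c"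

text \<open>The two-sided ideal of the free algebra on the underlying set of the Lie algebra. The first two
  families of generators cut the free algebra down to the tensor algebra.\<close>

inductive_set uea_ideal :: "'g::complex_lie_algebra free_alg set" where
  gen_add: "fgen (x + y) - fgen x - fgen y \<in> uea_ideal"
| gen_scale: "fgen (c *\<^sub>C x) - fconst c * fgen x \<in> uea_ideal"
| gen_bracket: "fgen x * fgen y - fgen y * fgen x - fgen (lie_bracket x y) \<in> uea_ideal"
| zero: "0 \<in> uea_ideal"
| add: "p \<in> uea_ideal \<Longrightarrow> q \<in> uea_ideal \<Longrightarrow> p + q \<in> uea_ideal"
| mult: "p \<in> uea_ideal \<Longrightarrow> a * p * b \<in> uea_ideal"

lemma uea_ideal_mult_left: "p \<in> uea_ideal \<Longrightarrow> a * p \<in> uea_ideal"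
  using uea_ideal.mult[of p a 1] by simp

lemma uea_ideal_mult_right: "p \<in> uea_ideal \<Longrightarrow> p * b \<in> uea_ideal"
  using uea_ideal.mult[of p 1 b] by simp

lemma uea_ideal_minus: "p \<in> uea_ideal \<Longrightarrow> - p \<in> uea_ideal"
  using uea_ideal_mult_left[of p "-1"] by simp

lemma uea_ideal_diff: "p \<in> uea_ideal \<Longrightarrow> q \<in> uea_ideal \<Longrightarrow> p - q \<in> uea_ideal"
  using uea_ideal.add[OF _ uea_ideal_minus] by fastforce

quotient_type (overloaded) 'g uea = "'g::complex_lie_algebra free_alg" / "\<lambda>p q. p - q \<in> uea_ideal"
proof (rule equivpI)
  show "reflp (\<lambda>p q::'g free_alg. p - q \<in> uea_ideal)"
    by (auto intro!: reflpI uea_ideal.zero)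
  show "symp (\<lambda>p q::'g free_alg. p - q \<in> uea_ideal)"
    using uea_ideal_minus by (intro sympI) fastforce
  show "transp (\<lambda>p q::'g free_alg. p - q \<in> uea_ideal)"
    using uea_ideal.add by (intro transpI) fastforce
qed

lemma fconst_mult: "fconst (a * b) = fconst a * fconst b"
  by (simp add: fconst_def mult_single)

lemma fconst_add: "fconst (a + b) = fconst a + fconst b"
  by (simp add: fconst_def single_add)

lemma fconst_1: "fconst 1 = 1"
  by (simp add: fconst_def)

lemma lookup_mult_0:
  "Poly_Mapping.lookup (p * q) 0 = Poly_Mapping.lookup p 0 * Poly_Mapping.lookup q 0" for p q :: "'a free_alg"
proof -
  have *: "0 = u + v \<longleftrightarrow> u = 0 \<and> v = 0" for u v :: "'a fword"
    by (auto simp: zero_fword_def plus_fword_def) (metis fword.exhaust_sel)+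
  have "Poly_Mapping.lookup (p * q) 0 =
    (\<Sum>u. Poly_Mapping.lookup p u * (\<Sum>v. Poly_Mapping.lookup q v when v = 0) when u = 0)"
    unfolding lookup_mult * by (rule Sum_any.cong) (auto simp: when_def)
  then show ?thesis by simp
qed

lemma one_notin_uea_ideal: "1 \<notin> uea_ideal"
proof -
  have "Poly_Mapping.lookup p 0 = 0" if "p \<in> uea_ideal" for p :: "'a free_alg"
    using that
  proof induction
    case (gen_add x y)
    then show ?case by (simp add: lookup_minus fgen_def lookup_single zero_fword_def)
  next
    case (gen_scale c x)
    then show ?case by (simp add: lookup_minus fgen_def lookup_single zero_fword_def lookup_mult_0[unfolded zero_fword_def])
  next
    case (gen_bracket x y)
    then show ?case by (simp add: lookup_minus fgen_def lookup_single zero_fword_def lookup_mult_0[unfolded zero_fword_def])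
  qed (simp_all add: lookup_add lookup_mult_0)
  then show ?thesis by force
qed

instantiation uea :: (complex_lie_algebra) "{ring_1, complex_vector}"
begin

lift_definition zero_uea :: "'a uea" is 0 .

lift_definition one_uea :: "'a uea" is 1 .

lift_definition plus_uea :: "'a uea \<Rightarrow> 'a uea \<Rightarrow> 'a uea" is "(+)"
  using uea_ideal.add by (metis (no_types, lifting) add_diff_add)

lift_definition uminus_uea :: "'a uea \<Rightarrow> 'a uea" is uminus
  using uea_ideal_minus by (metis minus_diff_minus)

lift_definition minus_uea :: "'a uea \<Rightarrow> 'a uea \<Rightarrow> 'a uea" is "(-)"
proof -
  fix a b c d :: "'a free_alg"
  assume "a - b \<in> uea_ideal" "c - d \<in> uea_ideal"
  moreover have "a - c - (b - d) = (a - b) - (c - d)" by simp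
  ultimately show "a - c - (b - d) \<in> uea_ideal" using uea_ideal_diff by metis
qed

lift_definition times_uea :: "'a uea \<Rightarrow> 'a uea \<Rightarrow> 'a uea" is "(*)"
proof -
  fix a b c d :: "'a free_alg"
  assume "a - b \<in> uea_ideal" "c - d \<in> uea_ideal"
  moreover have "a * c - b * d = (a - b) * c + b * (c - d)" by (simp add: algebra_simps)
  ultimately show "a * c - b * d \<in> uea_ideal"
    by (metis uea_ideal.add uea_ideal_mult_left uea_ideal_mult_right)
qed

lift_definition scaleC_uea :: "complex \<Rightarrow> 'a uea \<Rightarrow> 'a uea" is "\<lambda>c p. fconst c * p"
  by (metis right_diff_distrib uea_ideal_mult_left)


instance
proof
  show "(0::'a uea) \<noteq> 1"
    by transfer (use one_notin_uea_ideal uea_ideal_minus in fastforce)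
qed (transfer; use uea_ideal.zero in \<open>simp add: algebra_simps fconst_mult fconst_add fconst_1\<close>)+

end

lift_definition uea_of :: "'g::complex_lie_algebra \<Rightarrow> 'g uea" is fgen .

lemma uea_of_bracket:
  "uea_of (lie_bracket x y) = uea_of x * uea_of y - uea_of y * uea_of x"
proof transfer
  fix x y :: 'a
  show "fgen (lie_bracket x y) - (fgen x * fgen y - fgen y * fgen x) \<in> uea_ideal"
    using uea_ideal_minus[OF uea_ideal.gen_bracket[of x y]] by simp
qed

definition is_subalgebra :: "'g::complex_lie_algebra uea set \<Rightarrow> bool" where
  "is_subalgebra B \<longleftrightarrow> cvec.subspace B \<and> 1 \<in> B \<and> (\<forall>a\<in>B. \<forall>b\<in>B. a * b \<in> B)"

definition subalgebra_gen :: "'g::complex_lie_algebra uea set \<Rightarrow> 'g uea set" where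
  "subalgebra_gen S = \<Inter>{B. is_subalgebra B \<and> S \<subseteq> B}"


section \<open>Graded Lie algebras\<close>

definition is_free_abelian :: "'q::ab_group_add itself \<Rightarrow> bool" where
  "is_free_abelian _ \<longleftrightarrow>
     (\<exists>B :: 'q set. \<lparr>carrier = (UNIV :: 'q set), mult = (+), one = 0\<rparr> \<cong> free_Abelian_group B)"

definition is_grading :: "('q::ab_group_add \<Rightarrow> 'g::complex_lie_algebra set) \<Rightarrow> bool" where
  "is_grading gr \<longleftrightarrow>
     (\<forall>\<alpha>. cvec.subspace (gr \<alpha>)) \<and>
     (\<forall>x. \<exists>!f :: 'q \<Rightarrow> 'g. (\<forall>\<alpha>. f \<alpha> \<in> gr \<alpha>) \<and> finite {\<alpha>. f \<alpha> \<noteq> 0} \<and>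
        x = (\<Sum>\<alpha> | f \<alpha> \<noteq> 0. f \<alpha>)) \<and>
     (\<forall>\<alpha> \<beta>. \<forall>x\<in>gr \<alpha>. \<forall>y\<in>gr \<beta>. lie_bracket x y \<in> gr (\<alpha> + \<beta>))"

definition n_part :: "('q::ab_group_add \<Rightarrow> 'g::complex_lie_algebra set) \<Rightarrow> ('q \<Rightarrow> int) \<Rightarrow> 'g set" where
  "n_part gr \<pi> = cvec.span (\<Union>\<alpha>\<in>{\<alpha>. \<pi> \<alpha> > 0}. gr \<alpha>)"

definition b_minus :: "('q::ab_group_add \<Rightarrow> 'g::complex_lie_algebra set) \<Rightarrow> ('q \<Rightarrow> int) \<Rightarrow> 'g set" where
  "b_minus gr \<pi> = cvec.span (\<Union>\<alpha>\<in>{\<alpha>. \<pi> \<alpha> \<le> 0}. gr \<alpha>)"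

text \<open>The component of degree \<open>\<alpha>\<close> of the quotient by the center is the image of \<open>gr \<alpha>\<close>.\<close>

definition Q_good :: "('q::ab_group_add \<Rightarrow> 'g::complex_lie_algebra set) \<Rightarrow> ('q \<Rightarrow> int) \<Rightarrow> bool" where
  "Q_good gr \<pi> \<longleftrightarrow>
     (\<forall>\<alpha>. \<pi> \<alpha> > 0 \<longrightarrow> dim_le (gr \<alpha>) 1) \<and>
     (\<forall>\<alpha>. \<pi> \<alpha> \<le> 0 \<longrightarrow> dim_le (abs_mod_center ` gr \<alpha>) 1)"

definition K_all :: "('q \<Rightarrow> 'g::complex_lie_algebra set) \<Rightarrow> 'q set" where
  "K_all gr = {\<alpha>. gr \<alpha> \<noteq> {0}}"

definition K_pos :: "('q \<Rightarrow> 'g::complex_lie_algebra set) \<Rightarrow> ('q \<Rightarrow> int) \<Rightarrow> 'q set" where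
  "K_pos gr \<pi> = K_all gr \<inter> {\<alpha>. \<pi> \<alpha> > 0}"

definition K_nonpos :: "('q \<Rightarrow> 'g::complex_lie_algebra set) \<Rightarrow> ('q \<Rightarrow> int) \<Rightarrow> 'q set" where
  "K_nonpos gr \<pi> = K_all gr \<inter> {\<alpha>. \<pi> \<alpha> \<le> 0}"

definition R_nonpos :: "('q \<Rightarrow> 'g::complex_lie_algebra set) \<Rightarrow> ('q \<Rightarrow> int) \<Rightarrow> 'q set" where
  "R_nonpos gr \<pi> = {\<alpha> \<in> K_nonpos gr \<pi>. lie_center \<inter> gr \<alpha> = gr \<alpha>}"

definition Z_minus :: "('q::ab_group_add \<Rightarrow> 'g::complex_lie_algebra set) \<Rightarrow> ('q \<Rightarrow> int) \<Rightarrow> 'g set" where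
  "Z_minus gr \<pi> = lie_center \<inter> b_minus gr \<pi>"

definition homogeneous_choice ::
  "('q::ab_group_add \<Rightarrow> 'g::complex_lie_algebra set) \<Rightarrow> ('q \<Rightarrow> int) \<Rightarrow> ('q \<Rightarrow> 'g) \<Rightarrow> bool" where
  "homogeneous_choice gr \<pi> x \<longleftrightarrow>
     (\<forall>\<alpha> \<in> K_all gr - R_nonpos gr \<pi>. x \<alpha> \<in> gr \<alpha> \<and> x \<alpha> \<noteq> 0 \<and> x \<alpha> \<notin> Z_minus gr \<pi>)"

text \<open>A homomorphism of Lie algebras from the subalgebra \<open>n\<close> to the abelian Lie algebra of complex
  numbers; the values of \<open>\<phi>\<close> outside \<open>n\<close> play no role.\<close>

definition lie_character :: "'g::complex_lie_algebra set \<Rightarrow> ('g \<Rightarrow> complex) \<Rightarrow> bool" where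
  "lie_character n \<phi> \<longleftrightarrow>
     (\<forall>x\<in>n. \<forall>y\<in>n. \<phi> (x + y) = \<phi> x + \<phi> y) \<and>
     (\<forall>c. \<forall>x\<in>n. \<phi> (c *\<^sub>C x) = c * \<phi> x) \<and>
     (\<forall>x\<in>n. \<forall>y\<in>n. \<phi> (lie_bracket x y) = 0)"

definition is_maximal_in :: "'q::order \<Rightarrow> 'q set \<Rightarrow> bool" where
  "is_maximal_in a S \<longleftrightarrow> a \<in> S \<and> (\<forall>b\<in>S. a \<le> b \<longrightarrow> b = a)"

definition nonsingular ::
  "('q::linordered_ab_group_add \<Rightarrow> 'g::complex_lie_algebra set) \<Rightarrow> ('q \<Rightarrow> int) \<Rightarrow> ('q \<Rightarrow> 'g) \<Rightarrow>
     ('g \<Rightarrow> complex) \<Rightarrow> bool" where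
  "nonsingular gr \<pi> x \<phi> \<longleftrightarrow>
     (let S = {\<alpha> \<in> K_pos gr \<pi>. \<phi> (x \<alpha>) \<noteq> 0}; \<alpha>\<^sub>\<phi> = (THE a. is_maximal_in a S) in
        (\<exists>!a. is_maximal_in a S) \<and>
        (\<forall>\<beta> \<in> K_nonpos gr \<pi> - R_nonpos gr \<pi>. \<exists>y \<in> gr (\<alpha>\<^sub>\<phi> - \<beta>). \<phi> (lie_bracket y (x \<beta>)) \<noteq> 0))"


section \<open>Modules\<close>

text \<open>The underlying vector space of a module is a subspace of an arbitrary complex vector space; this
  allows modules of different sizes to live in one type. The values of \<open>mact M x\<close> outside
  \<open>mspace M\<close> play no role.\<close>

record ('g, 'v) lie_mod =
  mspace :: "'v set"
  mact :: "'g \<Rightarrow> 'v \<Rightarrow> 'v"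

definition lie_module :: "('g::complex_lie_algebra, 'v::complex_vector) lie_mod \<Rightarrow> bool" where
  "lie_module M \<longleftrightarrow>
     cvec.subspace (mspace M) \<and>
     (\<forall>x. \<forall>v\<in>mspace M. mact M x v \<in> mspace M) \<and>
     (\<forall>x. \<forall>v\<in>mspace M. \<forall>w\<in>mspace M. mact M x (v + w) = mact M x v + mact M x w) \<and>
     (\<forall>x c. \<forall>v\<in>mspace M. mact M x (c *\<^sub>C v) = c *\<^sub>C mact M x v) \<and>
     (\<forall>x y. \<forall>v\<in>mspace M. mact M (x + y) v = mact M x v + mact M y v) \<and>
     (\<forall>x c. \<forall>v\<in>mspace M. mact M (c *\<^sub>C x) v = c *\<^sub>C mact M x v) \<and>
     (\<forall>x y. \<forall>v\<in>mspace M.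
        mact M (lie_bracket x y) v = mact M x (mact M y v) - mact M y (mact M x v))"

definition is_submodule ::
  "'v::complex_vector set \<Rightarrow> ('g::complex_lie_algebra, 'v) lie_mod \<Rightarrow> bool" where
  "is_submodule W M \<longleftrightarrow>
     cvec.subspace W \<and> W \<subseteq> mspace M \<and> (\<forall>x. \<forall>v\<in>W. mact M x v \<in> W)"

definition generates :: "'v::complex_vector \<Rightarrow> ('g::complex_lie_algebra, 'v) lie_mod \<Rightarrow> bool" where
  "generates v M \<longleftrightarrow> v \<in> mspace M \<and> (\<forall>W. is_submodule W M \<and> v \<in> W \<longrightarrow> W = mspace M)"

definition whittaker_vector ::
  "'g::complex_lie_algebra set \<Rightarrow> ('g \<Rightarrow> complex) \<Rightarrow> ('g, 'v::complex_vector) lie_mod \<Rightarrow> 'v \<Rightarrow> bool" where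
  "whittaker_vector n \<phi> M v \<longleftrightarrow> v \<in> mspace M \<and> (\<forall>x\<in>n. mact M x v = \<phi> x *\<^sub>C v)"

definition whittaker_module ::
  "'g::complex_lie_algebra set \<Rightarrow> ('g \<Rightarrow> complex) \<Rightarrow> ('g, 'v::complex_vector) lie_mod \<Rightarrow> bool" where
  "whittaker_module n \<phi> M \<longleftrightarrow>
     lie_module M \<and> (\<exists>v. whittaker_vector n \<phi> M v \<and> generates v M)"

definition lie_mod_iso ::
  "('g::complex_lie_algebra, 'v::complex_vector) lie_mod \<Rightarrow>
     ('g, 'w::complex_vector) lie_mod \<Rightarrow> bool" where
  "lie_mod_iso M N \<longleftrightarrow>
     (\<exists>f. bij_betw f (mspace M) (mspace N) \<and>
        (\<forall>v\<in>mspace M. \<forall>w\<in>mspace M. f (v + w) = f v + f w) \<and>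
        (\<forall>c. \<forall>v\<in>mspace M. f (c *\<^sub>C v) = c *\<^sub>C f v) \<and>
        (\<forall>x. \<forall>v\<in>mspace M. f (mact M x v) = mact N x (f v)))"

text \<open>The set of all Whittaker modules within one type \<open>'v\<close>. A Whittaker module is a quotient of the enveloping
  algebra, so the type \<open>'g uea\<close> contains a copy of every Whittaker module.\<close>

definition whittaker_modules ::
  "'g::complex_lie_algebra set \<Rightarrow> ('g \<Rightarrow> complex) \<Rightarrow> ('g, 'v::complex_vector) lie_mod set" where
  "whittaker_modules n \<phi> = {M. whittaker_module n \<phi> M}"

definition whittaker_iso_rel ::
  "'g::complex_lie_algebra set \<Rightarrow> ('g \<Rightarrow> complex) \<Rightarrow> ('g, 'v::complex_vector) lie_mod rel" where
  "whittaker_iso_rel n \<phi> =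
     {(M, N). M \<in> whittaker_modules n \<phi> \<and> N \<in> whittaker_modules n \<phi> \<and> lie_mod_iso M N}"


subsection \<open>The action of the enveloping algebra\<close>

definition free_act ::
  "('g::complex_lie_algebra, 'v::complex_vector) lie_mod \<Rightarrow> 'g free_alg \<Rightarrow> 'v \<Rightarrow> 'v" where
  "free_act M p v =
     (\<Sum>w\<in>Poly_Mapping.keys p. Poly_Mapping.lookup p w *\<^sub>C foldr (mact M) (letters w) v)"

text \<open>Independence of the chosen representative is lemma \<open>uea_act_abs\<close> below.\<close>

definition uea_act ::
  "('g::complex_lie_algebra, 'v::complex_vector) lie_mod \<Rightarrow> 'g uea \<Rightarrow> 'v \<Rightarrow> 'v" where
  "uea_act M u v = free_act M (rep_uea u) v"

lemma free_alg_induct [case_names zero add]: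
  fixes p :: "'a free_alg"
  assumes "P 0" and step: "\<And>p w c. P p \<Longrightarrow> P (p + Poly_Mapping.single w c)"
  shows "P p"
proof (induction p rule: update_induct)
  case (update p w c)
  have "Poly_Mapping.update w c p = p + Poly_Mapping.single w c"
    using update.hyps
    by (intro poly_mapping_eqI) (auto simp: lookup_update lookup_add lookup_single in_keys_iff when_def)
  then show ?case using step update.IH by simp
qed fact

lemma free_act_0 [simp]: "free_act M 0 v = 0"
  by (simp add: free_act_def)

lemma free_act_single: "free_act M (Poly_Mapping.single w c) v = c *\<^sub>C foldr (mact M) (letters w) v"
  by (simp add: free_act_def)

lemma free_act_add: "free_act M (p + q) v = free_act M p v + free_act M q v"
  unfolding free_act_def
  by (rule setsum_keys_plus_distrib) (simp_all add: cvec.scale_left_distrib)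

lemma free_act_minus: "free_act M (- p) v = - free_act M p v"
  using free_act_add[of M p "- p" v] by (simp add: eq_neg_iff_add_eq_0 add.commute)

lemma free_act_diff: "free_act M (p - q) v = free_act M p v - free_act M q v"
  using free_act_add[of M p "- q" v] by (simp add: free_act_minus)

lemma free_act_fgen [simp]: "free_act M (fgen x) v = mact M x v"
  by (simp add: fgen_def free_act_single)

lemma free_act_1 [simp]: "free_act M 1 v = v"
  using free_act_single[of M 0 1 v] unfolding single_one by (simp add: zero_fword_def)

context
  fixes M :: "('g::complex_lie_algebra, 'v::complex_vector) lie_mod"
  assumes M: "lie_module M"
begin

lemma mact_closed: "v \<in> mspace M \<Longrightarrow> mact M x v \<in> mspace M"
  and mact_add: "v \<in> mspace M \<Longrightarrow> w \<in> mspace M \<Longrightarrow> mact M x (v + w) = mact M x v + mact M x w"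
  and mact_scale: "v \<in> mspace M \<Longrightarrow> mact M x (c *\<^sub>C v) = c *\<^sub>C mact M x v"
  and mspace_subspace: "cvec.subspace (mspace M)"
  using M by (auto simp: lie_module_def)

lemma foldr_mact:
  assumes "v \<in> mspace M"
  shows "foldr (mact M) xs v \<in> mspace M"
    and "w \<in> mspace M \<Longrightarrow>
      foldr (mact M) xs (v + w) = foldr (mact M) xs v + foldr (mact M) xs w"
    and "foldr (mact M) xs (c *\<^sub>C v) = c *\<^sub>C foldr (mact M) xs v"
proof -
  have closed: "foldr (mact M) xs v \<in> mspace M" if "v \<in> mspace M" for v xs
    using that by (induction xs) (auto intro: mact_closed)
  show "foldr (mact M) xs v \<in> mspace M" using closed assms .
  show "foldr (mact M) xs (v + w) = foldr (mact M) xs v + foldr (mact M) xs w"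
    if "w \<in> mspace M"
    using that assms by (induction xs) (simp_all add: closed mact_add)
  show "foldr (mact M) xs (c *\<^sub>C v) = c *\<^sub>C foldr (mact M) xs v"
    using assms by (induction xs) (simp_all add: closed mact_scale)
qed

lemma free_act_closed: "v \<in> mspace M \<Longrightarrow> free_act M p v \<in> mspace M"
  unfolding free_act_def
  by (intro cvec.subspace_sum cvec.subspace_scale mspace_subspace foldr_mact)

lemma free_act_add_right:
  "v \<in> mspace M \<Longrightarrow> w \<in> mspace M \<Longrightarrow> free_act M p (v + w) = free_act M p v + free_act M p w"
  by (simp add: free_act_def foldr_mact cvec.scale_right_distrib sum.distrib)

lemma free_act_zero_right: "free_act M p 0 = 0"
  using free_act_add_right[of 0 0 p] cvec.subspace_0[OF mspace_subspace] by simp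

lemma free_act_mult:
  assumes v: "v \<in> mspace M"
  shows "free_act M (p * q) v = free_act M p (free_act M q v)"
proof (induction q rule: free_alg_induct)
  case zero
  then show ?case by (simp add: free_act_zero_right)
next
  case (add q w c)
  have "free_act M (p * Poly_Mapping.single w c) v = free_act M p (free_act M (Poly_Mapping.single w c) v)"
    by (induction p rule: free_alg_induct)
      (simp_all add: free_act_add distrib_right mult_single free_act_single plus_fword_def
        foldr_mact v)
  then show ?case
    by (simp add: distrib_left free_act_add add free_act_add_right free_act_closed v)
qed

lemma free_act_uea_ideal:
  assumes "p \<in> uea_ideal" "v \<in> mspace M"
  shows "free_act M p v = 0"
  using assms
proof (induction arbitrary: v)
  case (gen_add x y)
  then show ?case using M by (simp add: free_act_diff lie_module_def)
next
  case (gen_scale c x)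
  then show ?case using M
    by (simp add: free_act_diff free_act_mult lie_module_def fconst_def free_act_single zero_fword_def)
next
  case (gen_bracket x y)
  then show ?case using M by (simp add: free_act_diff free_act_mult lie_module_def)
next
  case (mult p a b)
  then show ?case by (simp add: free_act_mult free_act_closed free_act_zero_right)
qed (simp_all add: free_act_add)

lemma uea_act_abs:
  assumes "v \<in> mspace M"
  shows "uea_act M (abs_uea p) v = free_act M p v"
proof -
  have "rep_uea (abs_uea p) - p \<in> uea_ideal"
    using Quotient3_abs_rep[OF Quotient3_uea, of "abs_uea p"] unfolding uea.abs_eq_iff .
  from free_act_uea_ideal[OF this assms] show ?thesis
    by (simp add: uea_act_def free_act_diff)
qed

lemma uea_act_uea_of: "v \<in> mspace M \<Longrightarrow> uea_act M (uea_of x) v = mact M x v"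
  by (simp add: uea_of.abs_eq uea_act_abs)

lemma uea_act_mult:
  assumes "v \<in> mspace M"
  shows "uea_act M (a * b) v = uea_act M a (uea_act M b v)"
proof (induction a; induction b)
  fix p q
  show "uea_act M (abs_uea q * abs_uea p) v = uea_act M (abs_uea q) (uea_act M (abs_uea p) v)"
    by (simp add: times_uea.abs_eq uea_act_abs free_act_mult free_act_closed assms)
qed

end

definition annihilator ::
  "('g::complex_lie_algebra, 'v::complex_vector) lie_mod \<Rightarrow> 'g uea set" where
  "annihilator M = {u. \<forall>v\<in>mspace M. uea_act M u v = 0}"


section \<open>The central subalgebra\<close>

text \<open>The symmetric algebra of the central subspace \<open>Z_minus gr \<pi>\<close>, realized inside the enveloping algebra
  as the unital subalgebra generated by this subspace (by Poincare-Birkhoff-Witt the canonical map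
  from the symmetric algebra is injective).\<close>

definition S_Z :: "('q::ab_group_add \<Rightarrow> 'g::complex_lie_algebra set) \<Rightarrow> ('q \<Rightarrow> int) \<Rightarrow> 'g uea set" where
  "S_Z gr \<pi> = subalgebra_gen (uea_of ` Z_minus gr \<pi>)"

definition S_Z_ring ::
  "('q::ab_group_add \<Rightarrow> 'g::complex_lie_algebra set) \<Rightarrow> ('q \<Rightarrow> int) \<Rightarrow> 'g uea ring" where
  "S_Z_ring gr \<pi> = \<lparr>carrier = S_Z gr \<pi>, mult = (*), one = 1, zero = 0, add = (+)\<rparr>"

definition A_of ::
  "('q::ab_group_add \<Rightarrow> 'g::complex_lie_algebra set) \<Rightarrow> ('q \<Rightarrow> int) \<Rightarrow>
     ('g, 'v::complex_vector) lie_mod \<Rightarrow> 'g uea set" where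
  "A_of gr \<pi> M = S_Z gr \<pi> \<inter> annihilator M"

end

theory Submission
  imports Defs "HOL-Library.Function_Algebras" "HOL-Library.Multiset"
begin

text \<open>A cyclic module is \<open>U(\<g>)/J\<close> for the annihilator \<open>J\<close> of its cyclic vector, so Whittaker
  modules correspond to left ideals \<open>J\<close> containing all \<open>q - \<phi>(q)\<close> with \<open>q\<close> in \<open>\<n>\<close>, and \<open>A\<^sub>V = A \<inter> J\<close>
  because \<open>A\<close> is central. Every ideal \<open>I\<close> of \<open>A\<close> is of the form \<open>A \<inter> J\<close>: by the
  Poincare-Birkhoff-Witt theorem the character of \<open>Z'' + \<n>\<close> with values in \<open>A\<close> extends to an \<open>A\<close>-linear
  retraction \<open>\<Lambda>\<close> of \<open>U(\<g>)\<close> onto \<open>A\<close> with \<open>\<Lambda>(u q) = \<phi>(q) \<Lambda>(u)\<close>, and one takes the \<open>u\<close> with \<open>\<Lambda>(v u) \<in> I\<close> for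
  all \<open>v\<close>. Conversely \<open>J\<close> is determined by \<open>A \<inter> J\<close>: modulo \<open>J\<close> every element of \<open>U(\<g>)\<close> is a combination of
  ordered monomials in the \<open>x\<^sub>\<beta>\<close> with coefficients in \<open>A\<close>, and if such a combination lies in \<open>J\<close>, commutators with
  the elements provided by nonsingularity act on its leading part like partial derivatives, so that by induction on a
  Kazhdan-type weight all its coefficients lie in \<open>J\<close>.\<close>

text \<open>The enveloping algebra is given by generators and relations, which do not show that
  ordered monomials are independent; the retraction needs this, so it is derived from a confluence
  argument on words. The character sends z in Z'' to its own class in A and q in n to the scalar
  \<phi>(q). Its values lie in A rather than in the complex numbers, so a single \<Lambda> serves
  all ideals I.

  For the uniqueness of J the obstacle is that a commutator with a monomial yields many terms. With
  h = \<pi>(\<alpha>_\<phi>) > 0, a letter of degree \<alpha> gets weight h - \<pi>(\<alpha>). A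
  bracket merges two letters and loses weight h, and \<phi> vanishes on letters of negative weight,
  so reduction modulo J does not raise the weight. Ties between degrees with the same image under
  \<pi> remain. The order of Q breaks them: for \<gamma> > \<beta> an element y of degree
  \<alpha>_\<phi> - \<beta> brackets x_\<gamma> into a degree above \<alpha>_\<phi>, where \<phi>
  vanishes because \<alpha>_\<phi> is maximal and the components of n are at most one-dimensional.
  Hence \<beta> is taken smallest.\<close>

instantiation "fun" :: (type, complex_vector) complex_vector
begin

definition scaleC_fun :: "complex \<Rightarrow> ('a \<Rightarrow> 'b) \<Rightarrow> 'a \<Rightarrow> 'b" where
  "scaleC_fun c f = (\<lambda>x. c *\<^sub>C f x)"

instance
  by standard (simp_all add: scaleC_fun_def fun_eq_iff cvec.scale_right_distrib cvec.scale_left_distrib)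

end

lemma scaleC_fun_apply [simp]: "(c *\<^sub>C f) x = c *\<^sub>C f x"
  by (simp add: scaleC_fun_def)

context
  fixes M :: "('g::complex_lie_algebra, 'v::complex_vector) lie_mod" and v :: 'v
  assumes M: "lie_module M" and v: "v \<in> mspace M"
begin

lemma uea_act_closed: "uea_act M u v \<in> mspace M"
  by (simp add: uea_act_def free_act_closed[OF M v])

lemma uea_act_add: "uea_act M (a + b) v = uea_act M a v + uea_act M b v"
proof (induction a; induction b)
  fix p q
  show "uea_act M (abs_uea q + abs_uea p) v = uea_act M (abs_uea q) v + uea_act M (abs_uea p) v"
    by (simp add: plus_uea.abs_eq uea_act_abs[OF M v] free_act_add)
qed

lemma uea_act_scale: "uea_act M (c *\<^sub>C a) v = c *\<^sub>C uea_act M a v"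
proof (induction a)
  fix p
  show "uea_act M (c *\<^sub>C abs_uea p) v = c *\<^sub>C uea_act M (abs_uea p) v"
    by (simp add: scaleC_uea.abs_eq uea_act_abs[OF M v] free_act_mult[OF M v] fconst_def
        free_act_single zero_fword_def)
qed

lemma uea_act_1: "uea_act M 1 v = v"
  by (simp add: one_uea_def uea_act_abs[OF M v])

lemma uea_act_prod_list: "uea_act M (prod_list (map uea_of xs)) v = foldr (mact M) xs v"
  by (induction xs)
    (simp_all add: uea_act_1 uea_act_mult[OF M v] uea_act_uea_of[OF M] foldr_mact(1)[OF M v])

end

section \<open>The Poincare-Birkhoff-Witt theorem\<close>

fun inversions :: "('a \<Rightarrow> 'a \<Rightarrow> bool) \<Rightarrow> 'a list \<Rightarrow> nat" where
  "inversions r [] = 0"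
| "inversions r (a # w) = length (filter (\<lambda>b. r b a) w) + inversions r w"

lemma inversions_swap:
  assumes "r b a" "\<not> r a b"
  shows "inversions r (u @ b # a # v) < inversions r (u @ a # b # v)"
  using assms by (induction u) auto

text \<open>Straightening replaces a descent by the swapped word, which has the same length and
  fewer inversions, and by bracket terms, which are shorter but may have more inversions. Hence
  length is compared first.\<close>

definition word_order :: "('a \<Rightarrow> 'a \<Rightarrow> bool) \<Rightarrow> ('a list \<times> 'a list) set" where
  "word_order r = measures [length, inversions r]"

lemma wf_word_order: "wf (word_order r)"
  by (simp add: word_order_def)

lemma word_order_shorter: "length v < length w \<Longrightarrow> (v, w) \<in> word_order r"
  by (simp add: word_order_def)

lemma word_order_swap:
  "r b a \<Longrightarrow> \<not> r a b \<Longrightarrow> (u @ b # a # v, u @ a # b # v) \<in> word_order r"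
  by (simp add: word_order_def inversions_swap)

section \<open>Linear extension from a basis\<close>

interpretation cpair: vector_space_pair "scaleC :: complex \<Rightarrow> 'a \<Rightarrow> 'a::complex_vector"
  "scaleC :: complex \<Rightarrow> 'b \<Rightarrow> 'b::complex_vector"
  by unfold_locales

abbreviation clinear :: "('a::complex_vector \<Rightarrow> 'b::complex_vector) \<Rightarrow> bool" where
  "clinear \<equiv> Vector_Spaces.linear scaleC scaleC"

lemma clinearI:
  assumes "\<And>x y. f (x + y) = f x + f y" "\<And>c x. f (c *\<^sub>C x) = c *\<^sub>C f x"
  shows "clinear f"
  using assms by unfold_locales auto

text \<open>Only the values of \<open>f\<close> on \<open>B\<close> enter, since the representation
  vanishes elsewhere. As an explicit finite sum the extension is visibly linear in \<open>f\<close>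
  as well, and two extensions can be interchanged (\<open>basis_ext_swap\<close>).\<close>

definition basis_ext :: "'a::complex_vector set \<Rightarrow> ('a \<Rightarrow> 'b::complex_vector) \<Rightarrow> 'a \<Rightarrow> 'b" where
  "basis_ext B f x = (\<Sum>b | cvec.representation B x b \<noteq> 0. cvec.representation B x b *\<^sub>C f b)"

lemma basis_ext_superset:
  assumes "finite S" "{b. cvec.representation B x b \<noteq> 0} \<subseteq> S"
  shows "basis_ext B f x = (\<Sum>b\<in>S. cvec.representation B x b *\<^sub>C f b)"
  unfolding basis_ext_def using assms by (intro sum.mono_neutral_left) auto

lemma basis_ext_add_fun:
  "basis_ext B (\<lambda>b. f b + g b) x = basis_ext B f x + basis_ext B g x"
  by (simp add: basis_ext_def cvec.scale_right_distrib sum.distrib)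

lemma basis_ext_diff_fun:
  "basis_ext B (\<lambda>b. f b - g b) x = basis_ext B f x - basis_ext B g x"
  by (simp add: basis_ext_def cvec.scale_right_diff_distrib sum_subtractf)

lemma basis_ext_scale_fun:
  "basis_ext B (\<lambda>b. c *\<^sub>C f b) x = c *\<^sub>C basis_ext B f x"
  by (simp add: basis_ext_def cvec.scale_sum_right mult.commute)

lemma basis_ext_zero_fun: "basis_ext B (\<lambda>b. 0) x = 0"
  by (simp add: basis_ext_def)

lemma basis_ext_swap:
  "basis_ext B (\<lambda>b. basis_ext B (f b) y) x = basis_ext B (\<lambda>c. basis_ext B (\<lambda>b. f b c) x) y"
  unfolding basis_ext_def cvec.scale_sum_right
  by (subst sum.swap) (simp add: mult.commute)

lemma basis_ext_cong:
  assumes "\<And>b. b \<in> B \<Longrightarrow> f b = g b"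
  shows "basis_ext B f x = basis_ext B g x"
  unfolding basis_ext_def using assms cvec.representation_ne_zero by (intro sum.cong) auto

lemma clinear_basis_ext:
  assumes "cvec.independent B" "cvec.span B = UNIV"
  shows "clinear (basis_ext B f)"
proof (rule clinearI)
  fix x y :: 'a
  let ?S = "{b. cvec.representation B x b \<noteq> 0} \<union> {b. cvec.representation B y b \<noteq> 0}"
  have fin: "finite ?S" by (simp add: cvec.finite_representation)
  have "basis_ext B f (x + y) = (\<Sum>b\<in>?S. cvec.representation B (x + y) b *\<^sub>C f b)"
    using fin assms by (intro basis_ext_superset) (auto simp: cvec.representation_add)
  also have "\<dots> = basis_ext B f x + basis_ext B f y"
    using assms fin
    by (simp add: basis_ext_superset[OF fin, of B x] basis_ext_superset[OF fin, of B y]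
        cvec.representation_add cvec.scale_left_distrib sum.distrib)
  finally show "basis_ext B f (x + y) = basis_ext B f x + basis_ext B f y" .
next
  fix c :: complex and x :: 'a
  have "basis_ext B f (c *\<^sub>C x) =
      (\<Sum>b | cvec.representation B x b \<noteq> 0. cvec.representation B (c *\<^sub>C x) b *\<^sub>C f b)"
    using assms by (intro basis_ext_superset) (auto simp: cvec.representation_scale cvec.finite_representation)
  also have "\<dots> = c *\<^sub>C basis_ext B f x"
    using assms by (simp add: basis_ext_def cvec.representation_scale cvec.scale_sum_right)
  finally show "basis_ext B f (c *\<^sub>C x) = c *\<^sub>C basis_ext B f x" .
qed

lemma basis_ext_basis:
  assumes "cvec.independent B" "b \<in> B"
  shows "basis_ext B f b = f b"
proof -
  have "basis_ext B f b = (\<Sum>c\<in>{b}. cvec.representation B b c *\<^sub>C f c)"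
    using assms by (intro basis_ext_superset) (auto simp: cvec.representation_basis split: if_splits)
  then show ?thesis using assms by (simp add: cvec.representation_basis)
qed

lemma basis_ext_unique:
  assumes "cvec.independent B" "cvec.span B = UNIV" "clinear g" "\<And>b. b \<in> B \<Longrightarrow> g b = f b"
  shows "basis_ext B f x = g x"
proof -
  have "basis_ext B f x = basis_ext B g x"
    using assms(4) by (intro basis_ext_cong) simp
  also have "\<dots> = g (\<Sum>b | cvec.representation B x b \<noteq> 0. cvec.representation B x b *\<^sub>C b)"
    by (simp add: basis_ext_def cpair.linear_sum[OF assms(3)] cpair.linear_scale[OF assms(3)])
  finally show ?thesis
    using cvec.sum_nonzero_representation_eq[OF assms(1), of x] assms(2) by simp
qed

text \<open>Any strict total order will do: straightening terminates by length and inversions, so no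
  well-foundedness is imposed on the order of the letters.\<close>

locale ordered_lie_basis =
  fixes B :: "'g::complex_lie_algebra set" and less :: "'g \<Rightarrow> 'g \<Rightarrow> bool" (infix \<open>\<sqsubset>\<close> 50)
  assumes independent: "cvec.independent B" and span: "cvec.span B = UNIV"
    and asym: "a \<sqsubset> b \<Longrightarrow> \<not> b \<sqsubset> a"
    and trans: "a \<sqsubset> b \<Longrightarrow> b \<sqsubset> c \<Longrightarrow> a \<sqsubset> c"
    and total: "a \<noteq> b \<Longrightarrow> a \<sqsubset> b \<or> b \<sqsubset> a"
begin

abbreviation ext :: "('g \<Rightarrow> 'b::complex_vector) \<Rightarrow> 'g \<Rightarrow> 'b" where
  "ext \<equiv> basis_ext B"

lemma linear_ext: "clinear (ext f)"
  using clinear_basis_ext[OF independent span] .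

lemmas ext_add = cpair.linear_add[OF linear_ext]
  and ext_scale = cpair.linear_scale[OF linear_ext]
  and ext_diff = cpair.linear_diff[OF linear_ext]
  and ext_0 = cpair.linear_0[OF linear_ext]
  and ext_neg = cpair.linear_neg[OF linear_ext]

section \<open>Straightening of words and its confluence\<close>

definition descent :: "'g list \<Rightarrow> 'g list \<times> 'g \<times> 'g \<times> 'g list \<Rightarrow> bool" where
  "descent w d = (case d of (u, a, b, v) \<Rightarrow> w = u @ a # b # v \<and> b \<sqsubset> a)"

definition some_descent :: "'g list \<Rightarrow> 'g list \<times> 'g \<times> 'g \<times> 'g list" where
  "some_descent w = (SOME d. descent w d)"

text \<open>The functional with values \<open>f\<close> on sorted words that straightening forces on
  all other words. At each stage one descent is picked by \<open>SOME\<close>; that the result does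
  not depend on the picks is the content of \<open>norm_form_straight\<close>.\<close>

function norm_form :: "('g list \<Rightarrow> 'b::complex_vector) \<Rightarrow> 'g list \<Rightarrow> 'b" where
  "norm_form f w = (if \<exists>d. descent w d then
     (case some_descent w of (u, a, b, v) \<Rightarrow>
        norm_form f (u @ b # a # v) +
        (\<Sum>c | cvec.representation B (lie_bracket a b) c \<noteq> 0.
           cvec.representation B (lie_bracket a b) c *\<^sub>C norm_form f (u @ c # v)))
   else f w)"
  by pat_completeness auto

termination
proof (relation "inv_image (word_order less) snd", goal_cases)
  case 1
  then show ?case by (simp add: wf_word_order)
next
  case (2 f w u p a q b v)
  then have "descent w (u, a, b, v)" using someI_ex[of "descent w"] by (auto simp: some_descent_def)
  then show ?case using word_order_swap[of "(\<sqsubset>)" b a u v] asym[of b a]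
    by (auto simp: descent_def)
next
  case (3 f w u p a q b v c)
  then have "descent w (u, a, b, v)" using someI_ex[of "descent w"] by (auto simp: some_descent_def)
  then show ?case by (auto simp: descent_def intro: word_order_shorter)
qed

declare norm_form.simps [simp del]

lemma norm_form_sorted: "(\<And>u a b v. w = u @ a # b # v \<Longrightarrow> \<not> b \<sqsubset> a) \<Longrightarrow> norm_form f w = f w"
  by (subst norm_form.simps) (auto simp: descent_def)

lemma norm_form_descent:
  assumes "w = u @ a # b # v" "b \<sqsubset> a"
  obtains u a b v where "w = u @ a # b # v" "b \<sqsubset> a"
    "norm_form f w = norm_form f (u @ b # a # v) + ext (\<lambda>c. norm_form f (u @ c # v)) (lie_bracket a b)"
proof -
  have ex: "\<exists>d. descent w d" using assms by (auto simp: descent_def)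
  then have "descent w (some_descent w)" unfolding some_descent_def by (rule someI_ex)
  then show thesis
    using that ex norm_form.simps[of f w] by (auto simp: descent_def basis_ext_def split: prod.splits)
qed

text \<open>The relation a b = b a + [a, b] of U(g), in the context \<open>u\<close>,
  \<open>v\<close>, tested against a functional \<open>l\<close> on words; the bracket is expanded
  in the basis \<open>B\<close>.\<close>

definition straight :: "('g list \<Rightarrow> 'b::complex_vector) \<Rightarrow> 'g list \<Rightarrow> 'g \<Rightarrow> 'g \<Rightarrow> 'g list \<Rightarrow> bool" where
  "straight l u a b v \<longleftrightarrow>
     l (u @ a # b # v) = l (u @ b # a # v) + ext (\<lambda>c. l (u @ c # v)) (lie_bracket a b)"

lemma bracket_commute: "lie_bracket a b = - lie_bracket b (a::'g)"
proof -
  have "lie_bracket a b + lie_bracket b a = lie_bracket (a + b) (a + b)"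
    unfolding bracket_add_left bracket_add_right by (simp add: bracket_self)
  then show ?thesis
    by (simp add: bracket_self eq_neg_iff_add_eq_0)
qed

lemma straight_refl: "straight l u a a v"
  by (simp add: straight_def bracket_self ext_0)

lemma straight_sym: "straight l u a b v \<Longrightarrow> straight l u b a v"
  unfolding straight_def bracket_commute[of b a] by (simp add: ext_neg)

text \<open>Both sides are linear in \<open>x\<close>. The extension from basis letters to arbitrary
  elements is what makes the relation applicable to letters that are themselves brackets.\<close>

lemma straight_ext:
  assumes "\<And>a. a \<in> B \<Longrightarrow> straight l u a b v"
  shows "ext (\<lambda>a. l (u @ a # b # v)) x =
    ext (\<lambda>a. l (u @ b # a # v)) x + ext (\<lambda>c. l (u @ c # v)) (lie_bracket x b)"
proof -
  have "ext (\<lambda>a. l (u @ a # b # v) - l (u @ b # a # v)) x = ext (\<lambda>c. l (u @ c # v)) (lie_bracket x b)"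
  proof (rule basis_ext_unique[OF independent span])
    show "clinear (\<lambda>x. ext (\<lambda>c. l (u @ c # v)) (lie_bracket x b))"
      by (rule clinearI) (simp_all add: bracket_add_left bracket_scale_left ext_add ext_scale)
  qed (use assms in \<open>simp add: straight_def\<close>)
  then show ?thesis by (simp add: basis_ext_diff_fun algebra_simps)
qed

text \<open>Rewriting the second pair in every term on the left and the first pair in every term on
  the right produces the same terms; the two double sums over brackets agree by
  \<open>basis_ext_swap\<close>.\<close>

lemma straight_disjoint:
  assumes "straight l u a b (t @ d # c # v)" "straight l (u @ b # a # t) c d v"
    and "\<And>e. e \<in> B \<Longrightarrow> straight l u a b (t @ e # v)"
    and "\<And>e. e \<in> B \<Longrightarrow> straight l (u @ e # t) c d v"
  shows "l (u @ a # b # t @ d # c # v) + ext (\<lambda>e. l (u @ a # b # t @ e # v)) (lie_bracket c d) =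
    l (u @ b # a # t @ c # d # v) + ext (\<lambda>e. l (u @ e # t @ c # d # v)) (lie_bracket a b)"
proof -
  have 1: "ext (\<lambda>e. l (u @ a # b # t @ e # v)) (lie_bracket c d) =
      ext (\<lambda>e. l (u @ b # a # t @ e # v)) (lie_bracket c d) +
      ext (\<lambda>e. ext (\<lambda>k. l (u @ k # t @ e # v)) (lie_bracket a b)) (lie_bracket c d)"
    unfolding basis_ext_add_fun[symmetric] using assms(3) by (intro basis_ext_cong) (simp add: straight_def)
  have 2: "ext (\<lambda>e. l (u @ e # t @ c # d # v)) (lie_bracket a b) =
      ext (\<lambda>e. l (u @ e # t @ d # c # v)) (lie_bracket a b) +
      ext (\<lambda>e. ext (\<lambda>k. l (u @ e # t @ k # v)) (lie_bracket c d)) (lie_bracket a b)"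
    unfolding basis_ext_add_fun[symmetric] using assms(4) by (intro basis_ext_cong) (simp add: straight_def)
  show ?thesis
    using assms(1,2) unfolding straight_def 1 2
    by (simp add: basis_ext_swap[where x = "lie_bracket c d"])
qed

text \<open>Both sides are reduced to the reversed word c b a. The remaining terms pair up as the
  same bracket standing before and after the same letter; moving it across leaves three double
  brackets, which cancel by the Jacobi identity.\<close>

lemma straight_overlap:
  assumes ac: "straight l (u @ [b]) a c v" and bc: "straight l u b c (a # v)"
    and ac': "straight l u a c (b # v)" and ab: "straight l (u @ [c]) a b v"
    and short: "\<And>x y. x \<in> B \<Longrightarrow> y \<in> {a, b, c} \<Longrightarrow> straight l u x y v"
  shows "l (u @ b # a # c # v) + ext (\<lambda>e. l (u @ e # c # v)) (lie_bracket a b) =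
    l (u @ a # c # b # v) + ext (\<lambda>e. l (u @ a # e # v)) (lie_bracket b c)"
proof -
  let ?m = "\<lambda>x y z. l (u @ x # y # z # v)"
  let ?l = "\<lambda>x y. ext (\<lambda>e. l (u @ e # y # v)) x"
  let ?r = "\<lambda>y x. ext (\<lambda>e. l (u @ y # e # v)) x"
  let ?s = "\<lambda>x. ext (\<lambda>e. l (u @ e # v)) x"
  have lr: "?l x y = ?r y x + ?s (lie_bracket x y)" if "y \<in> {a, b, c}" for x y
    by (rule straight_ext) (use short that in blast)
  have 1: "?m b a c = ?m c b a + ?l (lie_bracket b c) a + ?r b (lie_bracket a c)"
    using ac bc by (simp add: straight_def)
  have 2: "?m a c b = ?m c b a + ?r c (lie_bracket a b) + ?l (lie_bracket a c) b"
    using ac' ab by (simp add: straight_def)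
  have "lie_bracket (lie_bracket b c) a + (lie_bracket (lie_bracket a b) c) - lie_bracket (lie_bracket a c) b = 0"
    using jacobi[of a b c] bracket_commute[of a "lie_bracket b c"] bracket_commute[of c "lie_bracket a b"]
      bracket_commute[of b "lie_bracket c a"] bracket_commute[of c a]
      bracket_scale_left[of "-1" "lie_bracket a c" b]
    by (simp add: algebra_simps)
  then have "?s (lie_bracket (lie_bracket b c) a) + ?s (lie_bracket (lie_bracket a b) c)
      - ?s (lie_bracket (lie_bracket a c) b) = 0"
    by (simp flip: ext_add ext_diff add: ext_0)
  then show ?thesis
    using 1 2 lr[of c "lie_bracket a b"] lr[of a "lie_bracket b c"] lr[of b "lie_bracket a c"]
    by (simp add: algebra_simps)
qed

text \<open>Confluence of straightening: two descents of the same word are either equal, disjoint, or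
  overlap in one letter, and in the last case the Jacobi identity resolves the ambiguity.\<close>

lemma norm_form_straight:
  assumes "set (u @ a # b # v) \<subseteq> B"
  shows "straight (norm_form f) u a b v"
proof -
  have claim: "\<forall>u a b v. w = u @ a # b # v \<longrightarrow> set w \<subseteq> B \<longrightarrow> b \<sqsubset> a \<longrightarrow> straight (norm_form f) u a b v" for w
  proof (induction w rule: wf_induct_rule[OF wf_word_order[of "(\<sqsubset>)"]])
    case (1 w)
    let ?l = "norm_form f"
    \<comment> \<open>Requiring both orders of the two letters to lie below \<open>w\<close> makes
      the hypothesis usable whichever of them is the descent, since \<open>straight\<close> is
      symmetric.\<close>
    have IH: "straight ?l u a b v"
      if "(u @ a # b # v, w) \<in> word_order (\<sqsubset>)" "(u @ b # a # v, w) \<in> word_order (\<sqsubset>)"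
        "set (u @ a # b # v) \<subseteq> B" for u a b v
    proof -
      consider "a = b" | "b \<sqsubset> a" | "a \<sqsubset> b" using total by blast
      then show ?thesis
      proof cases
        case 1
        then show ?thesis by (simp add: straight_refl)
      next
        case 2
        then show ?thesis using 1[OF that(1)] that(3) by blast
      next
        case 3
        moreover have "set (u @ b # a # v) \<subseteq> B" using that by auto
        ultimately show ?thesis using 1[OF that(2)] straight_sym by blast
      qed
    qed
    have short: "straight ?l u a b v"
      if "length (u @ a # b # v) < length w" "set (u @ a # b # v) \<subseteq> B" for u a b v
      using that by (intro IH word_order_shorter) auto
    have tr: "(x, w) \<in> word_order (\<sqsubset>)" if "(x, y) \<in> word_order (\<sqsubset>)" "(y, w) \<in> word_order (\<sqsubset>)" for x y
      using that by (auto simp: word_order_def)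
    \<comment> \<open>Any two descents of \<open>w\<close> give the same value; by symmetry the
      first may be assumed to start no later than the second.\<close>
    have main: "?l (u @ b # a # v) + ext (\<lambda>c. ?l (u @ c # v)) (lie_bracket a b) =
        ?l (u' @ d # c # v') + ext (\<lambda>e. ?l (u' @ e # v')) (lie_bracket c d)"
      if w: "w = u @ a # b # v" "b \<sqsubset> a" "w = u' @ c # d # v'" "d \<sqsubset> c"
        and le: "length u \<le> length u'" and wB: "set w \<subseteq> B" for u a b v u' c d v'
    proof -
      have "\<exists>s. u' = u @ s \<and> a # b # v = s @ c # d # v'"
        using w le by (auto simp: append_eq_append_conv2)
      then obtain s where s: "u' = u @ s" "a # b # v = s @ c # d # v'" by blast
      consider "s = []" | "s = [a]" | t where "s = a # b # t"
        using s(2) by (cases s; cases "tl s") auto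
      then show ?thesis
      proof cases
        case 1
        then show ?thesis using s by simp
      next
        case 2
        then have eq: "c = b" "v = d # v'" "u' = u @ [a]" using s by auto
        have w': "w = u @ a # b # d # v'" using w eq by simp
        have db: "d \<sqsubset> b" using w eq by simp
        have da: "d \<sqsubset> a" using db \<open>b \<sqsubset> a\<close> trans by blast
        have sw: "set u \<subseteq> B" "a \<in> B" "b \<in> B" "d \<in> B" "set v' \<subseteq> B" using wB w' by auto
        note as = asym[OF \<open>b \<sqsubset> a\<close>] asym[OF db] asym[OF da]
        have o1: "(u @ b # a # d # v', w) \<in> word_order (\<sqsubset>)"
          using word_order_swap[of "(\<sqsubset>)" b a u "d # v'"] as w' w(2) by simp
        have o2: "(u @ a # d # b # v', w) \<in> word_order (\<sqsubset>)"
          using word_order_swap[of "(\<sqsubset>)" d b "u @ [a]" "v'"] as w' db by simp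
        have o3: "(u @ b # d # a # v', w) \<in> word_order (\<sqsubset>)"
          by (rule tr[OF _ o1]) (use word_order_swap[of "(\<sqsubset>)" d a "u @ [b]" "v'"] as da in simp)
        have o4: "(u @ d # a # b # v', w) \<in> word_order (\<sqsubset>)"
          by (rule tr[OF _ o2]) (use word_order_swap[of "(\<sqsubset>)" d a u "b # v'"] as da in simp)
        have o5: "(u @ d # b # a # v', w) \<in> word_order (\<sqsubset>)"
          by (rule tr[OF _ o4]) (use word_order_swap[of "(\<sqsubset>)" b a "u @ [d]" "v'"] as w(2) in simp)
        have "?l (u @ b # a # d # v') + ext (\<lambda>e. ?l (u @ e # d # v')) (lie_bracket a b) =
            ?l (u @ a # d # b # v') + ext (\<lambda>e. ?l (u @ a # e # v')) (lie_bracket b d)"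
        proof (rule straight_overlap)
          show "straight ?l (u @ [b]) a d v'" using o1 o3 sw by (intro IH) auto
          show "straight ?l u b d (a # v')" using o3 o5 sw by (intro IH) auto
          show "straight ?l u a d (b # v')" using o2 o4 sw by (intro IH) auto
          show "straight ?l (u @ [d]) a b v'" using o4 o5 sw by (intro IH) auto
          show "straight ?l u x y v'" if "x \<in> B" "y \<in> {a, b, d}" for x y
            using that sw w' by (intro short) auto
        qed
        then show ?thesis using eq by simp
      next
        case 3
        then have eq: "v = t @ c # d # v'" "u' = u @ a # b # t" using s by auto
        have w': "w = u @ a # b # t @ c # d # v'" using w eq by simp
        have sw: "set u \<subseteq> B" "a \<in> B" "b \<in> B" "c \<in> B" "d \<in> B" "set v' \<subseteq> B" "set t \<subseteq> B" using wB w' by auto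
        note as = asym[OF \<open>b \<sqsubset> a\<close>] asym[OF \<open>d \<sqsubset> c\<close>]
        have o1: "(u @ b # a # t @ c # d # v', w) \<in> word_order (\<sqsubset>)"
          using word_order_swap[of "(\<sqsubset>)" b a u "t @ c # d # v'"] as w' w(2) by simp
        have o2: "(u @ a # b # t @ d # c # v', w) \<in> word_order (\<sqsubset>)"
          using word_order_swap[of "(\<sqsubset>)" d c "u @ a # b # t" "v'"] as w' w(4) by simp
        have o3: "(u @ b # a # t @ d # c # v', w) \<in> word_order (\<sqsubset>)"
          by (rule tr[OF _ o1]) (use word_order_swap[of "(\<sqsubset>)" d c "u @ b # a # t" "v'"] as w(4) in simp)
        have "?l (u @ a # b # t @ d # c # v') + ext (\<lambda>e. ?l (u @ a # b # t @ e # v')) (lie_bracket c d) =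
            ?l (u @ b # a # t @ c # d # v') + ext (\<lambda>e. ?l (u @ e # t @ c # d # v')) (lie_bracket a b)"
        proof (rule straight_disjoint)
          show "straight ?l u a b (t @ d # c # v')" using o2 o3 sw by (intro IH) auto
          show "straight ?l (u @ b # a # t) c d v'" using o1 o3 sw by (intro IH) auto
          show "straight ?l u a b (t @ e # v')" if "e \<in> B" for e
            using that sw w' by (intro short) auto
          show "straight ?l (u @ e # t) c d v'" if "e \<in> B" for e
            using that sw w' by (intro short) auto
        qed
        then show ?thesis using eq by simp
      qed
    qed
    show ?case
    proof (intro allI impI)
      fix u a b v
      assume w: "w = u @ a # b # v" and wB: "set w \<subseteq> B" and ba: "b \<sqsubset> a"
      \<comment> \<open>The recursion rewrites a descent of its own choice; \<open>main\<close>
        transfers the result to the given one.\<close>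
      obtain u' c d v' where d: "w = u' @ c # d # v'" "d \<sqsubset> c"
        "?l w = ?l (u' @ d # c # v') + ext (\<lambda>e. ?l (u' @ e # v')) (lie_bracket c d)"
        using norm_form_descent[OF w ba] by blast
      have "?l (u @ b # a # v) + ext (\<lambda>c. ?l (u @ c # v)) (lie_bracket a b) =
        ?l (u' @ d # c # v') + ext (\<lambda>e. ?l (u' @ e # v')) (lie_bracket c d)"
        using main[OF w ba d(1,2) _ wB] main[OF d(1,2) w ba _ wB] nat_le_linear by metis
      then show "straight ?l u a b v"
        using d(3) w by (simp add: straight_def)
    qed
  qed
  consider "a = b" | "b \<sqsubset> a" | "a \<sqsubset> b" using total by blast
  then show ?thesis
  proof cases
    case 1
    then show ?thesis by (simp add: straight_refl)
  next
    case 2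
    then show ?thesis using claim[of "u @ a # b # v"] assms by blast
  next
    case 3
    moreover have "set (u @ b # a # v) \<subseteq> B" using assms by auto
    ultimately show ?thesis using claim[of "u @ b # a # v"] straight_sym by blast
  qed
qed


text \<open>The functionals on words that respect straightening form the coinduced module, i.e. the dual of
  the enveloping algebra; acting on one of them and evaluating at the empty word gives back its values on words.\<close>

definition word_module :: "('g, 'g list \<Rightarrow> 'b::complex_vector) lie_mod" where
  "word_module = \<lparr>mspace = {l. \<forall>u v. \<forall>a\<in>B. \<forall>b\<in>B. straight l u a b v},
     mact = (\<lambda>x l w. ext (\<lambda>b. l (w @ [b])) x)\<rparr>"

lemma straight_zero: "straight (0 :: 'g list \<Rightarrow> 'b::complex_vector) u a b v"
  by (simp add: straight_def basis_ext_zero_fun)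

lemma straight_add: "straight l u a b v \<Longrightarrow> straight l' u a b v \<Longrightarrow> straight (l + l') u a b v"
  by (simp add: straight_def basis_ext_add_fun)

lemma straight_scale: "straight l u a b v \<Longrightarrow> straight (c *\<^sub>C l) u a b v"
  by (simp add: straight_def basis_ext_scale_fun cvec.scale_right_distrib)

text \<open>The action appends a letter on the right. A relation inside the word is untouched by
  this, which gives closure. The relation at the end of the word is the module identity:
  \<open>x\<close> is reduced to a basis letter by uniqueness of linear extensions, and
  \<open>straight_ext\<close> treats \<open>y\<close>.\<close>

lemma lie_module_word_module: "lie_module (word_module :: ('g, 'g list \<Rightarrow> 'b::complex_vector) lie_mod)"
proof -
  have closed: "straight (\<lambda>w. ext (\<lambda>b. l (w @ [b])) x) u a b v"
    if "\<forall>u v. straight l u a b v" for l :: "'g list \<Rightarrow> 'b" and x u a b v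
  proof -
    have "ext (\<lambda>e. l (u @ a # b # v @ [e])) x =
        ext (\<lambda>e. l (u @ b # a # v @ [e]) + ext (\<lambda>c. l (u @ c # v @ [e])) (lie_bracket a b)) x"
      using that by (simp add: straight_def)
    then show ?thesis
      by (simp add: straight_def basis_ext_add_fun basis_ext_swap[where x = x and y = "lie_bracket a b"])
  qed
  have comm: "ext (\<lambda>b. l (w @ [b])) (lie_bracket x y) =
      ext (\<lambda>b. ext (\<lambda>c. l (w @ [b, c])) y) x - ext (\<lambda>c. ext (\<lambda>b. l (w @ [c, b])) x) y"
    if l: "\<forall>u v. \<forall>a\<in>B. \<forall>b\<in>B. straight l u a b v" for l :: "'g list \<Rightarrow> 'b" and x y w
  proof -
    have "ext (\<lambda>b. l (w @ [b])) (lie_bracket x y) =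
        ext (\<lambda>b. ext (\<lambda>c. l (w @ [b, c])) y - ext (\<lambda>c. l (w @ [c, b])) y) x"
    proof (rule basis_ext_unique[OF independent span, symmetric])
      show "clinear (\<lambda>x. ext (\<lambda>b. l (w @ [b])) (lie_bracket x y))"
        by (rule clinearI) (simp_all add: bracket_add_left bracket_scale_left ext_add ext_scale)
      show "ext (\<lambda>b. l (w @ [b])) (lie_bracket b y) = ext (\<lambda>c. l (w @ [b, c])) y - ext (\<lambda>c. l (w @ [c, b])) y"
        if "b \<in> B" for b
      proof -
        have "ext (\<lambda>c. l (w @ c # b # [])) y =
            ext (\<lambda>c. l (w @ b # c # [])) y + ext (\<lambda>c. l (w @ c # [])) (lie_bracket y b)"
          by (rule straight_ext) (use l that in blast)
        then show ?thesis by (simp add: bracket_commute[of b y] ext_neg)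
      qed
    qed
    then show ?thesis
      by (simp add: basis_ext_diff_fun basis_ext_swap[where x = x and y = y])
  qed
  show ?thesis
    unfolding lie_module_def
  proof (intro conjI allI ballI)
    show "cvec.subspace (mspace (word_module :: ('g, 'g list \<Rightarrow> 'b) lie_mod))"
      using straight_zero by (auto simp: word_module_def cvec.subspace_def intro: straight_add straight_scale)
  next
    fix x and l :: "'g list \<Rightarrow> 'b" assume "l \<in> mspace word_module"
    then show "mact word_module x l \<in> mspace word_module"
      by (simp add: word_module_def closed)
  next
    fix x y and l :: "'g list \<Rightarrow> 'b" assume "l \<in> mspace word_module"
    then show "mact word_module (lie_bracket x y) l =
        mact word_module x (mact word_module y l) - mact word_module y (mact word_module x l)"
      by (simp add: word_module_def fun_eq_iff comm)
  qed (simp_all add: word_module_def fun_eq_iff ext_add ext_scale basis_ext_add_fun basis_ext_scale_fun)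
qed

lemma foldr_word_module:
  assumes "set w \<subseteq> B"
  shows "foldr (mact word_module) w l u = l (u @ w)"
  using assms
proof (induction w arbitrary: u)
  case (Cons b w)
  then show ?case by (simp add: word_module_def basis_ext_basis[OF independent])
qed simp

text \<open>Existence of a functional with prescribed values on the sorted monomials says that these
  monomials are linearly independent.\<close>

theorem poincare_birkhoff_witt:
  fixes f :: "'g list \<Rightarrow> 'b::complex_vector"
  obtains \<Lambda> :: "'g uea \<Rightarrow> 'b" where "clinear \<Lambda>"
    "\<And>w. set w \<subseteq> B \<Longrightarrow> sorted_wrt (\<lambda>a b. \<not> b \<sqsubset> a) w \<Longrightarrow> \<Lambda> (prod_list (map uea_of w)) = f w"
proof
  \<comment> \<open>Membership in \<open>word_module\<close> demands the relation in every context,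
    while confluence holds for contexts with letters in \<open>B\<close>; in the other contexts all
    terms vanish by the default 0.\<close>
  define l where "l w = (if set w \<subseteq> B then norm_form f w else 0)" for w
  have l: "l \<in> mspace word_module"
  proof -
    have "straight l u a b v" if "a \<in> B" "b \<in> B" for u a b v
    proof (cases "set (u @ a # b # v) \<subseteq> B")
      case True
      then have "ext (\<lambda>c. l (u @ c # v)) (lie_bracket a b) = ext (\<lambda>c. norm_form f (u @ c # v)) (lie_bracket a b)"
        by (intro basis_ext_cong) (auto simp: l_def)
      with norm_form_straight[OF True, of f] True show ?thesis
        by (simp add: straight_def l_def)
    next
      case False
      then have "l (u @ c # v) = 0" for c using that by (auto simp: l_def)
      with False show ?thesis by (auto simp: straight_def l_def basis_ext_zero_fun)
    qed
    then show ?thesis by (simp add: word_module_def)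
  qed
  note M = lie_module_word_module
  show "clinear (\<lambda>u. uea_act word_module u l [])"
    by (rule clinearI) (simp_all add: uea_act_add[OF M l] uea_act_scale[OF M l])
  show "uea_act word_module (prod_list (map uea_of w)) l [] = f w"
    if "set w \<subseteq> B" "sorted_wrt (\<lambda>a b. \<not> b \<sqsubset> a) w" for w
  proof -
    have "norm_form f w = f w"
      using that(2) by (intro norm_form_sorted) (auto simp: sorted_wrt_append)
    then show ?thesis
      using that(1) by (simp add: uea_act_prod_list[OF M l] foldr_word_module l_def)
  qed
qed

end

section \<open>Spanning sets of the enveloping algebra\<close>

lemma uea_of_add: "uea_of (x + y) = uea_of x + uea_of y"
  by transfer (use uea_ideal.gen_add in \<open>simp add: diff_diff_eq\<close>)

lemma uea_of_scale: "uea_of (c *\<^sub>C x) = c *\<^sub>C uea_of x"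
  by transfer (rule uea_ideal.gen_scale)

lemma uea_of_0 [simp]: "uea_of 0 = 0"
  using uea_of_scale[of 0 0] by simp

lemma fconst_commute: "p * fconst c = fconst c * p"
  by (induction p rule: free_alg_induct)
    (simp_all add: distrib_left distrib_right fconst_def mult_single mult.commute)

lemma uea_scale_mult [simp]: "(c *\<^sub>C a) * b = c *\<^sub>C (a * b)" for a b :: "'g::complex_lie_algebra uea"
  by transfer (simp add: mult.assoc uea_ideal.zero)

lemma uea_mult_scale [simp]: "a * (c *\<^sub>C b) = c *\<^sub>C (a * b)" for a b :: "'g::complex_lie_algebra uea"
proof transfer
  fix a b :: "'g free_alg" and c
  have "a * (fconst c * b) = fconst c * (a * b)"
    by (metis fconst_commute mult.assoc)
  then show "a * (fconst c * b) - fconst c * (a * b) \<in> uea_ideal"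
    by (simp add: uea_ideal.zero)
qed

definition umon :: "'g::complex_lie_algebra list \<Rightarrow> 'g uea" where
  "umon w = prod_list (map uea_of w)"

lemma umon_simps [simp]:
  "umon [] = 1" "umon (a # w) = uea_of a * umon w" "umon (u @ v) = umon u * umon v"
  by (simp_all add: umon_def)

lemma abs_uea_single: "abs_uea (Poly_Mapping.single (FWord w) c) = c *\<^sub>C umon w"
proof (induction w arbitrary: c)
  case Nil
  then show ?case by (simp add: one_uea_def scaleC_uea.abs_eq fconst_def zero_fword_def)
next
  case (Cons x w)
  have "Poly_Mapping.single (FWord (x # w)) c = fgen x * Poly_Mapping.single (FWord w) c"
    by (simp add: fgen_def mult_single plus_fword_def)
  then show ?case
    using Cons by (simp flip: times_uea.abs_eq uea_of.abs_eq)
qed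

lemma span_umon:
  assumes "cvec.span H = (UNIV :: 'g::complex_lie_algebra set)"
  shows "cvec.span (umon ` {w. set w \<subseteq> H}) = UNIV"
proof -
  let ?S = "cvec.span (umon ` {w. set w \<subseteq> H})"
  have 1: "uea_of x * u \<in> ?S" if "u \<in> ?S" for x u
    using that
  proof (induction u rule: cvec.span_induct_alt)
    case base
    then show ?case by (simp add: cvec.span_zero)
  next
    case (step c m u)
    then obtain w where w: "m = umon w" "set w \<subseteq> H" by blast
    have "x \<in> cvec.span H" using assms by simp
    then have "uea_of x * m \<in> ?S"
    proof (induction x rule: cvec.span_induct_alt)
      case base
      then show ?case by (simp add: cvec.span_zero)
    next
      case (step d h y)
      have "uea_of h * m = umon (h # w)" using w by simp
      then have "uea_of h * m \<in> ?S" using w step(1) by (intro cvec.span_base) (metis imageI insert_subset list.simps(15) mem_Collect_eq)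
      with step show ?case
        by (simp add: uea_of_add uea_of_scale distrib_right cvec.span_add cvec.span_scale)
    qed
    with step show ?case
      by (simp add: distrib_left cvec.span_add cvec.span_scale)
  qed
  have 2: "umon w \<in> ?S" for w
  proof (induction w)
    case Nil
    have "umon [] \<in> ?S" by (intro cvec.span_base imageI) simp
    then show ?case .
  qed (simp add: 1)
  have "abs_uea p \<in> ?S" for p
  proof (induction p rule: free_alg_induct)
    case zero
    then show ?case using cvec.span_zero[of "umon ` {w. set w \<subseteq> H}"] by (simp add: zero_uea_def)
  next
    case (add p w c)
    then show ?case
      using 2 by (cases w) (simp add: abs_uea_single cvec.span_add cvec.span_scale flip: plus_uea.abs_eq)
  qed
  then have "u \<in> ?S" for u by (induction u) blast
  then show ?thesis by blast
qed

lemma span_umon_UNIV: "cvec.span (range umon) = UNIV"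
  using span_umon[of UNIV] by simp

lemma umon_swap:
  "umon (u @ a # b # v) = umon (u @ b # a # v) + umon u * uea_of (lie_bracket a b) * umon v"
  by (simp add: uea_of_bracket algebra_simps)

lemma umon_insert_mem:
  assumes "cvec.subspace S" "x \<in> cvec.span C" "\<And>c. c \<in> C \<Longrightarrow> umon (u @ c # v) \<in> S"
  shows "umon u * uea_of x * umon v \<in> S"
  using assms(2)
proof (induction x rule: cvec.span_induct_alt)
  case base
  then show ?case using cvec.subspace_0[OF assms(1)] by simp
next
  case (step c y x)
  moreover have "umon u * uea_of y * umon v \<in> S" using assms(3)[OF step(1)] by (simp add: mult.assoc)
  ultimately show ?case
    using assms(1) by (simp add: uea_of_add uea_of_scale distrib_left distrib_right cvec.subspace_add cvec.subspace_scale)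
qed

lemma sorted_wrt_adjacent:
  assumes "\<And>u a b v. w = u @ a # b # v \<Longrightarrow> P a b" "transp P"
  shows "sorted_wrt P w"
proof -
  have "successively P w"
    using assms(1)
  proof (induction w rule: induct_list012)
    case (3 x y zs)
    have "P x y" using 3(3)[of "[]" x y zs] by simp
    moreover have "successively P (y # zs)" by (rule 3(2)) (use 3(3)[of "x # _"] in simp)
    ultimately show ?case by simp
  qed simp_all
  then show ?thesis using assms(2) by (simp add: successively_conv_sorted_wrt)
qed

section \<open>The spanning half of the Poincare-Birkhoff-Witt theorem\<close>

context ordered_lie_basis
begin

definition sorted_word :: "'g list \<Rightarrow> bool" where
  "sorted_word w \<longleftrightarrow> sorted_wrt (\<lambda>a b. \<not> b \<sqsubset> a) w"

lemma sorted_word_adjacent: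
  assumes "\<And>u a b v. w = u @ a # b # v \<Longrightarrow> \<not> b \<sqsubset> a"
  shows "sorted_word w"
proof -
  have "transp (\<lambda>a b. \<not> b \<sqsubset> a)"
  proof (intro transpI notI)
    fix a b c assume "\<not> b \<sqsubset> a" "\<not> c \<sqsubset> b" "c \<sqsubset> a"
    then show False using trans[of c a b] total[of a b] by blast
  qed
  then show ?thesis unfolding sorted_word_def using assms by (intro sorted_wrt_adjacent) auto
qed

lemma span_sorted_umon: "cvec.span (umon ` {w. set w \<subseteq> B \<and> sorted_word w}) = UNIV"
proof -
  let ?S = "cvec.span (umon ` {w. set w \<subseteq> B \<and> sorted_word w})"
  have "set w \<subseteq> B \<Longrightarrow> umon w \<in> ?S" for w
  proof (induction w rule: wf_induct_rule[OF wf_word_order[of "(\<sqsubset>)"]])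
    case (1 w)
    show ?case
    proof (cases "\<exists>u a b v. w = u @ a # b # v \<and> b \<sqsubset> a")
      case True
      then obtain u a b v where w: "w = u @ a # b # v" "b \<sqsubset> a" by blast
      have "umon (u @ b # a # v) \<in> ?S"
        using 1(2) w word_order_swap[of "(\<sqsubset>)" b a u v, OF w(2) asym[OF w(2)]]
        by (intro 1(1)) simp_all
      moreover have "umon u * uea_of (lie_bracket a b) * umon v \<in> ?S"
      proof (rule umon_insert_mem)
        show "lie_bracket a b \<in> cvec.span B" using span by simp
        show "umon (u @ c # v) \<in> ?S" if "c \<in> B" for c
          using that 1(2) w by (intro 1(1) word_order_shorter) auto
      qed simp
      ultimately show ?thesis unfolding w umon_swap[of u a b v] by (rule cvec.span_add)
    next
      case False
      then have "sorted_word w" by (intro sorted_word_adjacent) blast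
      then show ?thesis using 1(2) by (intro cvec.span_base imageI) simp
    qed
  qed
  then have "cvec.span (umon ` {w. set w \<subseteq> B}) \<subseteq> ?S"
    by (intro cvec.span_minimal) auto
  then show ?thesis using span_umon[OF span] by blast
qed

end

text \<open>Placing the letters outside \<open>C\<close> before those of \<open>C\<close> makes
  every sorted word a word in the complement followed by a word in \<open>C\<close>. Within each of
  the two blocks a well-order of the type supplies a total order.\<close>

lemma ordered_lie_basis_exists:
  assumes "cvec.independent B" "cvec.span B = (UNIV :: 'g::complex_lie_algebra set)"
  obtains r where "ordered_lie_basis B r" "\<And>a c. a \<notin> C \<Longrightarrow> c \<in> C \<Longrightarrow> r a c"
proof -
  obtain r :: "'g rel" where r: "Well_order r" "Field r = UNIV" using well_ordering by metis
  then have r': "antisym r" "Relation.trans r" "total_on UNIV r"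
    by (simp_all add: well_order_on_def linear_order_on_def partial_order_on_def preorder_on_def)
  define s where "s a b \<longleftrightarrow> (a, b) \<in> r \<and> a \<noteq> b" for a b
  have asym: "\<not> s b a" if "s a b" for a b
    using that antisymD[OF r'(1)] by (auto simp: s_def)
  have trans: "s a c" if "s a b" "s b c" for a b c
    using that transD[OF r'(2), of a b c] asym[of a b] unfolding s_def by blast
  have total: "s a b \<or> s b a" if "a \<noteq> b" for a b
    using that r'(3) unfolding s_def total_on_def by blast
  let ?r = "\<lambda>a b. (a \<notin> C \<and> b \<in> C) \<or> ((a \<in> C \<longleftrightarrow> b \<in> C) \<and> s a b)"
  have "ordered_lie_basis B ?r"
  proof
    show "\<not> ?r b a" if "?r a b" for a b using that asym by blast
    show "?r a c" if "?r a b" "?r b c" for a b c using that trans by blast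
    show "?r a b \<or> ?r b a" if "a \<noteq> b" for a b using total[OF that] by blast
  qed (use assms in simp_all)
  then show thesis by (rule that) blast
qed

section \<open>Extending a character of a subalgebra to the enveloping algebra\<close>

definition central_uea :: "'g::complex_lie_algebra uea set" where
  "central_uea = {a. \<forall>u. a * u = u * a}"

lemma central_left_commute: "a \<in> central_uea \<Longrightarrow> a * (b * c) = b * (a * c)"
  unfolding central_uea_def by (metis (mono_tags, lifting) mem_Collect_eq mult.assoc)

lemma is_subalgebra_prod_list: "is_subalgebra A \<Longrightarrow> set xs \<subseteq> A \<Longrightarrow> prod_list xs \<in> A"
  by (induction xs) (auto simp: is_subalgebra_def)

text \<open>By the Poincare-Birkhoff-Witt theorem the enveloping algebra is a free right module over that of the
  subalgebra \<open>p\<close>, with the monomials in a complement as basis; \<open>\<Lambda>\<close> is the coefficient of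
  the empty monomial, to which the character is applied.\<close>

lemma character_extension:
  fixes p :: "'g::complex_lie_algebra set" and \<chi> :: "'g \<Rightarrow> 'g uea"
  assumes p: "cvec.subspace p" "\<And>x y. x \<in> p \<Longrightarrow> y \<in> p \<Longrightarrow> lie_bracket x y \<in> p"
    and add: "\<And>x y. x \<in> p \<Longrightarrow> y \<in> p \<Longrightarrow> \<chi> (x + y) = \<chi> x + \<chi> y"
    and scale: "\<And>c x. x \<in> p \<Longrightarrow> \<chi> (c *\<^sub>C x) = c *\<^sub>C \<chi> x"
    and bracket: "\<And>x y. x \<in> p \<Longrightarrow> y \<in> p \<Longrightarrow> \<chi> (lie_bracket x y) = 0"
    and A: "is_subalgebra A" "A \<subseteq> central_uea" "\<chi> ` p \<subseteq> A"
  obtains \<Lambda> :: "'g uea \<Rightarrow> 'g uea" where "clinear \<Lambda>" "\<Lambda> 1 = 1"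
    "\<And>u q. q \<in> p \<Longrightarrow> \<Lambda> (u * uea_of q) = \<Lambda> u * \<chi> q" "range \<Lambda> \<subseteq> A"
proof -
  obtain C where C: "C \<subseteq> p" "cvec.independent C" "p \<subseteq> cvec.span C"
    using cvec.maximal_independent_subset by blast
  have spC: "cvec.span C = p" using C p(1) cvec.span_minimal by blast
  obtain B where B: "C \<subseteq> B" "cvec.independent B" "cvec.span B = UNIV"
    using cvec.maximal_independent_subset_extend[of C UNIV] C(2) by (metis subset_UNIV top.extremum_unique)
  obtain r where r: "ordered_lie_basis B r" and first: "\<And>a c. a \<notin> C \<Longrightarrow> c \<in> C \<Longrightarrow> r a c"
    using ordered_lie_basis_exists[OF B(2,3)] by metis
  interpret ordered_lie_basis B r by fact
  define f where "f w = (if set w \<subseteq> C then prod_list (map \<chi> w) else 0)" for w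
  obtain \<Lambda> :: "'g uea \<Rightarrow> 'g uea" where lin: "clinear \<Lambda>"
    and \<Lambda>: "\<And>w. set w \<subseteq> B \<Longrightarrow> sorted_word w \<Longrightarrow> \<Lambda> (umon w) = f w"
    using poincare_birkhoff_witt[of f] unfolding umon_def sorted_word_def by blast
  note lin_simps = cpair.linear_add[OF lin] cpair.linear_scale[OF lin] cpair.linear_0[OF lin]
  have \<chi>0: "\<chi> 0 = 0" using scale[of 0 0] cvec.subspace_0[OF p(1)] by simp
  \<comment> \<open>The part \<open>t\<close> may be unsorted, so that a letter of \<open>C\<close>
    can later be appended to it. Sorting \<open>t\<close> only creates brackets inside
    \<open>p\<close>, which \<chi> kills, and the values of \<chi> commute.\<close>
  have split: "\<Lambda> (umon (s @ t)) = (if s = [] then prod_list (map \<chi> t) else 0)"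
    if s: "set s \<subseteq> B - C" "sorted_word s" and t: "set t \<subseteq> C" for s t
    using t
  proof (induction t rule: wf_induct_rule[OF wf_word_order[of r]])
    case (1 t)
    show ?case
    proof (cases "\<exists>u a b v. t = u @ a # b # v \<and> r b a")
      case True
      then obtain u a b v where t: "t = u @ a # b # v" "r b a" by blast
      have ab: "a \<in> C" "b \<in> C" using 1(2) t by auto
      then have abp: "a \<in> p" "b \<in> p" "lie_bracket a b \<in> p" using C(1) p(2) by auto
      have sw: "\<Lambda> (umon (s @ u @ b # a # v)) = (if s = [] then prod_list (map \<chi> (u @ b # a # v)) else 0)"
        using 1(2) t word_order_swap[of r b a u v] asym[of b a] by (intro 1(1)) auto
      have "\<Lambda> (umon (s @ u) * uea_of x * umon v) =
          (if s = [] then prod_list (map \<chi> u) * \<chi> x * prod_list (map \<chi> v) else 0)" if "x \<in> p" for x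
      proof -
        let ?P = "\<lambda>x. x \<in> p \<and> \<Lambda> (umon (s @ u) * uea_of x * umon v) =
          (if s = [] then prod_list (map \<chi> u) * \<chi> x * prod_list (map \<chi> v) else 0)"
        have "x \<in> cvec.span C" using that spC by simp
        then have "?P x"
        proof (induction x rule: cvec.span_induct_alt)
          case base
          then show ?case by (simp add: lin_simps \<chi>0 cvec.subspace_0[OF p(1)])
        next
          case (step c y x)
          have "\<Lambda> (umon (s @ u @ y # v)) = (if s = [] then prod_list (map \<chi> (u @ y # v)) else 0)"
            using 1(2) t step(1) by (intro 1(1) word_order_shorter) auto
          moreover have "c *\<^sub>C y \<in> p" "y \<in> p" "x \<in> p"
            using step C(1) p(1) by (auto intro: cvec.subspace_scale)
          ultimately show ?case
            using step(2) p(1)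
            by (simp add: uea_of_add uea_of_scale distrib_left distrib_right lin_simps add scale mult.assoc
                cvec.subspace_add)
        qed
        then show ?thesis ..
      qed
      from this[OF abp(3)] have "\<Lambda> (umon (s @ u) * uea_of (lie_bracket a b) * umon v) = 0"
        using bracket[OF abp(1,2)] by simp
      moreover have "\<chi> b * (\<chi> a * z) = \<chi> a * (\<chi> b * z)" for z
        using A(2,3) abp central_left_commute by blast
      ultimately show ?thesis
        using sw umon_swap[of "s @ u" a b v] by (auto simp: t lin_simps)
    next
      case False
      then have "sorted_word t" by (intro sorted_word_adjacent) blast
      moreover have "\<not> r c a" if "a \<in> set s" "c \<in> set t" for a c
        using that s 1(2) first asym by blast
      ultimately have "sorted_word (s @ t)" using s by (auto simp: sorted_word_def sorted_wrt_append)
      then show ?thesis using s 1(2) B(1) \<Lambda>[of "s @ t"] by (cases s) (auto simp: f_def)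
    qed
  qed
  have decomp: "\<exists>s t. w = s @ t \<and> set s \<subseteq> B - C \<and> sorted_word s \<and> set t \<subseteq> C"
    if "set w \<subseteq> B" "sorted_word w" for w
    using that
  proof (induction w)
    case Nil
    then show ?case by simp
  next
    case (Cons a w)
    then obtain s t where st: "w = s @ t" "set s \<subseteq> B - C" "sorted_word s" "set t \<subseteq> C"
      by (auto simp: sorted_word_def)
    show ?case
    proof (cases "a \<in> C")
      case True
      then have "b \<in> C" if "b \<in> set w" for b using that Cons.prems first by (auto simp: sorted_word_def)
      then have "a # w = [] @ (a # w) \<and> set (a # w) \<subseteq> C" using True by auto
      then show ?thesis by (metis empty_set empty_subsetI sorted_word_def sorted_wrt.simps(1))
    next
      case False
      have "a # w = (a # s) @ t \<and> set (a # s) \<subseteq> B - C \<and> sorted_word (a # s)"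
        using st False Cons.prems by (auto simp: sorted_word_def)
      then show ?thesis using st(4) by blast
    qed
  qed
  show thesis
  proof
    show "clinear \<Lambda>" by fact
    show "\<Lambda> 1 = 1" using split[of "[]" "[]"] by (simp add: sorted_word_def)
    have "\<Lambda> u \<in> A" for u
    proof -
      have "u \<in> cvec.span (umon ` {w. set w \<subseteq> B \<and> sorted_word w})" using span_sorted_umon by simp
      then show ?thesis
      proof (induction u rule: cvec.span_induct_alt)
        case base
        then show ?case using A(1) by (simp add: lin_simps is_subalgebra_def cvec.subspace_0)
      next
        case (step c m u)
        have "prod_list (map \<chi> w) \<in> A" if "set w \<subseteq> C" for w
          by (rule is_subalgebra_prod_list) (use A(1,3) C(1) that in auto)
        then have "f w \<in> A" for w
          using A(1) by (auto simp: f_def is_subalgebra_def cvec.subspace_0)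
        then show ?case using step A(1) \<Lambda>
          by (auto simp: lin_simps is_subalgebra_def intro!: cvec.subspace_add cvec.subspace_scale)
      qed
    qed
    then show "range \<Lambda> \<subseteq> A" by blast
    show "\<Lambda> (u * uea_of q) = \<Lambda> u * \<chi> q" if "q \<in> p" for u q
    proof -
      have "u \<in> cvec.span (umon ` {w. set w \<subseteq> B \<and> sorted_word w})" using span_sorted_umon by simp
      then show ?thesis
      proof (induction u rule: cvec.span_induct_alt)
        case base
        then show ?case by (simp add: lin_simps)
      next
        case (step c m u)
        obtain w where w: "m = umon w" "set w \<subseteq> B" "sorted_word w" using step(1) by blast
        then obtain s t where st: "w = s @ t" "set s \<subseteq> B - C" "sorted_word s" "set t \<subseteq> C"
          using decomp by blast
        have "q \<in> cvec.span C" using that spC by simp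
        then have "q \<in> p \<and> \<Lambda> (m * uea_of q) = \<Lambda> m * \<chi> q"
        proof (induction q rule: cvec.span_induct_alt)
          case base
          then show ?case by (simp add: lin_simps \<chi>0 cvec.subspace_0[OF p(1)])
        next
          case (step d y q)
          \<comment> \<open>The product is the monomial of \<open>s\<close> followed by
            \<open>t @ [y]\<close>, again of the shape covered by \<open>split\<close>.\<close>
          have "\<Lambda> (m * uea_of y) = \<Lambda> m * \<chi> y"
            using split[OF st(2,3), of "t @ [y]"] split[OF st(2-4)] st(4) step(1)
            by (simp add: w st(1) mult.assoc)
          moreover have "d *\<^sub>C y \<in> p" "y \<in> p" "q \<in> p"
            using step C(1) p(1) by (auto intro: cvec.subspace_scale)
          ultimately show ?case using step(2) p(1)
            by (simp add: uea_of_add uea_of_scale distrib_left lin_simps add scale cvec.subspace_add)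
        qed
        then show ?case using step by (simp add: distrib_right lin_simps)
      qed
    qed
  qed
qed

section \<open>Cyclic modules and left ideals\<close>

definition left_ideal :: "'g::complex_lie_algebra uea set \<Rightarrow> bool" where
  "left_ideal J \<longleftrightarrow> cvec.subspace J \<and> (\<forall>a. \<forall>u\<in>J. a * u \<in> J)"

definition vector_ann ::
  "('g::complex_lie_algebra, 'v::complex_vector) lie_mod \<Rightarrow> 'v \<Rightarrow> 'g uea set" where
  "vector_ann M v = {u. uea_act M u v = 0}"

lemma uea_span_induct [case_names zero umon]:
  fixes u :: "'g::complex_lie_algebra uea"
  assumes "P 0" "\<And>c w u. P u \<Longrightarrow> P (c *\<^sub>C umon w + u)"
  shows "P u"
proof -
  have "u \<in> cvec.span (range umon)" by (simp add: span_umon_UNIV)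
  then show ?thesis
    by (induction u rule: cvec.span_induct_alt) (use assms in auto)
qed

context
  fixes M :: "('g::complex_lie_algebra, 'v::complex_vector) lie_mod"
  assumes M: "lie_module M"
begin

lemma uea_act_umon: "v \<in> mspace M \<Longrightarrow> uea_act M (umon w) v = foldr (mact M) w v"
  by (simp add: umon_def uea_act_prod_list[OF M])

lemma uea_act_0: "v \<in> mspace M \<Longrightarrow> uea_act M 0 v = 0"
  using uea_act_scale[OF M, of v 0 0] by simp

lemma uea_act_diff: "v \<in> mspace M \<Longrightarrow> uea_act M (a - b) v = uea_act M a v - uea_act M b v"
  using uea_act_add[OF M, of v "a - b" b] by simp

lemma uea_act_zero_right: "uea_act M u 0 = 0"
  by (simp add: uea_act_def free_act_zero_right[OF M])

lemma mact_uea_act: "v \<in> mspace M \<Longrightarrow> mact M x (uea_act M u v) = uea_act M (uea_of x * u) v"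
  by (simp add: uea_act_mult[OF M] uea_act_uea_of[OF M] uea_act_closed[OF M])

lemma uea_act_submodule:
  assumes W: "is_submodule W M" "v \<in> W"
  shows "uea_act M u v \<in> W"
proof -
  have v: "v \<in> mspace M" using W by (auto simp: is_submodule_def)
  have "foldr (mact M) w v \<in> W" for w
    using W by (induction w) (auto simp: is_submodule_def)
  then show ?thesis
    using W v by (induction u rule: uea_span_induct)
      (auto simp: uea_act_0 uea_act_add[OF M] uea_act_scale[OF M] uea_act_umon is_submodule_def
        intro!: cvec.subspace_0 cvec.subspace_add cvec.subspace_scale)
qed

text \<open>The orbit U(g) v is itself a submodule containing v, and every submodule containing v
  contains it.\<close>

lemma generates_iff:
  assumes v: "v \<in> mspace M"
  shows "generates v M \<longleftrightarrow> mspace M = range (\<lambda>u. uea_act M u v)"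
proof
  let ?W = "range (\<lambda>u. uea_act M u v)"
  have "is_submodule ?W M"
    unfolding is_submodule_def
  proof (intro conjI allI ballI)
    show "cvec.subspace ?W"
      unfolding cvec.subspace_def
      by (auto simp flip: uea_act_add[OF M v] uea_act_scale[OF M v] uea_act_0[OF v])
    show "?W \<subseteq> mspace M" using uea_act_closed[OF M v] by auto
    show "mact M x w \<in> ?W" if "w \<in> ?W" for x w using that by (auto simp: mact_uea_act[OF v])
  qed
  moreover have "v \<in> ?W" using uea_act_1[OF M v] by (metis rangeI)
  ultimately show "generates v M \<Longrightarrow> mspace M = ?W" by (auto simp: generates_def)
  show "generates v M" if "mspace M = ?W"
    unfolding generates_def
  proof (intro conjI allI impI)
    fix W assume W: "is_submodule W M \<and> v \<in> W"
    then have "?W \<subseteq> W" using uea_act_submodule by auto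
    then show "W = mspace M" using that W by (auto simp: is_submodule_def)
  qed (fact v)
qed

lemma left_ideal_vector_ann:
  assumes v: "v \<in> mspace M"
  shows "left_ideal (vector_ann M v)"
  by (auto simp: left_ideal_def vector_ann_def cvec.subspace_def uea_act_0[OF v] uea_act_add[OF M v]
      uea_act_scale[OF M v] uea_act_mult[OF M v] uea_act_zero_right)

lemma central_annihilator:
  assumes "generates v M" "A \<subseteq> central_uea"
  shows "A \<inter> annihilator M = A \<inter> vector_ann M v"
proof -
  have v: "v \<in> mspace M" using assms(1) by (auto simp: generates_def)
  have comm: "uea_act M a (uea_act M u v) = uea_act M u (uea_act M a v)" if "a \<in> A" for a u
  proof -
    have "a * u = u * a" using that assms(2) unfolding central_uea_def by blast
    then show ?thesis by (metis uea_act_mult[OF M v])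
  qed
  have "a \<in> annihilator M \<longleftrightarrow> a \<in> vector_ann M v" if a: "a \<in> A" for a
  proof
    assume "a \<in> annihilator M"
    then show "a \<in> vector_ann M v" using v by (simp add: annihilator_def vector_ann_def)
  next
    assume "a \<in> vector_ann M v"
    then have "uea_act M a (uea_act M u v) = 0" for u
      unfolding comm[OF a] by (simp add: vector_ann_def uea_act_zero_right)
    then show "a \<in> annihilator M" using assms(1) generates_iff[OF v] by (auto simp: annihilator_def)
  qed
  then show ?thesis by blast
qed

end

text \<open>The map taking u v to u w is well defined and injective exactly because the annihilators
  of the two generators coincide.\<close>

lemma lie_mod_iso_cyclic:
  assumes M: "lie_module M" "generates v M" and N: "lie_module N" "generates w N"
    and ann: "vector_ann M v = vector_ann N w"
  shows "lie_mod_iso M N"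
proof -
  have v: "v \<in> mspace M" and w: "w \<in> mspace N" using M N by (auto simp: generates_def)
  have sM: "mspace M = range (\<lambda>u. uea_act M u v)" and sN: "mspace N = range (\<lambda>u. uea_act N u w)"
    using M N v w by (auto simp: generates_iff)
  have eq: "uea_act M a v = uea_act M b v \<longleftrightarrow> uea_act N a w = uea_act N b w" for a b
  proof -
    have "a - b \<in> vector_ann M v \<longleftrightarrow> a - b \<in> vector_ann N w" using ann by simp
    then show ?thesis
      by (simp add: vector_ann_def uea_act_diff[OF M(1) v] uea_act_diff[OF N(1) w])
  qed
  define f where "f m = uea_act N (SOME u. uea_act M u v = m) w" for m
  have f: "f (uea_act M u v) = uea_act N u w" for u
    unfolding f_def using someI[of "\<lambda>u'. uea_act M u' v = uea_act M u v" u] eq by blast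
  show ?thesis
    unfolding lie_mod_iso_def
  proof (intro exI conjI ballI allI)
    show "bij_betw f (mspace M) (mspace N)"
      by (auto simp: bij_betw_def inj_on_def sM sN f eq image_iff)
  qed (auto simp: sM f mact_uea_act[OF M(1) v] mact_uea_act[OF N(1) w]
      simp flip: uea_act_add[OF M(1) v] uea_act_add[OF N(1) w] uea_act_scale[OF M(1) v]
        uea_act_scale[OF N(1) w])
qed

lemma annihilator_iso:
  assumes M: "lie_module M" and N: "lie_module N" and iso: "lie_mod_iso M N"
  shows "annihilator M = annihilator N"
proof -
  obtain f where bij: "bij_betw f (mspace M) (mspace N)"
    and add: "\<And>v w. v \<in> mspace M \<Longrightarrow> w \<in> mspace M \<Longrightarrow> f (v + w) = f v + f w"
    and scale: "\<And>c v. v \<in> mspace M \<Longrightarrow> f (c *\<^sub>C v) = c *\<^sub>C f v"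
    and act: "\<And>x v. v \<in> mspace M \<Longrightarrow> f (mact M x v) = mact N x (f v)"
    using iso unfolding lie_mod_iso_def by blast
  note sub = mspace_subspace[OF M]
  have f0: "f 0 = 0" using scale[of 0 0] cvec.subspace_0[OF sub] by simp
  have "f (uea_act M u v) = uea_act N u (f v)" if v: "v \<in> mspace M" for u v
  proof -
    have fv: "f v \<in> mspace N" using bij v by (auto simp: bij_betw_def)
    have "f (foldr (mact M) w v) = foldr (mact N) w (f v)" for w
      by (induction w) (simp_all add: act foldr_mact(1)[OF M v])
    then show ?thesis
      by (induction u rule: uea_span_induct)
        (simp_all add: uea_act_0[OF M v] uea_act_0[OF N fv] f0 uea_act_add[OF M v] uea_act_add[OF N fv]
          uea_act_scale[OF M v] uea_act_scale[OF N fv] uea_act_umon[OF M v] uea_act_umon[OF N fv]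
          add scale cvec.subspace_scale[OF sub] foldr_mact(1)[OF M v] uea_act_closed[OF M v])
  qed
  moreover have "f x = 0 \<longleftrightarrow> x = 0" if "x \<in> mspace M" for x
    using that bij f0 cvec.subspace_0[OF sub] by (auto simp: bij_betw_def inj_on_def)
  moreover have "mspace N = f ` mspace M" using bij by (simp add: bij_betw_def)
  ultimately have "uea_act N u (f v) = 0 \<longleftrightarrow> uea_act M u v = 0" "mspace N = f ` mspace M"
    if "v \<in> mspace M" for u v
    using that uea_act_closed[OF M] by metis+
  then show ?thesis
    using \<open>mspace N = f ` mspace M\<close> by (auto simp: annihilator_def)
qed

lemma lie_mod_iso_refl: "lie_mod_iso M M"
  unfolding lie_mod_iso_def by (rule exI[of _ id]) simp

lemma lie_mod_iso_sym:
  assumes M: "lie_module M" and iso: "lie_mod_iso M N"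
  shows "lie_mod_iso N M"
proof -
  obtain f where bij: "bij_betw f (mspace M) (mspace N)"
    and add: "\<And>v w. v \<in> mspace M \<Longrightarrow> w \<in> mspace M \<Longrightarrow> f (v + w) = f v + f w"
    and scale: "\<And>c v. v \<in> mspace M \<Longrightarrow> f (c *\<^sub>C v) = c *\<^sub>C f v"
    and act: "\<And>x v. v \<in> mspace M \<Longrightarrow> f (mact M x v) = mact N x (f v)"
    using iso unfolding lie_mod_iso_def by blast
  note sub = mspace_subspace[OF M]
  let ?g = "the_inv_into (mspace M) f"
  have inj: "inj_on f (mspace M)" and N: "mspace N = f ` mspace M" using bij by (auto simp: bij_betw_def)
  have g: "?g (f v) = v" if "v \<in> mspace M" for v using the_inv_into_f_f[OF inj that] .
  show ?thesis
    unfolding lie_mod_iso_def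
  proof (intro exI conjI ballI allI)
    show "bij_betw ?g (mspace N) (mspace M)" using bij by (rule bij_betw_the_inv_into)
  qed (auto simp: N g mact_closed[OF M] cvec.subspace_add[OF sub] cvec.subspace_scale[OF sub]
      simp flip: add scale act)
qed

lemma lie_mod_iso_trans:
  assumes "lie_mod_iso M N" "lie_mod_iso N P"
  shows "lie_mod_iso M P"
proof -
  obtain f where f: "bij_betw f (mspace M) (mspace N)"
    "\<forall>v\<in>mspace M. \<forall>w\<in>mspace M. f (v + w) = f v + f w"
    "\<forall>c. \<forall>v\<in>mspace M. f (c *\<^sub>C v) = c *\<^sub>C f v" "\<forall>x. \<forall>v\<in>mspace M. f (mact M x v) = mact N x (f v)"
    using assms(1) unfolding lie_mod_iso_def by blast
  obtain g where g: "bij_betw g (mspace N) (mspace P)"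
    "\<forall>v\<in>mspace N. \<forall>w\<in>mspace N. g (v + w) = g v + g w"
    "\<forall>c. \<forall>v\<in>mspace N. g (c *\<^sub>C v) = c *\<^sub>C g v" "\<forall>x. \<forall>v\<in>mspace N. g (mact N x v) = mact P x (g v)"
    using assms(2) unfolding lie_mod_iso_def by blast
  have "f v \<in> mspace N" if "v \<in> mspace M" for v using f(1) that by (auto simp: bij_betw_def)
  then show ?thesis
    unfolding lie_mod_iso_def using f g bij_betw_trans[OF f(1) g(1)] by (intro exI[of _ "g \<circ> f"]) auto
qed

text \<open>The quotient by \<open>J\<close> is realized on the image of a linear projection with kernel \<open>J\<close>.\<close>

lemma cyclic_module_exists:
  assumes J: "left_ideal J"
  obtains N :: "('g::complex_lie_algebra, 'g uea) lie_mod" and w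
  where "lie_module N" "generates w N" "vector_ann N w = J"
proof -
  have sub: "cvec.subspace J" and mult: "\<And>a u. u \<in> J \<Longrightarrow> a * u \<in> J" using J by (auto simp: left_ideal_def)
  \<comment> \<open>\<open>g\<close> is a linear projection onto \<open>J\<close>, obtained as a
    left inverse of the inclusion; \<open>P\<close> is the complementary projection.\<close>
  obtain g where g: "g ` UNIV \<subseteq> J" "clinear g" "\<forall>v\<in>J. g v = v"
    using cpair.linear_exists_left_inverse_on[of id J] sub cvec.linear_id by auto
  define P where "P u = u - g u" for u
  have linP: "clinear P"
    by (rule clinearI) (simp_all add: P_def cpair.linear_add[OF g(2)] cpair.linear_scale[OF g(2)]
        cvec.scale_right_diff_distrib)
  note P_simps = cpair.linear_add[OF linP] cpair.linear_scale[OF linP] cpair.linear_diff[OF linP]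
  have P0: "P u = 0 \<longleftrightarrow> u \<in> J" for u
    using g by (auto simp: P_def)
  have Peq: "P u = P v \<longleftrightarrow> u - v \<in> J" for u v
    using P0[of "u - v"] by (simp add: P_simps)
  have PP: "P (a * P u) = P (a * u)" for a u
  proof -
    have "P u - u \<in> J" using cvec.subspace_neg[OF sub, of "g u"] g(1) by (auto simp: P_def)
    from mult[OF this, of a] show ?thesis unfolding Peq by (simp add: right_diff_distrib)
  qed
  define N where "N = \<lparr>mspace = range P, mact = (\<lambda>x v. P (uea_of x * v))\<rparr>"
  have N: "lie_module N"
    unfolding lie_module_def
  proof (intro conjI allI ballI)
    show "cvec.subspace (mspace N)"
      using cpair.linear_subspace_image[OF linP cvec.subspace_UNIV] by (simp add: N_def)
    show "mact N (lie_bracket x y) v = mact N x (mact N y v) - mact N y (mact N x v)" for x y v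
      by (simp add: N_def PP uea_of_bracket left_diff_distrib P_simps mult.assoc)
  qed (simp_all add: N_def uea_of_add uea_of_scale distrib_left distrib_right P_simps)
  have w: "P 1 \<in> mspace N" by (simp add: N_def)
  have "foldr (mact N) xs (P 1) = P (umon xs)" for xs
    by (induction xs) (simp_all add: N_def PP)
  then have act: "uea_act N u (P 1) = P u" for u
    by (induction u rule: uea_span_induct)
      (simp_all add: uea_act_0[OF N w] cpair.linear_0[OF linP] uea_act_add[OF N w] uea_act_scale[OF N w]
        uea_act_umon[OF N w] P_simps)
  have "generates (P 1) N" "vector_ann N (P 1) = J"
    using act by (auto simp: generates_iff[OF N w] vector_ann_def P0) (simp_all add: N_def)
  with N show thesis by (rule that)
qed

section \<open>Graded Lie algebras and the central subalgebra\<close>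

lemma is_subalgebra_gen: "is_subalgebra (subalgebra_gen S)"
  by (auto simp: is_subalgebra_def subalgebra_gen_def cvec.subspace_def)

lemma subalgebra_gen_superset: "S \<subseteq> subalgebra_gen S"
  by (auto simp: subalgebra_gen_def)

lemma subalgebra_gen_minimal: "is_subalgebra B \<Longrightarrow> S \<subseteq> B \<Longrightarrow> subalgebra_gen S \<subseteq> B"
  by (auto simp: subalgebra_gen_def)

lemma is_subalgebra_centralizer: "is_subalgebra {u. u * a = a * u}"
proof -
  have "u * v * a = a * (u * v)" if "u * a = a * u" "v * a = a * v" for u v
    using that by (metis mult.assoc)
  then show ?thesis
    by (auto simp: is_subalgebra_def cvec.subspace_def distrib_left distrib_right)
qed

lemma is_subalgebra_central: "is_subalgebra central_uea"
proof -
  let ?C = "\<lambda>u. {a :: 'a uea. a * u = u * a}"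
  have C: "cvec.subspace (?C u)" "1 \<in> ?C u" "\<forall>a\<in>?C u. \<forall>b\<in>?C u. a * b \<in> ?C u" for u
    using is_subalgebra_centralizer[of u] unfolding is_subalgebra_def by blast+
  have eq: "central_uea = \<Inter>(range ?C)" unfolding central_uea_def by blast
  show ?thesis
    unfolding is_subalgebra_def eq
  proof (intro conjI)
    show "cvec.subspace (\<Inter>(range ?C))" using C(1) by (intro cvec.subspace_Inter) blast
  qed (use C(2,3) in blast)+
qed

text \<open>The centralizer of z is a subalgebra containing all generators of U(g).\<close>

lemma uea_of_center:
  assumes "z \<in> lie_center"
  shows "uea_of z \<in> central_uea"
proof -
  let ?C = "{u. u * uea_of z = uea_of z * u}"
  have C: "is_subalgebra ?C" by (rule is_subalgebra_centralizer)
  have "uea_of x \<in> ?C" for x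
    using assms uea_of_bracket[of z x] by (simp add: lie_center_def)
  then have "umon w \<in> ?C" for w
    unfolding umon_def using C by (intro is_subalgebra_prod_list) auto
  then have "cvec.span (range umon) \<subseteq> ?C"
    using C by (intro cvec.span_minimal) (auto simp: is_subalgebra_def)
  then have "u \<in> ?C" for u by (simp add: span_umon_UNIV subset_eq)
  then show ?thesis by (simp add: central_uea_def)
qed

locale whittaker_setting =
  fixes gr :: "'q::linordered_ab_group_add \<Rightarrow> 'g::complex_lie_algebra set"
    and \<pi> :: "'q \<Rightarrow> int"
    and x :: "'q \<Rightarrow> 'g"
    and \<phi> :: "'g \<Rightarrow> complex"
  assumes pi_add: "\<pi> (\<alpha> + \<beta>) = \<pi> \<alpha> + \<pi> \<beta>"
    and mono_pi: "mono \<pi>"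
    and grading: "is_grading gr"
    and good: "Q_good gr \<pi>"
    and choice: "homogeneous_choice gr \<pi> x"
    and character: "lie_character (n_part gr \<pi>) \<phi>"
    and nonsing: "nonsingular gr \<pi> x \<phi>"
begin

abbreviation n :: "'g set" where "n \<equiv> n_part gr \<pi>"
abbreviation Z :: "'g set" where "Z \<equiv> Z_minus gr \<pi>"
abbreviation A :: "'g uea set" where "A \<equiv> S_Z gr \<pi>"

section \<open>Homogeneous decompositions and the subspaces n and Z''\<close>

lemma gr_subspace: "cvec.subspace (gr \<alpha>)"
  and gr_bracket: "a \<in> gr \<alpha> \<Longrightarrow> b \<in> gr \<beta> \<Longrightarrow> lie_bracket a b \<in> gr (\<alpha> + \<beta>)"
  using grading by (auto simp: is_grading_def)

lemma pi_diff: "\<pi> (\<alpha> - \<beta>) = \<pi> \<alpha> - \<pi> \<beta>"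
  using pi_add[of "\<alpha> - \<beta>" \<beta>] by simp

lemma span_homogeneous: "cvec.span (\<Union>\<alpha>. gr \<alpha>) = UNIV"
proof -
  have "v \<in> cvec.span (\<Union>\<alpha>. gr \<alpha>)" for v
  proof -
    obtain f where f: "\<forall>\<alpha>. f \<alpha> \<in> gr \<alpha>" "v = (\<Sum>\<alpha> | f \<alpha> \<noteq> 0. f \<alpha>)"
      using grading unfolding is_grading_def by metis
    have "(\<Sum>\<alpha> | f \<alpha> \<noteq> 0. f \<alpha>) \<in> cvec.span (\<Union>\<alpha>. gr \<alpha>)"
      using f(1) by (intro cvec.span_sum cvec.span_base) auto
    with f(2) show ?thesis by simp
  qed
  then show ?thesis by blast
qed

lemma graded_span_cases:
  assumes "v \<in> cvec.span (\<Union>\<alpha>\<in>S. gr \<alpha>)"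
  shows "\<exists>f T. finite T \<and> T \<subseteq> S \<and> (\<forall>\<alpha>\<in>T. f \<alpha> \<in> gr \<alpha>) \<and> v = (\<Sum>\<alpha>\<in>T. f \<alpha>)"
  using assms
proof (induction v rule: cvec.span_induct_alt)
  case base
  show ?case by (intro exI[of _ "\<lambda>_. 0"] exI[of _ "{}"]) simp
next
  case (step c y v)
  then obtain f T where T: "finite T" "T \<subseteq> S" "\<forall>\<alpha>\<in>T. f \<alpha> \<in> gr \<alpha>" "v = (\<Sum>\<alpha>\<in>T. f \<alpha>)" by blast
  obtain \<beta> where \<beta>: "\<beta> \<in> S" "y \<in> gr \<beta>" using step(1) by blast
  define h where "h = (\<lambda>\<alpha>. (if \<alpha> \<in> T then f \<alpha> else 0) + (if \<alpha> = \<beta> then c *\<^sub>C y else 0))"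
  have "h \<alpha> \<in> gr \<alpha>" for \<alpha>
    using T(3) \<beta>(2) gr_subspace[of \<alpha>]
    by (auto simp: h_def intro: cvec.subspace_add cvec.subspace_scale cvec.subspace_0)
  moreover have "(\<Sum>\<alpha>\<in>insert \<beta> T. h \<alpha>) = c *\<^sub>C y + v"
  proof -
    have "(\<Sum>\<alpha>\<in>insert \<beta> T. h \<alpha>) = (\<Sum>\<alpha>\<in>insert \<beta> T. if \<alpha> \<in> T then f \<alpha> else 0) + c *\<^sub>C y"
      using T(1) unfolding h_def sum.distrib by simp
    also have "(\<Sum>\<alpha>\<in>insert \<beta> T. if \<alpha> \<in> T then f \<alpha> else 0) = v"
      unfolding T(4) using T(1) by (intro sum.mono_neutral_cong_right) auto
    finally show ?thesis by simp
  qed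
  ultimately show ?case
    using T \<beta>(1) by (intro exI[of _ h] exI[of _ "insert \<beta> T"]) auto
qed

text \<open>Extended by zero, the two families of components are homogeneous decompositions of the
  same vector, hence equal; on disjoint supports they vanish.\<close>

lemma disjoint_graded_spans:
  assumes "v \<in> cvec.span (\<Union>\<alpha>\<in>S. gr \<alpha>)" "v \<in> cvec.span (\<Union>\<alpha>\<in>S'. gr \<alpha>)" "S \<inter> S' = {}"
  shows "v = 0"
proof -
  obtain f T where T: "finite T" "T \<subseteq> S" "\<forall>\<alpha>\<in>T. f \<alpha> \<in> gr \<alpha>" "v = (\<Sum>\<alpha>\<in>T. f \<alpha>)"
    using graded_span_cases[OF assms(1)] by blast
  obtain f' T' where T': "finite T'" "T' \<subseteq> S'" "\<forall>\<alpha>\<in>T'. f' \<alpha> \<in> gr \<alpha>" "v = (\<Sum>\<alpha>\<in>T'. f' \<alpha>)"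
    using graded_span_cases[OF assms(2)] by blast
  define P where "P f \<longleftrightarrow> (\<forall>\<alpha>. f \<alpha> \<in> gr \<alpha>) \<and> finite {\<alpha>. f \<alpha> \<noteq> 0} \<and> v = (\<Sum>\<alpha> | f \<alpha> \<noteq> 0. f \<alpha>)"
    for f
  have P: "P (\<lambda>\<alpha>. if \<alpha> \<in> T then f \<alpha> else 0)"
    if "finite T" "\<forall>\<alpha>\<in>T. f \<alpha> \<in> gr \<alpha>" "v = (\<Sum>\<alpha>\<in>T. f \<alpha>)" for f and T :: "'q set"
    unfolding P_def
  proof (intro conjI allI)
    show "(if \<alpha> \<in> T then f \<alpha> else 0) \<in> gr \<alpha>" for \<alpha>
      using that(2) gr_subspace by (auto intro: cvec.subspace_0)
    show "finite {\<alpha>. (if \<alpha> \<in> T then f \<alpha> else 0) \<noteq> 0}"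
      using that(1) by (rule rev_finite_subset) auto
    show "v = (\<Sum>\<alpha> | (if \<alpha> \<in> T then f \<alpha> else 0) \<noteq> 0. if \<alpha> \<in> T then f \<alpha> else 0)"
      unfolding that(3) using that(1) by (intro sum.mono_neutral_cong_right) auto
  qed
  have ex1: "\<exists>!f. P f" using grading unfolding is_grading_def P_def by (elim conjE allE)
  have eq: "(\<lambda>\<alpha>. if \<alpha> \<in> T then f \<alpha> else 0) = (\<lambda>\<alpha>. if \<alpha> \<in> T' then f' \<alpha> else 0)"
    using ex1 P[OF T(1,3,4)] P[OF T'(1,3,4)] by blast
  have "f \<alpha> = 0" if "\<alpha> \<in> T" for \<alpha>
  proof -
    have "\<alpha> \<notin> T'" using that T(2) T'(2) assms(3) by blast
    with fun_cong[OF eq, of \<alpha>] that show ?thesis by simp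
  qed
  then show ?thesis using T(4) by simp
qed

lemma n_subspace: "cvec.subspace n"
  by (simp add: n_part_def)

lemma gr_n: "v \<in> gr \<alpha> \<Longrightarrow> \<pi> \<alpha> > 0 \<Longrightarrow> v \<in> n"
  unfolding n_part_def by (intro cvec.span_base) auto

lemma Z_subspace: "cvec.subspace Z"
  unfolding Z_minus_def b_minus_def by (intro cvec.subspace_inter subspace_lie_center) simp

text \<open>Makes the sum Z'' + n direct, so that a character can be prescribed separately on the
  two summands.\<close>

lemma n_Z: "v \<in> n \<Longrightarrow> v \<in> Z \<Longrightarrow> v = 0"
  using disjoint_graded_spans[of v "{\<alpha>. \<pi> \<alpha> > 0}" "{\<alpha>. \<pi> \<alpha> \<le> 0}"]
  unfolding n_part_def Z_minus_def b_minus_def by fastforce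

lemma Z_center: "z \<in> Z \<Longrightarrow> z \<in> lie_center"
  by (simp add: Z_minus_def)

lemma bracket_0 [simp]: "lie_bracket 0 a = 0" "lie_bracket a 0 = (0::'g)"
  using bracket_scale_left[of 0 0 a] bracket_scale_right[of a 0 0] by simp_all

lemma center_bracket: "z \<in> lie_center \<Longrightarrow> lie_bracket z a = 0" "z \<in> lie_center \<Longrightarrow> lie_bracket a z = (0::'g)"
proof -
  assume z: "z \<in> lie_center"
  then show "lie_bracket z a = 0" by (simp add: lie_center_def)
  have "lie_bracket (a + z) (a + z) = lie_bracket a z + lie_bracket z a"
    unfolding bracket_add_left bracket_add_right by (simp add: bracket_self)
  with z show "lie_bracket a z = 0" by (simp add: lie_center_def bracket_self)
qed

lemma n_bracket:
  assumes "a \<in> n" "b \<in> n"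
  shows "lie_bracket a b \<in> n"
proof -
  have 1: "lie_bracket a b \<in> n" if "a \<in> gr \<alpha>" "\<pi> \<alpha> > 0" "b \<in> n" for a b \<alpha>
    using that(3) unfolding n_part_def
  proof (induction b rule: cvec.span_induct_alt)
    case base
    then show ?case by (simp add: cvec.span_zero)
  next
    case (step c y b)
    then obtain \<beta> where "\<pi> \<beta> > 0" "y \<in> gr \<beta>" by blast
    then have "lie_bracket a y \<in> n" using that gr_bracket by (intro gr_n[of _ "\<alpha> + \<beta>"]) (auto simp: pi_add)
    with step(2) show ?case
      unfolding n_part_def
      by (auto simp: bracket_add_right bracket_scale_right intro: cvec.span_add cvec.span_scale)
  qed
  show ?thesis
    using assms(1) unfolding n_part_def
  proof (induction a rule: cvec.span_induct_alt)
    case base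
    then show ?case by (simp add: cvec.span_zero)
  next
    case (step c y a)
    then have "lie_bracket y b \<in> n" using 1 assms(2) by blast
    with step(2) show ?case
      unfolding n_part_def
      by (auto simp: bracket_add_left bracket_scale_left intro: cvec.span_add cvec.span_scale)
  qed
qed

lemma phi_add: "a \<in> n \<Longrightarrow> b \<in> n \<Longrightarrow> \<phi> (a + b) = \<phi> a + \<phi> b"
  and phi_scale: "a \<in> n \<Longrightarrow> \<phi> (c *\<^sub>C a) = c * \<phi> a"
  and phi_bracket: "a \<in> n \<Longrightarrow> b \<in> n \<Longrightarrow> \<phi> (lie_bracket a b) = 0"
  using character by (auto simp: lie_character_def)

lemma phi_0: "\<phi> 0 = 0"
  using phi_scale[of 0 0] cvec.subspace_0[OF n_subspace] by simp

section \<open>The central subalgebra A and left ideals over its ideals\<close>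

lemma A_subalgebra: "is_subalgebra A"
  by (simp add: S_Z_def is_subalgebra_gen)

lemma A_subspace: "cvec.subspace A" and one_in_A: "1 \<in> A"
  and A_mult: "a \<in> A \<Longrightarrow> b \<in> A \<Longrightarrow> a * b \<in> A"
  using A_subalgebra by (auto simp: is_subalgebra_def)

lemma uea_of_Z: "z \<in> Z \<Longrightarrow> uea_of z \<in> A"
  unfolding S_Z_def using subalgebra_gen_superset by blast

lemma A_central: "A \<subseteq> central_uea"
  unfolding S_Z_def using uea_of_center Z_center
  by (intro subalgebra_gen_minimal is_subalgebra_central) auto

lemma A_commute: "a \<in> A \<Longrightarrow> a * u = u * a"
  using A_central by (auto simp: central_uea_def)

text \<open>These are the left ideals that occur as annihilators of cyclic Whittaker vectors; see
  \<open>whittaker_module_ideal\<close> and \<open>whittaker_module_from_ideal\<close>.\<close>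

definition whittaker_ideal :: "'g uea set \<Rightarrow> bool" where
  "whittaker_ideal J \<longleftrightarrow> left_ideal J \<and> (\<forall>q\<in>n. uea_of q - \<phi> q *\<^sub>C 1 \<in> J)"

lemma scaleC_1_in_A: "c *\<^sub>C 1 \<in> A"
  using A_subspace one_in_A by (rule cvec.subspace_scale)

text \<open>On Z'' + n the bracket depends only on the n-components, and \<phi> kills it, so
  \<open>character_extension\<close> applies. Compatibility with right multiplication then passes
  from Z'' to all of A, because the elements having it form a subalgebra.\<close>

lemma central_character_extension:
  obtains \<Lambda> :: "'g uea \<Rightarrow> 'g uea" where "clinear \<Lambda>" "\<And>a. a \<in> A \<Longrightarrow> \<Lambda> a = a" "range \<Lambda> \<subseteq> A"
    "\<And>u q. q \<in> n \<Longrightarrow> \<Lambda> (u * uea_of q) = \<phi> q *\<^sub>C \<Lambda> u" "\<And>u a. a \<in> A \<Longrightarrow> \<Lambda> (u * a) = \<Lambda> u * a"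
proof -
  define p where "p = {z + q |z q. z \<in> Z \<and> q \<in> n}"
  define \<chi> where "\<chi> v = (THE c. \<exists>z\<in>Z. \<exists>q\<in>n. v = z + q \<and> c = uea_of z + \<phi> q *\<^sub>C 1)" for v
  have \<chi>: "\<chi> (z + q) = uea_of z + \<phi> q *\<^sub>C 1" if zq: "z \<in> Z" "q \<in> n" for z q
    unfolding \<chi>_def
  proof (rule the_equality)
    fix c assume "\<exists>z'\<in>Z. \<exists>q'\<in>n. z + q = z' + q' \<and> c = uea_of z' + \<phi> q' *\<^sub>C 1"
    then obtain z' q' where *: "z' \<in> Z" "q' \<in> n" "z + q = z' + q'" "c = uea_of z' + \<phi> q' *\<^sub>C 1" by blast
    have "z - z' = q' - q" using *(3) by (simp add: algebra_simps)
    moreover have "z - z' \<in> Z" "q' - q \<in> n"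
      using zq * Z_subspace n_subspace by (auto intro: cvec.subspace_diff)
    ultimately have "q' - q = 0" using n_Z by metis
    with * show "c = uea_of z + \<phi> q *\<^sub>C 1" by simp
  qed (use zq in blast)
  have sub: "cvec.subspace p"
    using cvec.subspace_sums[OF Z_subspace n_subspace] by (simp add: p_def)
  have bracket: "lie_bracket (z + q) (z' + q') = lie_bracket q q'" if "z \<in> Z" "z' \<in> Z" for z q z' q'
    using that Z_center center_bracket by (simp add: bracket_add_left bracket_add_right)
  have Z0: "0 \<in> Z" and n0: "0 \<in> n" using Z_subspace n_subspace by (auto intro: cvec.subspace_0)
  have \<chi>n: "\<chi> q = \<phi> q *\<^sub>C 1" if "q \<in> n" for q using \<chi>[OF Z0 that] by simp
  have \<chi>Z: "\<chi> z = uea_of z" if "z \<in> Z" for z using \<chi>[OF that n0] by (simp add: phi_0)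
  have np: "q \<in> p" if "q \<in> n" for q using that Z0 unfolding p_def by force
  have Zp: "z \<in> p" if "z \<in> Z" for z using that n0 unfolding p_def by force
  have add: "\<chi> (v + w) = \<chi> v + \<chi> w" if "v \<in> p" "w \<in> p" for v w
  proof -
    obtain z q z' q' where "z \<in> Z" "q \<in> n" "v = z + q" "z' \<in> Z" "q' \<in> n" "w = z' + q'"
      using \<open>v \<in> p\<close> \<open>w \<in> p\<close> unfolding p_def by blast
    note zq = this
    have "v + w = (z + z') + (q + q')" "z + z' \<in> Z" "q + q' \<in> n"
      using zq Z_subspace n_subspace by (auto intro: cvec.subspace_add)
    then have "\<chi> (v + w) = uea_of (z + z') + \<phi> (q + q') *\<^sub>C 1" using \<chi> by metis
    then show ?thesis using zq by (simp add: \<chi> uea_of_add phi_add scaleC_add_left)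
  qed
  have scale: "\<chi> (c *\<^sub>C v) = c *\<^sub>C \<chi> v" if "v \<in> p" for c v
  proof -
    obtain z q where zq: "z \<in> Z" "q \<in> n" "v = z + q" using \<open>v \<in> p\<close> unfolding p_def by blast
    then have "c *\<^sub>C v = c *\<^sub>C z + c *\<^sub>C q" "c *\<^sub>C z \<in> Z" "c *\<^sub>C q \<in> n"
      using Z_subspace n_subspace by (auto simp: scaleC_add_right intro: cvec.subspace_scale)
    then show ?thesis using zq by (simp add: \<chi> uea_of_scale phi_scale scaleC_add_right scaleC_scaleC)
  qed
  have pb: "lie_bracket v w \<in> n \<and> \<phi> (lie_bracket v w) = 0" if "v \<in> p" "w \<in> p" for v w
    using that bracket n_bracket phi_bracket unfolding p_def by auto
  then have pbp: "lie_bracket v w \<in> p" and pb0: "\<chi> (lie_bracket v w) = 0" if "v \<in> p" "w \<in> p" for v w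
    using that np \<chi>n by simp_all
  have \<chi>A: "\<chi> ` p \<subseteq> A"
    unfolding p_def using uea_of_Z scaleC_1_in_A A_subspace by (auto simp: \<chi> intro!: cvec.subspace_add)
  obtain \<Lambda> :: "'g uea \<Rightarrow> 'g uea" where \<Lambda>: "clinear \<Lambda>" "\<Lambda> 1 = 1"
    "\<And>u q. q \<in> p \<Longrightarrow> \<Lambda> (u * uea_of q) = \<Lambda> u * \<chi> q" "range \<Lambda> \<subseteq> A"
    by (rule character_extension[OF sub pbp add scale pb0 A_subalgebra A_central \<chi>A]) blast+
  note lin = cpair.linear_add[OF \<Lambda>(1)] cpair.linear_scale[OF \<Lambda>(1)] cpair.linear_0[OF \<Lambda>(1)]
  have "is_subalgebra {a. \<forall>u. \<Lambda> (u * a) = \<Lambda> u * a}"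
    unfolding is_subalgebra_def cvec.subspace_def
    by (auto simp: distrib_left lin) (simp flip: mult.assoc)
  then have "A \<subseteq> {a. \<forall>u. \<Lambda> (u * a) = \<Lambda> u * a}"
    unfolding S_Z_def by (rule subalgebra_gen_minimal) (auto simp: \<Lambda>(3) Zp \<chi>Z)
  then have A: "\<Lambda> (u * a) = \<Lambda> u * a" if "a \<in> A" for u a using that by blast
  show thesis
  proof
    show "\<Lambda> a = a" if "a \<in> A" for a using A[OF that, of 1] \<Lambda>(2) by simp
  qed (use \<Lambda> np A \<chi>n in simp_all)
qed

text \<open>Letting v range over U(g) turns the preimage of \<open>I\<close> under \<Lambda> into a
  left ideal. For an element of A the choice v = 1 returns the element itself; conversely
  \<Lambda>(v i) = \<Lambda>(v) i lies in \<open>I\<close> for i in \<open>I\<close>.\<close>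

lemma whittaker_ideal_exists:
  assumes I: "cvec.subspace I" "I \<subseteq> A" "\<And>a i. a \<in> A \<Longrightarrow> i \<in> I \<Longrightarrow> a * i \<in> I"
  obtains J where "whittaker_ideal J" "A \<inter> J = I"
proof -
  obtain \<Lambda> :: "'g uea \<Rightarrow> 'g uea" where \<Lambda>: "clinear \<Lambda>" "\<And>a. a \<in> A \<Longrightarrow> \<Lambda> a = a" "range \<Lambda> \<subseteq> A"
    "\<And>u q. q \<in> n \<Longrightarrow> \<Lambda> (u * uea_of q) = \<phi> q *\<^sub>C \<Lambda> u" "\<And>u a. a \<in> A \<Longrightarrow> \<Lambda> (u * a) = \<Lambda> u * a"
    by (rule central_character_extension) blast
  note lin = cpair.linear_add[OF \<Lambda>(1)] cpair.linear_scale[OF \<Lambda>(1)] cpair.linear_0[OF \<Lambda>(1)]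
    cpair.linear_diff[OF \<Lambda>(1)]
  let ?J = "{u. \<forall>v. \<Lambda> (v * u) \<in> I}"
  have "left_ideal ?J"
    unfolding left_ideal_def cvec.subspace_def
    using I(1) by (auto simp: lin distrib_left cvec.subspace_0 cvec.subspace_add cvec.subspace_scale
        simp flip: mult.assoc)
  then have "whittaker_ideal ?J"
    unfolding whittaker_ideal_def using I(1) by (simp add: right_diff_distrib lin \<Lambda>(4) cvec.subspace_0)
  moreover have "A \<inter> ?J = I"
  proof
    show "A \<inter> ?J \<subseteq> I"
    proof
      fix a assume "a \<in> A \<inter> ?J"
      then have "\<Lambda> (1 * a) \<in> I" "a \<in> A" by blast+
      then show "a \<in> I" using \<Lambda>(2) by simp
    qed
    have "\<Lambda> (v * i) \<in> I" if "i \<in> I" for v i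
      using that I(2,3) \<Lambda>(3,5) by (metis rangeI subsetD)
    then show "I \<subseteq> A \<inter> ?J" using I(2) by blast
  qed
  ultimately show thesis by (rule that)
qed

end

section \<open>Straightening modulo a Whittaker ideal\<close>

lemma dim_le_1D:
  assumes "dim_le S 1" "u \<in> S" "u \<noteq> 0" "v \<in> S"
  shows "\<exists>c. v = c *\<^sub>C u"
proof -
  obtain B where B: "cvec.span B = S" "finite B" "card B \<le> 1" using assms(1) by (auto simp: dim_le_def)
  then obtain b where "B \<subseteq> {b}" by (metis card_le_Suc0_iff_eq One_nat_def subsetI singleton_iff subset_singletonD)
  then have S: "S \<subseteq> cvec.span {b}" using B(1) cvec.span_mono by blast
  then have "u \<in> cvec.span {b}" "v \<in> cvec.span {b}" using assms(2,4) by blast+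
  then obtain k l where kl: "u = k *\<^sub>C b" "v = l *\<^sub>C b" unfolding cvec.span_singleton by blast
  then have "v = (l / k) *\<^sub>C u" using assms(3) by (auto simp: scaleC_scaleC)
  then show ?thesis ..
qed

context whittaker_setting
begin

section \<open>Consequences of goodness and nonsingularity\<close>

abbreviation top_deg :: 'q where
  "top_deg \<equiv> (THE a. is_maximal_in a {\<alpha> \<in> K_pos gr \<pi>. \<phi> (x \<alpha>) \<noteq> 0})"

abbreviation h :: int where "h \<equiv> \<pi> top_deg"

definition Ks :: "'q set" where "Ks = K_nonpos gr \<pi> - R_nonpos gr \<pi>"

lemma top_deg_maximal: "is_maximal_in top_deg {\<alpha> \<in> K_pos gr \<pi>. \<phi> (x \<alpha>) \<noteq> 0}"
  by (rule theI'[OF conjunct1[OF nonsing[unfolded nonsingular_def Let_def]]])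

lemma nonsingular_witness: "\<beta> \<in> Ks \<Longrightarrow> \<exists>y\<in>gr (top_deg - \<beta>). \<phi> (lie_bracket y (x \<beta>)) \<noteq> 0"
  unfolding Ks_def by (rule bspec[OF conjunct2[OF nonsing[unfolded nonsingular_def Let_def]]])

lemma h_pos: "h > 0"
  using top_deg_maximal by (simp add: is_maximal_in_def K_pos_def)

lemma Ks_nonpos: "\<beta> \<in> Ks \<Longrightarrow> \<pi> \<beta> \<le> 0"
  by (auto simp: Ks_def K_nonpos_def)

lemma x_gr: "\<beta> \<in> Ks \<Longrightarrow> x \<beta> \<in> gr \<beta>"
  using choice by (auto simp: Ks_def K_nonpos_def homogeneous_choice_def)

text \<open>Such a component lies in n and is spanned by \<open>x \<delta>\<close>, on which \<phi>
  vanishes by maximality. The comparison is made in Q, so it also separates degrees with the same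
  image under \<pi>.\<close>

lemma phi_above:
  assumes "v \<in> gr \<delta>" "top_deg < \<delta>"
  shows "\<phi> v = 0"
proof (cases "gr \<delta> = {0}")
  case True
  then show ?thesis using assms phi_0 by simp
next
  case False
  have "h \<le> \<pi> \<delta>" by (intro monoD[OF mono_pi] less_imp_le assms)
  then have pos: "\<pi> \<delta> > 0" using h_pos by linarith
  then have K: "\<delta> \<in> K_pos gr \<pi>" "\<delta> \<notin> R_nonpos gr \<pi>"
    using False by (auto simp: K_pos_def K_all_def R_nonpos_def K_nonpos_def)
  then have x: "x \<delta> \<in> gr \<delta>" "x \<delta> \<noteq> 0" using choice by (auto simp: homogeneous_choice_def K_pos_def)
  obtain c where "v = c *\<^sub>C x \<delta>"
    using dim_le_1D[of "gr \<delta>" "x \<delta>" v] good pos assms(1) x by (auto simp: Q_good_def)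
  moreover have "\<phi> (x \<delta>) = 0"
    using top_deg_maximal assms(2) K(1) by (auto simp: is_maximal_in_def)
  ultimately show ?thesis using gr_n[OF x(1) pos] by (simp add: phi_scale)
qed

lemma phi_above_h: "v \<in> gr \<delta> \<Longrightarrow> \<pi> \<delta> > h \<Longrightarrow> \<phi> v = 0"
  using phi_above monoD[OF mono_pi, of \<delta> top_deg] by (meson leD not_less)

lemma gr_Z: "v \<in> gr \<alpha> \<Longrightarrow> \<pi> \<alpha> \<le> 0 \<Longrightarrow> v \<in> lie_center \<Longrightarrow> v \<in> Z"
  unfolding Z_minus_def b_minus_def by (auto intro: cvec.span_base)

text \<open>Modulo the center the component is at most a line, spanned by the class of
  \<open>x \<alpha>\<close>; the difference from a multiple of \<open>x \<alpha>\<close> is central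
  of nonpositive degree.\<close>

lemma gr_nonpos_cases:
  assumes "v \<in> gr \<alpha>" "\<pi> \<alpha> \<le> 0"
  shows "v \<in> Z \<or> \<alpha> \<in> Ks \<and> (\<exists>c. \<exists>z\<in>Z. v = c *\<^sub>C x \<alpha> + z)"
proof (cases "\<alpha> \<in> Ks")
  case False
  then have "v \<in> lie_center"
    using assms cvec.subspace_0[OF subspace_lie_center] by (auto simp: Ks_def K_nonpos_def K_all_def R_nonpos_def)
  then show ?thesis using gr_Z assms by blast
next
  case True
  then have x: "x \<alpha> \<in> gr \<alpha>" "x \<alpha> \<notin> Z"
    using choice by (auto simp: homogeneous_choice_def Ks_def K_nonpos_def)
  have rel: "abs_mod_center a = abs_mod_center b \<longleftrightarrow> a - b \<in> lie_center" for a b :: 'g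
    by (rule mod_center.abs_eq_iff)
  have "x \<alpha> - 0 \<notin> lie_center" using x gr_Z[OF x(1) assms(2)] by auto
  then have "abs_mod_center (x \<alpha>) \<noteq> 0" unfolding zero_mod_center_def using rel by metis
  then obtain c where "abs_mod_center v = c *\<^sub>C abs_mod_center (x \<alpha>)"
    using dim_le_1D[of "abs_mod_center ` gr \<alpha>" "abs_mod_center (x \<alpha>)" "abs_mod_center v"]
      good assms x by (auto simp: Q_good_def)
  then have "v - c *\<^sub>C x \<alpha> \<in> lie_center" by (simp add: scaleC_mod_center.abs_eq rel)
  moreover have "v - c *\<^sub>C x \<alpha> \<in> gr \<alpha>"
    using assms x gr_subspace by (intro cvec.subspace_diff cvec.subspace_scale) auto
  ultimately have "v - c *\<^sub>C x \<alpha> \<in> Z" using gr_Z assms(2) by blast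
  moreover have "v = c *\<^sub>C x \<alpha> + (v - c *\<^sub>C x \<alpha>)" by simp
  ultimately show ?thesis using True by blast
qed

section \<open>Ordered monomials and the weight filtration\<close>

definition xmon :: "'q multiset \<Rightarrow> 'g uea" where
  "xmon \<kappa> = umon (map x (sorted_list_of_multiset \<kappa>))"

text \<open>The weight \<open>h - \<pi> \<alpha>\<close> of degree \<open>\<alpha>\<close> is that of Kazhdan's filtration: a bracket lowers the total weight
  by \<open>h\<close>, and \<open>\<phi>\<close> vanishes on elements of negative weight.\<close>

definition wt :: "'q multiset \<Rightarrow> int" where
  "wt \<kappa> = (\<Sum>\<beta>\<in>#\<kappa>. h - \<pi> \<beta>)"

lemma wt_simps [simp]: "wt {#} = 0" "wt (add_mset \<beta> \<kappa>) = h - \<pi> \<beta> + wt \<kappa>" "wt (\<kappa> + \<mu>) = wt \<kappa> + wt \<mu>"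
  by (simp_all add: wt_def)

lemma wt_nonneg: "(\<And>\<beta>. \<beta> \<in># \<kappa> \<Longrightarrow> \<pi> \<beta> \<le> 0) \<Longrightarrow> wt \<kappa> \<ge> 0"
proof (induction \<kappa>)
  case (add \<beta> \<kappa>)
  then have "\<pi> \<beta> \<le> 0" "0 \<le> wt \<kappa>" by auto
  then show ?case using h_pos by simp
qed simp

text \<open>The A-span of the ordered monomials of weight at most \<open>k\<close>, together with
  the left ideal generated by all q - \<phi>(q). That left ideal lies in every Whittaker ideal, so
  it is put into every level, including the negative ones.\<close>

inductive_set filt :: "int \<Rightarrow> 'g uea set" for k where
  mono: "a \<in> A \<Longrightarrow> set_mset \<kappa> \<subseteq> Ks \<Longrightarrow> wt \<kappa> \<le> k \<Longrightarrow> a * xmon \<kappa> \<in> filt k"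
| null: "q \<in> n \<Longrightarrow> u * (uea_of q - \<phi> q *\<^sub>C 1) \<in> filt k"
| add: "m \<in> filt k \<Longrightarrow> m' \<in> filt k \<Longrightarrow> m + m' \<in> filt k"

lemma filt_mono: "m \<in> filt k \<Longrightarrow> k \<le> l \<Longrightarrow> m \<in> filt l"
  by (induction rule: filt.induct) (auto intro: filt.intros)

lemma filt_mult: "m \<in> filt k \<Longrightarrow> a \<in> A \<Longrightarrow> a * m \<in> filt k"
proof (induction rule: filt.induct)
  case (mono b \<kappa>)
  then show ?case using filt.mono[of "a * b" \<kappa> k] A_mult by (simp add: mult.assoc)
next
  case (null q u)
  then show ?case using filt.null[of q "a * u" k] by (simp add: mult.assoc)
qed (simp add: distrib_left filt.add)

lemma filt_scale: "m \<in> filt k \<Longrightarrow> c *\<^sub>C m \<in> filt k"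
  using filt_mult[OF _ scaleC_1_in_A[of c]] by fastforce

lemma filt_0: "0 \<in> filt k"
  using filt.null[of 0 0 k] n_subspace by (simp add: cvec.subspace_0)

lemma filt_sum: "(\<And>i. i \<in> F \<Longrightarrow> f i \<in> filt k) \<Longrightarrow> (\<Sum>i\<in>F. f i) \<in> filt k"
  by (induction F rule: infinite_finite_induct) (auto intro: filt.add filt_0)

subsection \<open>Words of homogeneous elements\<close>

text \<open>A letter carries its degree along, since an element need not determine it: a bracket may
  be 0, which lies in every component.\<close>

definition homog :: "('q \<times> 'g) list \<Rightarrow> bool" where
  "homog w \<longleftrightarrow> (\<forall>(\<alpha>, g)\<in>set w. g \<in> gr \<alpha>)"

abbreviation ev :: "('q \<times> 'g) list \<Rightarrow> 'g uea" where
  "ev w \<equiv> umon (map snd w)"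

abbreviation wtw :: "('q \<times> 'g) list \<Rightarrow> int" where
  "wtw w \<equiv> wt (mset (map fst w))"

lemma homog_simps [simp]:
  "homog []" "homog (p # w) \<longleftrightarrow> snd p \<in> gr (fst p) \<and> homog w" "homog (u @ v) \<longleftrightarrow> homog u \<and> homog v"
  by (auto simp: homog_def)

text \<open>Sub-multisets enter because a letter of degree \<alpha> is a multiple of
  \<open>x \<alpha>\<close> plus a central element, and the central term moves into the coefficient,
  deleting the letter from the monomial.\<close>

inductive_set sorted_span :: "'q multiset \<Rightarrow> 'g uea set" for D where
  mono: "a \<in> A \<Longrightarrow> set_mset \<kappa> \<subseteq> Ks \<Longrightarrow> \<kappa> \<subseteq># D \<Longrightarrow> a * xmon \<kappa> \<in> sorted_span D"
| add: "m \<in> sorted_span D \<Longrightarrow> m' \<in> sorted_span D \<Longrightarrow> m + m' \<in> sorted_span D"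

lemma sorted_span_mono: "m \<in> sorted_span D \<Longrightarrow> D \<subseteq># D' \<Longrightarrow> m \<in> sorted_span D'"
  by (induction rule: sorted_span.induct) (auto intro: sorted_span.intros)

lemma sorted_span_mult: "m \<in> sorted_span D \<Longrightarrow> a \<in> A \<Longrightarrow> a * m \<in> sorted_span D"
proof (induction rule: sorted_span.induct)
  case (mono b \<kappa>)
  then show ?case using sorted_span.mono[of "a * b" \<kappa> D] A_mult by (simp add: mult.assoc)
qed (simp add: distrib_left sorted_span.add)

lemma xmon_Cons:
  assumes "\<And>\<beta>. \<beta> \<in># \<kappa> \<Longrightarrow> \<alpha> \<le> \<beta>"
  shows "xmon (add_mset \<alpha> \<kappa>) = uea_of (x \<alpha>) * xmon \<kappa>"
proof -
  have "insort \<alpha> (sorted_list_of_multiset \<kappa>) = \<alpha> # sorted_list_of_multiset \<kappa>"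
    using assms by (intro insort_is_Cons) auto
  then show ?thesis by (simp add: xmon_def)
qed

lemma sorted_span_Cons:
  assumes "m \<in> sorted_span D" "\<And>\<beta>. \<beta> \<in># D \<Longrightarrow> \<alpha> \<le> \<beta>" "\<alpha> \<in> Ks"
  shows "uea_of (x \<alpha>) * m \<in> sorted_span (add_mset \<alpha> D)"
  using assms(1)
proof (induction rule: sorted_span.induct)
  case (mono a \<kappa>)
  have "uea_of (x \<alpha>) * (a * xmon \<kappa>) = a * xmon (add_mset \<alpha> \<kappa>)"
    using assms(2) mono xmon_Cons[of \<kappa> \<alpha>] A_commute[of a "uea_of (x \<alpha>)"]
    by (metis mset_subset_eqD mult.assoc)
  then show ?case using mono assms(3) sorted_span.mono[of a "add_mset \<alpha> \<kappa>" "add_mset \<alpha> D"] by simp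
qed (simp add: distrib_left sorted_span.add)

lemma ev_sorted_span:
  assumes "homog w" "sorted (map fst w)" "\<And>\<alpha>. \<alpha> \<in> set (map fst w) \<Longrightarrow> \<pi> \<alpha> \<le> 0"
  shows "ev w \<in> sorted_span (mset (map fst w))"
  using assms
proof (induction w)
  case Nil
  then show ?case using sorted_span.mono[of 1 "{#}" "{#}"] one_in_A by (simp add: xmon_def)
next
  case (Cons p w)
  obtain \<alpha> g where p: "p = (\<alpha>, g)" by force
  let ?D = "mset (map fst w)"
  have IH: "ev w \<in> sorted_span ?D" using Cons by simp
  then have IH': "ev w \<in> sorted_span (add_mset \<alpha> ?D)" by (rule sorted_span_mono) simp
  consider "g \<in> Z" | c z where "\<alpha> \<in> Ks" "z \<in> Z" "g = c *\<^sub>C x \<alpha> + z"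
    using gr_nonpos_cases[of g \<alpha>] Cons.prems p by auto
  then show ?case
  proof cases
    case 1
    then show ?thesis using sorted_span_mult[OF IH'] uea_of_Z p by simp
  next
    case 2
    have "uea_of (x \<alpha>) * ev w \<in> sorted_span (add_mset \<alpha> ?D)"
      using Cons.prems p 2 by (intro sorted_span_Cons[OF IH]) auto
    from sorted_span_mult[OF this scaleC_1_in_A[of c]]
    have "c *\<^sub>C (uea_of (x \<alpha>) * ev w) \<in> sorted_span (add_mset \<alpha> ?D)" by simp
    from sorted_span.add[OF this sorted_span_mult[OF IH' uea_of_Z[OF 2(2)]]]
    show ?thesis by (simp add: p 2(3) uea_of_add uea_of_scale distrib_right)
  qed
qed

lemma sorted_span_filt:
  assumes "m \<in> sorted_span D" "\<And>\<beta>. \<beta> \<in># D \<Longrightarrow> \<pi> \<beta> \<le> 0"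
  shows "m \<in> filt (wt D)"
  using assms(1)
proof (induction rule: sorted_span.induct)
  case (mono a \<kappa>)
  have "wt D = wt \<kappa> + wt (D - \<kappa>)" using mono(3) wt_simps(3)[of \<kappa> "D - \<kappa>"] by simp
  moreover have "wt (D - \<kappa>) \<ge> 0" using assms(2) by (intro wt_nonneg) (metis in_diffD)
  ultimately show ?case using mono by (intro filt.mono) auto
qed (rule filt.add)

text \<open>Sorting by degree preserves the weight up to bracket terms, which are shorter and lose
  h. In a sorted word the last degree is the largest: if it is positive under \<pi>, the last letter
  is replaced by its value under \<phi>; otherwise monotonicity of \<pi> puts all letters in
  b_-.\<close>

lemma ev_filt: "homog w \<Longrightarrow> ev w \<in> filt (wtw w)"
proof (induction w rule: wf_induct_rule[OF wf_word_order[of "\<lambda>p q. fst p < fst q"]])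
  case (1 w)
  show ?case
  proof (cases "\<exists>u a b v. w = u @ a # b # v \<and> fst b < fst a")
    case True
    then obtain u a b v where w: "w = u @ a # b # v" "fst b < fst a" by blast
    have "(u @ b # a # v, w) \<in> word_order (\<lambda>p q. fst p < fst q)"
      unfolding w(1) using w(2) by (intro word_order_swap) auto
    then have "ev (u @ b # a # v) \<in> filt (wtw w)" using 1(1)[of "u @ b # a # v"] 1(2) w by (simp add: add_ac)
    moreover have "ev u * uea_of (lie_bracket (snd a) (snd b)) * ev v \<in> filt (wtw w)"
    proof -
      let ?w = "u @ (fst a + fst b, lie_bracket (snd a) (snd b)) # v"
      have "ev ?w \<in> filt (wtw ?w)"
        using 1(2) w gr_bracket by (intro 1(1) word_order_shorter) auto
      moreover have "wtw ?w \<le> wtw w" using w h_pos by (simp add: pi_add)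
      ultimately show ?thesis using filt_mono[of "ev ?w"] by (simp add: mult.assoc)
    qed
    ultimately show ?thesis
      using filt.add umon_swap[of "map snd u" "snd a" "snd b" "map snd v"] w by simp
  next
    case False
    have sorted: "sorted (map fst w)"
      unfolding sorted_map
    proof (rule sorted_wrt_adjacent)
      show "fst a \<le> fst b" if "w = u @ a # b # v" for u a b v
        using False that not_less by blast
    qed (auto intro: transpI)
    show ?thesis
    proof (cases w rule: rev_cases)
      case Nil
      then show ?thesis using filt.mono[of 1 "{#}" 0] one_in_A by (simp add: xmon_def)
    next
      case (snoc w' p)
      obtain \<alpha> g where p: "p = (\<alpha>, g)" by force
      show ?thesis
      proof (cases "\<pi> \<alpha> > 0")
        case True
        have g: "g \<in> gr \<alpha>" "homog w'" using 1(2) snoc p by auto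
        have "ev w = ev w' * (uea_of g - \<phi> g *\<^sub>C 1) + \<phi> g *\<^sub>C ev w'"
          by (simp add: snoc p right_diff_distrib)
        moreover have "ev w' * (uea_of g - \<phi> g *\<^sub>C 1) \<in> filt (wtw w)"
          by (rule filt.null) (rule gr_n[OF g(1) True])
        moreover have "\<phi> g *\<^sub>C ev w' \<in> filt (wtw w)"
        proof (cases "\<phi> g = 0")
          case True
          then show ?thesis by (simp add: filt_0)
        next
          case False
          \<comment> \<open>A letter on which \<phi> does not vanish has weight at least 0, so
            dropping it does not raise the total.\<close>
          then have "\<pi> \<alpha> \<le> h" using phi_above_h g(1) by force
          moreover have "ev w' \<in> filt (wtw w')"
            using g(2) snoc by (intro 1(1) word_order_shorter) auto
          ultimately show ?thesis by (intro filt_scale) (auto simp: snoc p elim: filt_mono)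
        qed
        ultimately show ?thesis using filt.add by simp
      next
        case False
        have "\<pi> \<beta> \<le> 0" if "\<beta> \<in> set (map fst w)" for \<beta>
        proof -
          have "\<beta> \<le> \<alpha>" using that sorted by (auto simp: snoc p sorted_append)
          then have "\<pi> \<beta> \<le> \<pi> \<alpha>" by (rule monoD[OF mono_pi])
          then show ?thesis using False by simp
        qed
        then show ?thesis using 1(2) sorted by (intro sorted_span_filt ev_sorted_span) auto
      qed
    qed
  qed
qed

lemma ev_insert_filt:
  assumes "homog u" "homog v" "g \<in> gr \<alpha>" "wtw u + (h - \<pi> \<alpha>) + wtw v \<le> k"
  shows "ev u * uea_of g * ev v \<in> filt k"
proof -
  have "ev (u @ (\<alpha>, g) # v) \<in> filt (wtw (u @ (\<alpha>, g) # v))" using assms by (intro ev_filt) auto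
  moreover have "wtw (u @ (\<alpha>, g) # v) \<le> k" using assms(4) by simp
  ultimately have "ev (u @ (\<alpha>, g) # v) \<in> filt k" by (rule filt_mono)
  then show ?thesis by (simp add: mult.assoc)
qed

lemma filt_exhaustive: "\<exists>k. u \<in> filt k"
proof -
  have "u \<in> cvec.span (umon ` {w. set w \<subseteq> (\<Union>\<alpha>. gr \<alpha>)})"
    using span_umon[OF span_homogeneous] by simp
  then show ?thesis
  proof (induction u rule: cvec.span_induct_alt)
    case base
    then show ?case using filt_0 by blast
  next
    case (step c m u)
    obtain w where w: "m = umon w" "set w \<subseteq> (\<Union>\<alpha>. gr \<alpha>)" using step(1) by blast
    have "\<exists>w'. homog w' \<and> map snd w' = w"
      using w(2)
    proof (induction w)
      case Nil
      then show ?case by (intro exI[of _ "[]"]) simp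
    next
      case (Cons g w)
      then obtain w' \<alpha> where "homog w'" "map snd w' = w" "g \<in> gr \<alpha>" by auto
      then show ?case by (intro exI[of _ "(\<alpha>, g) # w'"]) simp
    qed
    then obtain k where k: "m \<in> filt k" using ev_filt w(1) by metis
    obtain l where l: "u \<in> filt l" using step by blast
    have "c *\<^sub>C m + u \<in> filt (max k l)"
      using filt_mono[OF k, of "max k l"] filt_mono[OF l, of "max k l"] by (intro filt.add filt_scale) auto
    then show ?case by blast
  qed
qed

subsection \<open>Leading terms of commutators\<close>

text \<open>At the right end \<open>z\<close> becomes the scalar \<phi>(z). The whole word has
  weight \<open>wtw u + wtw s + h - \<pi> \<delta>\<close>, and each letter passed leaves a bracket
  term with h less.\<close>

lemma move_right:
  assumes "z \<in> gr \<delta>" "\<pi> \<delta> > 0" "homog s" "homog u"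
  shows "ev u * uea_of z * ev s - \<phi> z *\<^sub>C (ev u * ev s) \<in> filt (wtw u + wtw s - \<pi> \<delta>)"
  using assms(3,4)
proof (induction s arbitrary: u)
  case Nil
  have "ev u * (uea_of z - \<phi> z *\<^sub>C 1) \<in> filt (wtw u - \<pi> \<delta>)"
    by (rule filt.null) (rule gr_n[OF assms(1,2)])
  then show ?case by (simp add: right_diff_distrib)
next
  case (Cons p s)
  obtain \<alpha> g where p: "p = (\<alpha>, g)" by force
  let ?k = "wtw u + wtw (p # s) - \<pi> \<delta>"
  have g: "g \<in> gr \<alpha>" "homog s" using Cons.prems p by auto
  have "ev (u @ [p]) * uea_of z * ev s - \<phi> z *\<^sub>C (ev (u @ [p]) * ev s) \<in> filt ?k"
    using Cons.IH[of "u @ [p]"] Cons.prems by (simp add: add_ac)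
  moreover have "ev u * uea_of (lie_bracket z g) * ev s \<in> filt ?k"
    using Cons.prems(2) g(2) gr_bracket[OF assms(1) g(1)]
    by (rule ev_insert_filt) (simp add: p pi_add)
  ultimately have "ev (u @ [p]) * uea_of z * ev s - \<phi> z *\<^sub>C (ev (u @ [p]) * ev s)
      + ev u * uea_of (lie_bracket z g) * ev s \<in> filt ?k"
    by (rule filt.add)
  then show ?case by (simp add: p uea_of_bracket algebra_simps)
qed

lemma bracket_degree: "y \<in> gr (top_deg - \<beta>) \<Longrightarrow> g \<in> gr \<gamma> \<Longrightarrow> lie_bracket y g \<in> gr (top_deg + (\<gamma> - \<beta>))"
  using gr_bracket[of y "top_deg - \<beta>" g \<gamma>] by (simp add: algebra_simps)

text \<open>The weight of \<open>y\<close> is \<open>\<pi> \<beta>\<close>, and every term of the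
  commutator contains one bracket, which costs h; the net drop is
  \<open>h - \<pi> \<beta>\<close>.\<close>

lemma commutator_filt:
  assumes y: "y \<in> gr (top_deg - \<beta>)" and "homog w" "homog u"
  shows "ev u * (uea_of y * ev w - ev w * uea_of y) \<in> filt (wtw u + wtw w - (h - \<pi> \<beta>))"
  using assms(2,3)
proof (induction w arbitrary: u)
  case Nil
  then show ?case by (simp add: filt_0)
next
  case (Cons p w)
  obtain \<gamma> g where p: "p = (\<gamma>, g)" by force
  let ?k = "wtw u + wtw (p # w) - (h - \<pi> \<beta>)"
  have g: "g \<in> gr \<gamma>" "homog w" using Cons.prems p by auto
  have "ev (u @ [p]) * (uea_of y * ev w - ev w * uea_of y) \<in> filt ?k"
    using Cons.IH[of "u @ [p]"] Cons.prems by (simp add: add_ac)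
  moreover have "ev u * uea_of (lie_bracket y g) * ev w \<in> filt ?k"
    using Cons.prems(2) g(2) bracket_degree[OF y g(1)]
    by (rule ev_insert_filt) (simp add: p pi_add pi_diff)
  ultimately have "ev (u @ [p]) * (uea_of y * ev w - ev w * uea_of y)
      + ev u * uea_of (lie_bracket y g) * ev w \<in> filt ?k"
    by (rule filt.add)
  then show ?case by (simp add: p uea_of_bracket algebra_simps)
qed

text \<open>The formal partial derivative with respect to \<open>x \<beta>\<close>, by the Leibniz
  rule along the word and with the other letters kept in order.\<close>

fun deriv_word :: "'q \<Rightarrow> 'q list \<Rightarrow> 'g uea" where
  "deriv_word \<beta> [] = 0"
| "deriv_word \<beta> (\<gamma> # s) = (if \<gamma> = \<beta> then umon (map x s) else 0) + uea_of (x \<gamma>) * deriv_word \<beta> s"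

abbreviation xw :: "'q list \<Rightarrow> ('q \<times> 'g) list" where
  "xw s \<equiv> map (\<lambda>\<gamma>. (\<gamma>, x \<gamma>)) s"

lemma homog_xw: "set s \<subseteq> Ks \<Longrightarrow> homog (xw s)"
  by (auto simp: homog_def x_gr)

lemma xw_simps [simp]: "map snd (xw s) = map x s" "map fst (xw s) = s"
  by (simp_all add: comp_def)

text \<open>If \<open>\<gamma> > \<beta>\<close> then \<open>[y, x \<gamma>]\<close> has degree above \<open>top_deg\<close>, where \<open>\<phi>\<close> vanishes; so only
  the letters \<open>x \<beta>\<close> contribute to the leading term.\<close>

lemma commutator_leading_term:
  assumes y: "y \<in> gr (top_deg - \<beta>)" and "set s \<subseteq> Ks" "homog u" "\<And>\<gamma>. \<gamma> \<in> set s \<Longrightarrow> \<beta> \<le> \<gamma>"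
  shows "ev u * (uea_of y * umon (map x s) - umon (map x s) * uea_of y
      - \<phi> (lie_bracket y (x \<beta>)) *\<^sub>C deriv_word \<beta> s)
    \<in> filt (wtw u + wt (mset s) - (h - \<pi> \<beta>) - h)"
  using assms(2,3,4)
proof (induction s arbitrary: u)
  case Nil
  then show ?case by (simp add: filt_0)
next
  case (Cons \<gamma> s)
  let ?k = "wtw u + wt (mset (\<gamma> # s)) - (h - \<pi> \<beta>) - h" and ?c = "\<phi> (lie_bracket y (x \<beta>))"
  let ?S = "umon (map x s)" and ?z = "lie_bracket y (x \<gamma>)"
  have \<gamma>: "x \<gamma> \<in> gr \<gamma>" "\<beta> \<le> \<gamma>" "set s \<subseteq> Ks" using Cons.prems x_gr by auto
  have z: "?z \<in> gr (top_deg + (\<gamma> - \<beta>))" using bracket_degree[OF y \<gamma>(1)] .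
  have pos: "\<pi> (top_deg + (\<gamma> - \<beta>)) > 0"
    using monoD[OF mono_pi \<gamma>(2)] h_pos by (simp add: pi_add pi_diff)
  \<comment> \<open>Leibniz rule for the commutator with y: in the term where the first letter
    survives, that letter joins the prefix \<open>u\<close>, which is why the statement carries a
    prefix.\<close>
  have "ev (u @ [(\<gamma>, x \<gamma>)]) * (uea_of y * ?S - ?S * uea_of y - ?c *\<^sub>C deriv_word \<beta> s) \<in> filt ?k"
    using Cons.IH[of "u @ [(\<gamma>, x \<gamma>)]"] Cons.prems \<gamma> by (simp add: add_ac)
  moreover have "ev u * uea_of ?z * ?S - (if \<gamma> = \<beta> then ?c else 0) *\<^sub>C (ev u * ?S) \<in> filt ?k"
  proof -
    have "\<phi> ?z = (if \<gamma> = \<beta> then ?c else 0)"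
      using phi_above[OF z] \<gamma>(2) by (auto simp: order_less_le)
    moreover have "wtw u + wtw (xw s) - \<pi> (top_deg + (\<gamma> - \<beta>)) = ?k"
      by (simp add: pi_add pi_diff comp_def)
    ultimately show ?thesis
      using move_right[OF z pos homog_xw[OF \<gamma>(3)] Cons.prems(2)] by (simp only: xw_simps)
  qed
  ultimately have "ev (u @ [(\<gamma>, x \<gamma>)]) * (uea_of y * ?S - ?S * uea_of y - ?c *\<^sub>C deriv_word \<beta> s)
      + (ev u * uea_of ?z * ?S - (if \<gamma> = \<beta> then ?c else 0) *\<^sub>C (ev u * ?S)) \<in> filt ?k"
    by (rule filt.add)
  then show ?case by (cases "\<gamma> = \<beta>") (simp_all add: uea_of_bracket algebra_simps)
qed

lemma deriv_word_0: "\<beta> \<notin> set s \<Longrightarrow> deriv_word \<beta> s = 0"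
  by (induction s) auto

text \<open>As \<beta> is a lower bound, its occurrences form a prefix of the sorted word, so
  deleting any one of them gives the same word.\<close>

lemma deriv_word_sorted:
  assumes "sorted s" "\<And>\<gamma>. \<gamma> \<in> set s \<Longrightarrow> \<beta> \<le> \<gamma>"
  shows "deriv_word \<beta> s = of_nat (count_list s \<beta>) *\<^sub>C umon (map x (remove1 \<beta> s))"
  using assms
proof (induction s)
  case (Cons \<gamma> s)
  show ?case
  proof (cases "\<gamma> = \<beta>")
    case False
    then have "\<beta> \<notin> set s" using Cons.prems by (auto dest: antisym)
    then show ?thesis using False deriv_word_0[of \<beta> s] by (simp add: count_list_0_iff)
  next
    case True
    have IH: "deriv_word \<beta> s = of_nat (count_list s \<beta>) *\<^sub>C umon (map x (remove1 \<beta> s))"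
      using Cons by simp
    show ?thesis
    proof (cases "\<beta> \<in> set s")
      case False
      then show ?thesis using True deriv_word_0 by (simp add: count_list_0_iff)
    next
      case mem: True
      then obtain s' where "s = \<beta> # s'" using Cons.prems by (cases s) (force dest: antisym)+
      then have "umon (map x s) = uea_of (x \<beta>) * umon (map x (remove1 \<beta> s))" by simp
      then show ?thesis
        unfolding True deriv_word.simps IH by (simp add: cvec.scale_left_distrib)
    qed
  qed
qed simp

lemma xmon_commutator:
  assumes y: "y \<in> gr (top_deg - \<beta>)" and \<kappa>: "set_mset \<kappa> \<subseteq> Ks" "\<And>\<gamma>. \<gamma> \<in># \<kappa> \<Longrightarrow> \<beta> \<le> \<gamma>"
  shows "uea_of y * xmon \<kappa> - xmon \<kappa> * uea_of y
      - (\<phi> (lie_bracket y (x \<beta>)) * of_nat (count \<kappa> \<beta>)) *\<^sub>C xmon (\<kappa> - {#\<beta>#})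
    \<in> filt (wt \<kappa> - (h - \<pi> \<beta>) - h)"
proof -
  let ?s = "sorted_list_of_multiset \<kappa>"
  have "sorted_list_of_multiset (\<kappa> - {#\<beta>#}) = sort (remove1 \<beta> ?s)"
    by (metis mset_remove1 mset_sorted_list_of_multiset sorted_list_of_multiset_mset)
  also have "\<dots> = remove1 \<beta> ?s" by (simp add: sort_key_id_if_sorted sorted_remove1)
  finally have 1: "xmon (\<kappa> - {#\<beta>#}) = umon (map x (remove1 \<beta> ?s))" by (simp add: xmon_def)
  have "count_list ?s \<beta> = count \<kappa> \<beta>"
    by (metis count_mset mset_sorted_list_of_multiset)
  then have "deriv_word \<beta> ?s = of_nat (count \<kappa> \<beta>) *\<^sub>C xmon (\<kappa> - {#\<beta>#})"
    using deriv_word_sorted[of ?s \<beta>] \<kappa>(2) 1 by simp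
  then show ?thesis
    using commutator_leading_term[OF y, of ?s "[]"] \<kappa> by (simp add: xmon_def scaleC_scaleC)
qed

lemma xmon_commutator_filt:
  assumes y: "y \<in> gr (top_deg - \<beta>)" and \<kappa>: "set_mset \<kappa> \<subseteq> Ks"
  shows "uea_of y * xmon \<kappa> - xmon \<kappa> * uea_of y \<in> filt (wt \<kappa> - (h - \<pi> \<beta>))"
  using commutator_filt[OF y homog_xw, of "sorted_list_of_multiset \<kappa>" "[]"] \<kappa>
  by (simp add: xmon_def comp_def)

subsection \<open>A Whittaker ideal is determined by its central part\<close>

text \<open>Only multiples of q - \<phi>(q) are discarded, so one family of coefficients is valid
  modulo all Whittaker ideals at once. This allows two ideals to be compared in
  \<open>whittaker_ideal_le\<close>.\<close>

lemma filt_family: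
  assumes "m \<in> filt k"
  shows "\<exists>G b. finite G \<and> (\<forall>\<kappa>\<in>G. set_mset \<kappa> \<subseteq> Ks \<and> wt \<kappa> \<le> k) \<and> (\<forall>\<kappa>. b \<kappa> \<in> A) \<and>
    (\<forall>J. whittaker_ideal J \<longrightarrow> m - (\<Sum>\<kappa>\<in>G. b \<kappa> * xmon \<kappa>) \<in> J)"
  using assms
proof (induction rule: filt.induct)
  case (mono a \<kappa>)
  have "a * xmon \<kappa> - (\<Sum>\<kappa>\<in>{\<kappa>}. a * xmon \<kappa>) \<in> J" if "whittaker_ideal J" for J
    using that by (simp add: whittaker_ideal_def left_ideal_def cvec.subspace_0)
  then show ?case using mono by (intro exI[of _ "{\<kappa>}"] exI[of _ "\<lambda>_. a"]) auto
next
  case (null q u)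
  have "u * (uea_of q - \<phi> q *\<^sub>C 1) - (\<Sum>\<kappa>\<in>{}. 0 * xmon \<kappa>) \<in> J" if "whittaker_ideal J" for J
    using that null by (simp add: whittaker_ideal_def left_ideal_def)
  then show ?case using cvec.subspace_0[OF A_subspace]
    by (intro exI[of _ "{}"] exI[of _ "\<lambda>_. 0"]) auto
next
  case (add m m')
  obtain G b where G: "finite G" "\<forall>\<kappa>\<in>G. set_mset \<kappa> \<subseteq> Ks \<and> wt \<kappa> \<le> k" "\<forall>\<kappa>. b \<kappa> \<in> A"
    "\<forall>J. whittaker_ideal J \<longrightarrow> m - (\<Sum>\<kappa>\<in>G. b \<kappa> * xmon \<kappa>) \<in> J" using add.IH(1) by blast
  obtain G' b' where G': "finite G'" "\<forall>\<kappa>\<in>G'. set_mset \<kappa> \<subseteq> Ks \<and> wt \<kappa> \<le> k" "\<forall>\<kappa>. b' \<kappa> \<in> A"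
    "\<forall>J. whittaker_ideal J \<longrightarrow> m' - (\<Sum>\<kappa>\<in>G'. b' \<kappa> * xmon \<kappa>) \<in> J" using add.IH(2) by blast
  define c where "c \<kappa> = (if \<kappa> \<in> G then b \<kappa> else 0) + (if \<kappa> \<in> G' then b' \<kappa> else 0)" for \<kappa>
  have "(\<Sum>\<kappa>\<in>G \<union> G'. c \<kappa> * xmon \<kappa>) =
      (\<Sum>\<kappa>\<in>G \<union> G'. if \<kappa> \<in> G then b \<kappa> * xmon \<kappa> else 0) + (\<Sum>\<kappa>\<in>G \<union> G'. if \<kappa> \<in> G' then b' \<kappa> * xmon \<kappa> else 0)"
    unfolding sum.distrib[symmetric] by (rule sum.cong) (auto simp: c_def distrib_right)
  also have "(\<Sum>\<kappa>\<in>G \<union> G'. if \<kappa> \<in> G then b \<kappa> * xmon \<kappa> else 0) = (\<Sum>\<kappa>\<in>G. b \<kappa> * xmon \<kappa>)"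
    using G(1) G'(1) by (intro sum.mono_neutral_cong_right) auto
  also have "(\<Sum>\<kappa>\<in>G \<union> G'. if \<kappa> \<in> G' then b' \<kappa> * xmon \<kappa> else 0) = (\<Sum>\<kappa>\<in>G'. b' \<kappa> * xmon \<kappa>)"
    using G(1) G'(1) by (intro sum.mono_neutral_cong_right) auto
  finally have sum: "(\<Sum>\<kappa>\<in>G \<union> G'. c \<kappa> * xmon \<kappa>) = (\<Sum>\<kappa>\<in>G. b \<kappa> * xmon \<kappa>) + (\<Sum>\<kappa>\<in>G'. b' \<kappa> * xmon \<kappa>)" .
  have "m + m' - (\<Sum>\<kappa>\<in>G \<union> G'. c \<kappa> * xmon \<kappa>) \<in> J" if J: "whittaker_ideal J" for J
  proof -
    have "(m - (\<Sum>\<kappa>\<in>G. b \<kappa> * xmon \<kappa>)) + (m' - (\<Sum>\<kappa>\<in>G'. b' \<kappa> * xmon \<kappa>)) \<in> J"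
      using G(4) G'(4) J by (intro cvec.subspace_add) (auto simp: whittaker_ideal_def left_ideal_def)
    then show ?thesis by (simp add: sum algebra_simps)
  qed
  moreover have "c \<kappa> \<in> A" for \<kappa>
    using G(3) G'(3) A_subspace by (auto simp: c_def intro: cvec.subspace_add cvec.subspace_0)
  ultimately show ?case
    using G(1,2) G'(1,2) by (intro exI[of _ "G \<union> G'"] exI[of _ c]) auto
qed

context
  fixes J assumes J: "whittaker_ideal J"
begin

lemma J_subspace: "cvec.subspace J" and J_mult: "u \<in> J \<Longrightarrow> a * u \<in> J"
  and J_null: "q \<in> n \<Longrightarrow> uea_of q - \<phi> q *\<^sub>C 1 \<in> J"
  using J by (auto simp: whittaker_ideal_def left_ideal_def)

lemma J_cancel: "k *\<^sub>C u \<in> J \<Longrightarrow> k \<noteq> 0 \<Longrightarrow> u \<in> J"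
  using cvec.subspace_scale[OF J_subspace, of "k *\<^sub>C u" "inverse k"] by (simp add: scaleC_scaleC scaleC_one)

lemma J_coeff: "a \<in> A \<Longrightarrow> a \<in> J \<Longrightarrow> a * xmon \<kappa> \<in> J"
  using J_mult[of a "xmon \<kappa>"] A_commute[of a "xmon \<kappa>"] by simp

text \<open>A left ideal is not stable under right multiplication in general, but u q = u (q -
  \<phi>(q)) + \<phi>(q) u stays in \<open>J\<close> for q in n.\<close>

lemma J_bracket:
  assumes "u \<in> J" "q \<in> n"
  shows "uea_of q * u - u * uea_of q \<in> J"
proof -
  have "uea_of q * u - (u * (uea_of q - \<phi> q *\<^sub>C 1) + \<phi> q *\<^sub>C u) \<in> J"
    using assms J_subspace J_mult J_null
    by (intro cvec.subspace_diff cvec.subspace_add cvec.subspace_scale) auto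
  then show ?thesis by (simp add: right_diff_distrib)
qed

text \<open>Induction on the weight: if the coefficients of top weight are not all in \<open>J\<close>, let \<open>\<beta>\<close> be the smallest degree
  occurring in the offending monomials and bracket with the element \<open>y\<close> supplied by nonsingularity. Modulo
  lower weight this acts as a nonzero multiple of the partial derivative in \<open>x \<beta>\<close>.\<close>

lemma coefficients_in_J:
  assumes "finite F" "\<And>\<kappa>. \<kappa> \<in> F \<Longrightarrow> set_mset \<kappa> \<subseteq> Ks \<and> wt \<kappa> \<le> int N" "\<And>\<kappa>. a \<kappa> \<in> A"
    and "(\<Sum>\<kappa>\<in>F. a \<kappa> * xmon \<kappa>) \<in> J" "\<kappa> \<in> F"
  shows "a \<kappa> \<in> J"
  using assms
proof (induction N arbitrary: F a \<kappa> rule: less_induct)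
  case (less N)
  have wt0: "wt \<kappa> \<ge> 0" if "\<kappa> \<in> F" for \<kappa>
    using less.prems(2)[OF that] Ks_nonpos by (intro wt_nonneg) auto
  define T where "T = {\<kappa> \<in> F. wt \<kappa> = int N \<and> a \<kappa> \<notin> J}"
  define L where "L = {\<kappa> \<in> F. wt \<kappa> < int N}"
  have fin: "finite T" "finite L" using less.prems(1) by (auto simp: T_def L_def)
  have TL: "T \<inter> L = {}" "T \<union> L \<subseteq> F" by (auto simp: T_def L_def)
  have rest: "a \<kappa> \<in> J" if "\<kappa> \<in> F - (T \<union> L)" for \<kappa>
    using that less.prems(2)[of \<kappa>] by (auto simp: T_def L_def)
  have U: "(\<Sum>\<kappa>\<in>T \<union> L. a \<kappa> * xmon \<kappa>) \<in> J"
  proof -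
    have "(\<Sum>\<kappa>\<in>F. a \<kappa> * xmon \<kappa>) = (\<Sum>\<kappa>\<in>F - (T \<union> L). a \<kappa> * xmon \<kappa>) + (\<Sum>\<kappa>\<in>T \<union> L. a \<kappa> * xmon \<kappa>)"
      using less.prems(1) TL(2) by (rule sum.subset_diff[rotated])
    moreover have "(\<Sum>\<kappa>\<in>F - (T \<union> L). a \<kappa> * xmon \<kappa>) \<in> J"
      using rest less.prems(3) J_coeff by (intro cvec.subspace_sum[OF J_subspace]) auto
    ultimately show ?thesis
      using cvec.subspace_diff[OF J_subspace less.prems(4), of "\<Sum>\<kappa>\<in>F - (T \<union> L). a \<kappa> * xmon \<kappa>"] by simp
  qed
  have "T = {}"
  proof (rule ccontr)
    assume ne: "T \<noteq> {}"
    have T: "set_mset \<kappa> \<subseteq> Ks" "wt \<kappa> = int N" "a \<kappa> \<notin> J" if "\<kappa> \<in> T" for \<kappa>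
      using that less.prems(2) by (auto simp: T_def)
    have L: "set_mset \<kappa> \<subseteq> Ks" "wt \<kappa> < int N" if "\<kappa> \<in> L" for \<kappa>
      using that less.prems(2) by (auto simp: L_def)
    show False
    proof (cases "{#} \<in> T")
      case True
      \<comment> \<open>The empty monomial has weight 0, and a letter of nonpositive degree under
        \<pi> has weight at least h > 0; so here the sum has only the constant term.\<close>
      then have N0: "N = 0" using T(2) by force
      have "\<kappa> = {#}" if "\<kappa> \<in> F" for \<kappa>
      proof (rule ccontr)
        assume "\<kappa> \<noteq> {#}"
        then obtain \<beta> \<mu> where \<kappa>: "\<kappa> = add_mset \<beta> \<mu>" by (metis multiset_cases)
        then have "\<pi> \<beta> \<le> 0" "wt \<mu> \<ge> 0" using less.prems(2)[OF that] Ks_nonpos by (auto intro!: wt_nonneg)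
        then show False using less.prems(2)[OF that] h_pos by (simp add: N0 \<kappa>)
      qed
      then have "T \<union> L = {{#}}" using True TL(2) by blast
      then have "a {#} \<in> J" using U by (simp add: xmon_def)
      then show False using T(3) True by blast
    next
      case False
      define \<beta> where "\<beta> = Min (\<Union>(set_mset ` T))"
      have fin_degs: "finite (\<Union>(set_mset ` T))" and "\<Union>(set_mset ` T) \<noteq> {}" using fin ne False by auto
      then have "\<beta> \<in> \<Union>(set_mset ` T)" unfolding \<beta>_def by (rule Min_in)
      then obtain \<kappa>0 where \<kappa>0: "\<kappa>0 \<in> T" "\<beta> \<in># \<kappa>0" by blast
      have \<beta>_min: "\<beta> \<le> \<gamma>" if "\<kappa> \<in> T" "\<gamma> \<in># \<kappa>" for \<kappa> \<gamma>
        unfolding \<beta>_def using that fin_degs by (intro Min_le) auto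
      have \<beta>: "\<beta> \<in> Ks" using T(1) \<kappa>0 by blast
      obtain y where y: "y \<in> gr (top_deg - \<beta>)" "\<phi> (lie_bracket y (x \<beta>)) \<noteq> 0"
        using nonsingular_witness[OF \<beta>] by blast
      define c where "c = \<phi> (lie_bracket y (x \<beta>))"
      have yn: "y \<in> n" using Ks_nonpos[OF \<beta>] h_pos by (intro gr_n[OF y(1)]) (simp add: pi_diff)
      \<comment> \<open>\<open>W\<close> is the weight left after deleting one letter
        \<open>x \<beta>\<close> from a monomial of weight \<open>N\<close>.\<close>
      define W where "W = int N - (h - \<pi> \<beta>)"
      define D where "D \<kappa> = uea_of y * xmon \<kappa> - xmon \<kappa> * uea_of y" for \<kappa>
      have ay: "uea_of y * (a \<kappa> * m) = a \<kappa> * (uea_of y * m)" for \<kappa> m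
        using A_central less.prems(3) central_left_commute by (metis subsetD)
      have "uea_of y * (\<Sum>\<kappa>\<in>T \<union> L. a \<kappa> * xmon \<kappa>) - (\<Sum>\<kappa>\<in>T \<union> L. a \<kappa> * xmon \<kappa>) * uea_of y \<in> J"
        by (rule J_bracket[OF U yn])
      also have "uea_of y * (\<Sum>\<kappa>\<in>T \<union> L. a \<kappa> * xmon \<kappa>) - (\<Sum>\<kappa>\<in>T \<union> L. a \<kappa> * xmon \<kappa>) * uea_of y =
          (\<Sum>\<kappa>\<in>T \<union> L. a \<kappa> * D \<kappa>)"
        by (simp add: sum_distrib_left sum_distrib_right sum_subtractf D_def right_diff_distrib ay mult.assoc)
      finally have DJ: "(\<Sum>\<kappa>\<in>T \<union> L. a \<kappa> * D \<kappa>) \<in> J" .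
      define lead where "lead \<kappa> = (c * of_nat (count \<kappa> \<beta>)) *\<^sub>C (a \<kappa> * xmon (\<kappa> - {#\<beta>#}))" for \<kappa>
      have low: "(\<Sum>\<kappa>\<in>T \<union> L. a \<kappa> * D \<kappa>) - (\<Sum>\<kappa>\<in>T. lead \<kappa>) \<in> filt (W - 1)"
      proof -
        have "a \<kappa> * D \<kappa> - lead \<kappa> \<in> filt (W - 1)" if "\<kappa> \<in> T" for \<kappa>
        proof -
          have "a \<kappa> * (D \<kappa> - (c * of_nat (count \<kappa> \<beta>)) *\<^sub>C xmon (\<kappa> - {#\<beta>#})) \<in> filt (W - h)"
            using xmon_commutator[OF y(1) T(1)[OF that]] \<beta>_min[OF that] T(2)[OF that] less.prems(3)
            by (intro filt_mult) (simp_all add: D_def c_def W_def)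
          then show ?thesis
            using filt_mono[of _ "W - h" "W - 1"] h_pos by (simp add: right_diff_distrib lead_def)
        qed
        moreover have "a \<kappa> * D \<kappa> \<in> filt (W - 1)" if "\<kappa> \<in> L" for \<kappa>
        proof -
          have "a \<kappa> * D \<kappa> \<in> filt (wt \<kappa> - (h - \<pi> \<beta>))"
            unfolding D_def using xmon_commutator_filt[OF y(1) L(1)[OF that]] less.prems(3) by (rule filt_mult)
          then show ?thesis using L(2)[OF that] by (elim filt_mono) (simp add: W_def)
        qed
        ultimately have "(\<Sum>\<kappa>\<in>T. a \<kappa> * D \<kappa> - lead \<kappa>) + (\<Sum>\<kappa>\<in>L. a \<kappa> * D \<kappa>) \<in> filt (W - 1)"
          by (intro filt.add filt_sum)
        then show ?thesis
          using sum.union_disjoint[OF fin TL(1), of "\<lambda>\<kappa>. a \<kappa> * D \<kappa>"] by (simp add: sum_subtractf algebra_simps)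
      qed
      obtain G b where G: "finite G" "\<forall>\<kappa>\<in>G. set_mset \<kappa> \<subseteq> Ks \<and> wt \<kappa> \<le> W - 1" "\<forall>\<kappa>. b \<kappa> \<in> A"
        "(\<Sum>\<kappa>\<in>T \<union> L. a \<kappa> * D \<kappa>) - (\<Sum>\<kappa>\<in>T. lead \<kappa>) - (\<Sum>\<kappa>\<in>G. b \<kappa> * xmon \<kappa>) \<in> J"
        using filt_family[OF low] J by blast
      have sumJ: "(\<Sum>\<kappa>\<in>T. lead \<kappa>) + (\<Sum>\<kappa>\<in>G. b \<kappa> * xmon \<kappa>) \<in> J"
        using cvec.subspace_diff[OF J_subspace DJ G(4)] by (simp add: algebra_simps)
      define T' where "T' = {\<kappa> \<in> T. \<beta> \<in># \<kappa>}"
      define F0 where "F0 = (\<lambda>\<kappa>. \<kappa> - {#\<beta>#}) ` T'"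
      \<comment> \<open>Indexed by the monomial after differentiation: the exponent of \<beta>
        before it was one higher, hence the \<open>Suc\<close>.\<close>
      define a' where "a' \<mu> = (c * of_nat (Suc (count \<mu> \<beta>))) *\<^sub>C a (add_mset \<beta> \<mu>)" for \<mu>
      have inj: "inj_on (\<lambda>\<kappa>. \<kappa> - {#\<beta>#}) T'"
        by (rule inj_on_inverseI[where g = "add_mset \<beta>"]) (auto simp: T'_def)
      have "(\<Sum>\<kappa>\<in>T. lead \<kappa>) = (\<Sum>\<kappa>\<in>T'. lead \<kappa>)"
        using fin(1) by (intro sum.mono_neutral_right) (auto simp: T'_def lead_def not_in_iff)
      also have "\<dots> = (\<Sum>\<kappa>\<in>T'. a' (\<kappa> - {#\<beta>#}) * xmon (\<kappa> - {#\<beta>#}))"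
        by (intro sum.cong) (auto simp: T'_def lead_def a'_def)
      also have "\<dots> = (\<Sum>\<mu>\<in>F0. a' \<mu> * xmon \<mu>)"
        unfolding F0_def by (subst sum.reindex[OF inj]) simp
      finally have lead: "(\<Sum>\<kappa>\<in>T. lead \<kappa>) = (\<Sum>\<mu>\<in>F0. a' \<mu> * xmon \<mu>)" .
      have F0: "set_mset \<mu> \<subseteq> Ks \<and> wt \<mu> = W" if \<mu>: "\<mu> \<in> F0" for \<mu>
      proof -
        obtain \<kappa> where \<kappa>: "\<kappa> \<in> T" "\<kappa> = add_mset \<beta> \<mu>" using \<mu> by (auto simp: F0_def T'_def)
        then show ?thesis using T(1,2)[OF \<kappa>(1)] by (auto simp: W_def)
      qed
      have \<mu>0: "\<kappa>0 - {#\<beta>#} \<in> F0" using \<kappa>0 by (auto simp: F0_def T'_def)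
      have W: "0 \<le> W" "W < int N"
      proof -
        have "set_mset (\<kappa>0 - {#\<beta>#}) \<subseteq> Ks" "wt (\<kappa>0 - {#\<beta>#}) = W" using F0[OF \<mu>0] by auto
        then show "0 \<le> W" using wt_nonneg Ks_nonpos by blast
        show "W < int N" using Ks_nonpos[OF \<beta>] h_pos by (simp add: W_def)
      qed
      \<comment> \<open>Monomials in \<open>F0\<close> have weight exactly \<open>W\<close>, those
        in \<open>G\<close> at most \<open>W - 1\<close>; so the lower terms cannot alter the
        coefficient wanted at \<open>\<kappa>0 - {#\<beta>#}\<close>.\<close>
      define b' where "b' \<mu> = (if \<mu> \<in> F0 then a' \<mu> else b \<mu>)" for \<mu>
      have disj: "F0 \<inter> G = {}" using F0 G(2) by fastforce
      have "b' (\<kappa>0 - {#\<beta>#}) \<in> J"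
      proof (rule less.IH[of "nat W"])
        show "nat W < N" using W by simp
        show "finite (F0 \<union> G)" using fin(1) G(1) by (auto simp: F0_def T'_def)
        show "set_mset \<mu> \<subseteq> Ks \<and> wt \<mu> \<le> int (nat W)" if "\<mu> \<in> F0 \<union> G" for \<mu>
          using that F0 G(2) W by fastforce
        show "b' \<mu> \<in> A" for \<mu>
          using less.prems(3) G(3) A_subspace by (auto simp: b'_def a'_def intro: cvec.subspace_scale)
        have "(\<Sum>\<mu>\<in>F0 \<union> G. b' \<mu> * xmon \<mu>) = (\<Sum>\<mu>\<in>F0. b' \<mu> * xmon \<mu>) + (\<Sum>\<mu>\<in>G. b' \<mu> * xmon \<mu>)"
          using fin(1) G(1) disj by (intro sum.union_disjoint) (auto simp: F0_def T'_def)
        also have "(\<Sum>\<mu>\<in>F0. b' \<mu> * xmon \<mu>) = (\<Sum>\<mu>\<in>F0. a' \<mu> * xmon \<mu>)"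
          by (intro sum.cong) (auto simp: b'_def)
        also have "(\<Sum>\<mu>\<in>G. b' \<mu> * xmon \<mu>) = (\<Sum>\<mu>\<in>G. b \<mu> * xmon \<mu>)"
          using disj by (intro sum.cong) (auto simp: b'_def)
        finally show "(\<Sum>\<mu>\<in>F0 \<union> G. b' \<mu> * xmon \<mu>) \<in> J" using sumJ lead by simp
      qed (use \<mu>0 in blast)
      then have "(c * of_nat (count \<kappa>0 \<beta>)) *\<^sub>C a \<kappa>0 \<in> J"
        using \<mu>0 \<kappa>0(2) by (simp add: b'_def a'_def)
      moreover have "c * of_nat (count \<kappa>0 \<beta>) \<noteq> 0" using y(2) \<kappa>0(2) by (simp add: c_def count_eq_zero_iff)
      ultimately have "a \<kappa>0 \<in> J" by (rule J_cancel)
      then show False using T(3)[OF \<kappa>0(1)] by blast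
    qed
  qed
  show ?case
  proof (cases "\<kappa> \<in> L")
    case False
    then show ?thesis using rest[of \<kappa>] less.prems(5) \<open>T = {}\<close> by simp
  next
    case True
    \<comment> \<open>With no offending term of weight \<open>N\<close> left, the part
      \<open>L\<close> alone sums into \<open>J\<close>, and its weights are at most
      \<open>N - 1\<close>.\<close>
    then have "wt \<kappa> < int N" "wt \<kappa> \<ge> 0" using wt0 by (auto simp: L_def)
    then have "N > 0" by simp
    show ?thesis
    proof (rule less.IH[of "N - 1" L a \<kappa>])
      show "set_mset \<mu> \<subseteq> Ks \<and> wt \<mu> \<le> int (N - 1)" if "\<mu> \<in> L" for \<mu>
        using that less.prems(2) \<open>N > 0\<close> by (auto simp: L_def)
      show "(\<Sum>\<kappa>\<in>L. a \<kappa> * xmon \<kappa>) \<in> J" using U \<open>T = {}\<close> by simp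
    qed (use \<open>N > 0\<close> fin less.prems(3) True in auto)
  qed
qed

end

text \<open>An element of \<open>J\<close> is congruent, modulo both ideals, to one combination of
  monomials. Its coefficients lie in A and in \<open>J\<close>, hence in \<open>J'\<close>, and
  being central they carry the whole combination into \<open>J'\<close>.\<close>

lemma whittaker_ideal_le:
  assumes J: "whittaker_ideal J" and J': "whittaker_ideal J'" and le: "A \<inter> J \<subseteq> J'"
  shows "J \<subseteq> J'"
proof
  fix u assume u: "u \<in> J"
  obtain k where k: "u \<in> filt k" using filt_exhaustive by blast
  obtain G b where G: "finite G" "\<forall>\<kappa>\<in>G. set_mset \<kappa> \<subseteq> Ks \<and> wt \<kappa> \<le> k" "\<forall>\<kappa>. b \<kappa> \<in> A"
    and diff: "\<forall>J. whittaker_ideal J \<longrightarrow> u - (\<Sum>\<kappa>\<in>G. b \<kappa> * xmon \<kappa>) \<in> J"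
    using filt_family[OF k] by blast
  let ?s = "\<Sum>\<kappa>\<in>G. b \<kappa> * xmon \<kappa>"
  have d: "u - ?s \<in> J" "u - ?s \<in> J'" using diff J J' by blast+
  have "?s \<in> J" using cvec.subspace_diff[OF J_subspace[OF J] u d(1)] by simp
  have "b \<kappa> \<in> J" if "\<kappa> \<in> G" for \<kappa>
  proof (rule coefficients_in_J[OF J G(1)])
    show "set_mset \<mu> \<subseteq> Ks \<and> wt \<mu> \<le> int (nat k)" if "\<mu> \<in> G" for \<mu>
      using G(2) that by force
  qed (use G(3) \<open>?s \<in> J\<close> that in blast)+
  then have "b \<kappa> * xmon \<kappa> \<in> J'" if "\<kappa> \<in> G" for \<kappa>
    using that le G(3) J_coeff[OF J'] by blast
  then have "?s \<in> J'" by (rule cvec.subspace_sum[OF J_subspace[OF J']])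
  from cvec.subspace_add[OF J_subspace[OF J'] d(2) this] show "u \<in> J'" by simp
qed

lemma whittaker_ideal_eq:
  "whittaker_ideal J \<Longrightarrow> whittaker_ideal J' \<Longrightarrow> A \<inter> J = A \<inter> J' \<Longrightarrow> J = J'"
  using whittaker_ideal_le[of J J'] whittaker_ideal_le[of J' J] by blast

subsection \<open>Whittaker modules and ideals\<close>

lemma whittaker_module_ideal:
  assumes "whittaker_module n \<phi> M"
  obtains v where "lie_module M" "generates v M" "whittaker_ideal (vector_ann M v)"
    "A_of gr \<pi> M = A \<inter> vector_ann M v"
proof -
  obtain v where M: "lie_module M" "generates v M" and v: "v \<in> mspace M" "\<forall>q\<in>n. mact M q v = \<phi> q *\<^sub>C v"
    using assms by (auto simp: whittaker_module_def whittaker_vector_def)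
  have "uea_act M (uea_of q - \<phi> q *\<^sub>C 1) v = 0" if "q \<in> n" for q
    using that v(2)
    by (simp add: uea_act_diff[OF M(1) v(1)] uea_act_scale[OF M(1) v(1)] uea_act_1[OF M(1) v(1)]
        uea_act_uea_of[OF M(1) v(1)])
  then have "whittaker_ideal (vector_ann M v)"
    using left_ideal_vector_ann[OF M(1) v(1)] by (simp add: whittaker_ideal_def vector_ann_def)
  moreover have "A_of gr \<pi> M = A \<inter> vector_ann M v"
    unfolding A_of_def by (rule central_annihilator[OF M A_central])
  ultimately show thesis using M by (intro that)
qed

lemma whittaker_module_iso:
  assumes M: "whittaker_module n \<phi> M" and N: "whittaker_module n \<phi> N"
    and eq: "A_of gr \<pi> M = A_of gr \<pi> N"
  shows "lie_mod_iso M N"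
proof -
  obtain v where v: "lie_module M" "generates v M" "whittaker_ideal (vector_ann M v)"
    "A_of gr \<pi> M = A \<inter> vector_ann M v" by (rule whittaker_module_ideal[OF M])
  obtain w where w: "lie_module N" "generates w N" "whittaker_ideal (vector_ann N w)"
    "A_of gr \<pi> N = A \<inter> vector_ann N w" by (rule whittaker_module_ideal[OF N])
  have "vector_ann M v = vector_ann N w"
    using v(3) w(3) by (rule whittaker_ideal_eq) (use eq v(4) w(4) in simp)
  then show ?thesis by (rule lie_mod_iso_cyclic[OF v(1,2) w(1,2)])
qed

lemma whittaker_module_from_ideal:
  assumes "whittaker_ideal J"
  obtains N :: "('g, 'g uea) lie_mod" where "whittaker_module n \<phi> N" "A_of gr \<pi> N = A \<inter> J"
proof -
  have "left_ideal J" using assms by (simp add: whittaker_ideal_def)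
  then obtain N :: "('g, 'g uea) lie_mod" and w
    where N: "lie_module N" "generates w N" and ann: "vector_ann N w = J"
    by (rule cyclic_module_exists)
  have w: "w \<in> mspace N" using N(2) by (simp add: generates_def)
  have "mact N q w = \<phi> q *\<^sub>C w" if "q \<in> n" for q
  proof -
    have "uea_of q - \<phi> q *\<^sub>C 1 \<in> vector_ann N w" using assms that ann by (simp add: whittaker_ideal_def)
    then show ?thesis
      by (simp add: vector_ann_def uea_act_diff[OF N(1) w] uea_act_scale[OF N(1) w] uea_act_1[OF N(1) w]
          uea_act_uea_of[OF N(1) w])
  qed
  then have "whittaker_module n \<phi> N"
    using N w by (auto simp: whittaker_module_def whittaker_vector_def)
  moreover have "A_of gr \<pi> N = A \<inter> J"
    unfolding A_of_def using central_annihilator[OF N A_central] ann by simp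
  ultimately show thesis by (rule that)
qed

text \<open>A ring ideal is closed under complex scalars because these lie in A; left and right
  ideals agree because A is commutative.\<close>

lemma ideal_iff:
  "ideal I (S_Z_ring gr \<pi>) \<longleftrightarrow> cvec.subspace I \<and> I \<subseteq> A \<and> (\<forall>a\<in>A. \<forall>i\<in>I. a * i \<in> I)"
proof
  assume "ideal I (S_Z_ring gr \<pi>)"
  then interpret ideal I "S_Z_ring gr \<pi>" .
  have sub: "I \<subseteq> A" using a_subset by (simp add: S_Z_ring_def)
  have mult: "a * i \<in> I" if "a \<in> A" "i \<in> I" for a i
    using I_l_closed[OF that(2), of a] that(1) by (simp add: S_Z_ring_def)
  have "cvec.subspace I"
    unfolding cvec.subspace_def
  proof (intro conjI ballI allI)
    show "0 \<in> I" using additive_subgroup.zero_closed[OF is_additive_subgroup] by (simp add: S_Z_ring_def)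
    show "i + j \<in> I" if "i \<in> I" "j \<in> I" for i j using additive_subgroup.a_closed[OF is_additive_subgroup that] by (simp add: S_Z_ring_def)
    show "c *\<^sub>C i \<in> I" if "i \<in> I" for c i using mult[OF scaleC_1_in_A that, of c] by simp
  qed
  with sub mult show "cvec.subspace I \<and> I \<subseteq> A \<and> (\<forall>a\<in>A. \<forall>i\<in>I. a * i \<in> I)" by blast
next
  assume I: "cvec.subspace I \<and> I \<subseteq> A \<and> (\<forall>a\<in>A. \<forall>i\<in>I. a * i \<in> I)"
  have group: "abelian_group (S_Z_ring gr \<pi>)"
  proof (rule abelian_groupI)
    fix a assume "a \<in> carrier (S_Z_ring gr \<pi>)"
    then have "- a \<in> carrier (S_Z_ring gr \<pi>)"
      using A_subspace by (simp add: S_Z_ring_def cvec.subspace_neg)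
    then show "\<exists>b\<in>carrier (S_Z_ring gr \<pi>). b \<oplus>\<^bsub>S_Z_ring gr \<pi>\<^esub> a = \<zero>\<^bsub>S_Z_ring gr \<pi>\<^esub>"
      by (intro bexI[of _ "- a"]) (simp_all add: S_Z_ring_def)
  qed (use A_subspace in \<open>simp_all add: S_Z_ring_def cvec.subspace_0 cvec.subspace_add add_ac\<close>)
  have ring: "ring (S_Z_ring gr \<pi>)"
  proof (rule ringI[OF group])
    show "monoid (S_Z_ring gr \<pi>)"
      by (rule monoidI) (simp_all add: S_Z_ring_def A_mult one_in_A mult.assoc)
  qed (simp_all add: S_Z_ring_def distrib_left distrib_right)
  show "ideal I (S_Z_ring gr \<pi>)"
  proof (rule idealI[OF ring])
    interpret R: abelian_group "S_Z_ring gr \<pi>" by (rule group)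
    show "subgroup I (add_monoid (S_Z_ring gr \<pi>))"
    proof (rule R.add.subgroupI)
      show "I \<subseteq> carrier (S_Z_ring gr \<pi>)" using I by (simp add: S_Z_ring_def)
      show "I \<noteq> {}" using I cvec.subspace_0 by blast
      show "\<ominus>\<^bsub>S_Z_ring gr \<pi>\<^esub> i \<in> I" if "i \<in> I" for i
      proof -
        have "\<ominus>\<^bsub>S_Z_ring gr \<pi>\<^esub> i = - i"
          using I that A_subspace
          by (intro R.minus_equality) (auto simp: S_Z_ring_def intro: cvec.subspace_neg)
        then show ?thesis using I that by (simp add: cvec.subspace_neg)
      qed
      show "i \<oplus>\<^bsub>S_Z_ring gr \<pi>\<^esub> j \<in> I" if "i \<in> I" "j \<in> I" for i j
        using I that by (simp add: S_Z_ring_def cvec.subspace_add)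
    qed
    show "a \<otimes>\<^bsub>S_Z_ring gr \<pi>\<^esub> i \<in> I" if "i \<in> I" "a \<in> carrier (S_Z_ring gr \<pi>)" for i a
      using I that by (simp add: S_Z_ring_def)
    show "i \<otimes>\<^bsub>S_Z_ring gr \<pi>\<^esub> a \<in> I" if "i \<in> I" "a \<in> carrier (S_Z_ring gr \<pi>)" for i a
    proof -
      have "i * a = a * i" using I that by (intro A_commute) auto
      then show ?thesis using I that by (simp add: S_Z_ring_def)
    qed
  qed
qed

lemma A_of_ideal:
  assumes "whittaker_module n \<phi> M"
  shows "ideal (A_of gr \<pi> M) (S_Z_ring gr \<pi>)"
proof -
  obtain v where v: "whittaker_ideal (vector_ann M v)" "A_of gr \<pi> M = A \<inter> vector_ann M v"
    by (rule whittaker_module_ideal[OF assms])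
  then show ?thesis
    unfolding ideal_iff
    using A_mult A_subspace by (auto simp: whittaker_ideal_def left_ideal_def intro: cvec.subspace_inter)
qed

lemma ideal_A_of_exists:
  assumes "ideal I (S_Z_ring gr \<pi>)"
  obtains N :: "('g, 'g uea) lie_mod" where "whittaker_module n \<phi> N" "A_of gr \<pi> N = I"
proof -
  have I: "cvec.subspace I" "I \<subseteq> A" "\<And>a i. a \<in> A \<Longrightarrow> i \<in> I \<Longrightarrow> a * i \<in> I"
    using assms unfolding ideal_iff by blast+
  obtain J where "whittaker_ideal J" "A \<inter> J = I" using whittaker_ideal_exists[OF I] by blast
  then show thesis using whittaker_module_from_ideal that by metis
qed

end

text \<open>Isomorphism classes are formed among modules carried by \<open>'g uea\<close>, where
  they constitute a set. \<open>the_elem\<close> reads off the common value of \<open>A_of\<close>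
  on a class. The last conjunct covers Whittaker modules over any other carrier type.\<close>

theorem theorem4p2p2:
  fixes gr :: "'q::linordered_ab_group_add \<Rightarrow> 'g::complex_lie_algebra set"
    and \<pi> :: "'q \<Rightarrow> int"
    and x :: "'q \<Rightarrow> 'g"
    and \<phi> :: "'g \<Rightarrow> complex"
  assumes "is_free_abelian TYPE('q)"
    and "\<And>\<alpha> \<beta>. \<pi> (\<alpha> + \<beta>) = \<pi> \<alpha> + \<pi> \<beta>"
    and "mono \<pi>"
    and "is_grading gr"
    and "Q_good gr \<pi>"
    and "homogeneous_choice gr \<pi> x"
    and "lie_character (n_part gr \<pi>) \<phi>"
    and "nonsingular gr \<pi> x \<phi>"
  shows
    "equiv (whittaker_modules (n_part gr \<pi>) \<phi>)
       (whittaker_iso_rel (n_part gr \<pi>) \<phi> :: ('g, 'g uea) lie_mod rel) \<and>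
     A_of gr \<pi> respects (whittaker_iso_rel (n_part gr \<pi>) \<phi> :: ('g, 'g uea) lie_mod rel) \<and>
     bij_betw (\<lambda>C. the_elem (A_of gr \<pi> ` C))
       (whittaker_modules (n_part gr \<pi>) \<phi> //
         (whittaker_iso_rel (n_part gr \<pi>) \<phi> :: ('g, 'g uea) lie_mod rel))
       {I. ideal I (S_Z_ring gr \<pi>)} \<and>
     (\<forall>V :: ('g, 'v::complex_vector) lie_mod. whittaker_module (n_part gr \<pi>) \<phi> V \<longrightarrow>
       (\<exists>V' \<in> (whittaker_modules (n_part gr \<pi>) \<phi> :: ('g, 'g uea) lie_mod set).
          lie_mod_iso V V' \<and> A_of gr \<pi> V' = A_of gr \<pi> V))"
proof -
  interpret whittaker_setting gr \<pi> x \<phi>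
    using assms by unfold_locales
  let ?W = "whittaker_modules n \<phi> :: ('g, 'g uea) lie_mod set"
  let ?R = "whittaker_iso_rel n \<phi> :: ('g, 'g uea) lie_mod rel"
  have W: "M \<in> ?W \<longleftrightarrow> whittaker_module n \<phi> M" for M by (simp add: whittaker_modules_def)
  have R: "(M, N) \<in> ?R \<longleftrightarrow> M \<in> ?W \<and> N \<in> ?W \<and> lie_mod_iso M N" for M N
    by (simp add: whittaker_iso_rel_def)
  have lie: "lie_module M" if "M \<in> ?W" for M using that by (simp add: W whittaker_module_def)
  have equiv: "equiv ?W ?R"
  proof (rule equivI)
    show "?R \<subseteq> ?W \<times> ?W" using R by auto
    show "refl_on ?W ?R" using R lie_mod_iso_refl by (auto simp: refl_on_def)
    show "sym ?R" unfolding sym_def using R lie by (blast intro: lie_mod_iso_sym)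
    show "Relation.trans ?R" unfolding Relation.trans_def using R by (blast intro: lie_mod_iso_trans)
  qed
  \<comment> \<open>Isomorphic modules have the same annihilator; the converse is the uniqueness of
    the left ideal over a given ideal of A.\<close>
  have iso: "(M, N) \<in> ?R \<longleftrightarrow> A_of gr \<pi> M = A_of gr \<pi> N" if "M \<in> ?W" "N \<in> ?W" for M N
    using that R W annihilator_iso[OF lie lie] whittaker_module_iso unfolding A_of_def by metis
  have resp: "A_of gr \<pi> respects ?R"
    using iso R by (auto simp: congruent_def)
  have elem: "the_elem (A_of gr \<pi> ` (?R `` {M})) = A_of gr \<pi> M" if "M \<in> ?W" for M
  proof -
    have "A_of gr \<pi> ` (?R `` {M}) = {A_of gr \<pi> M}"
    proof
      show "A_of gr \<pi> ` (?R `` {M}) \<subseteq> {A_of gr \<pi> M}" using iso R by auto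
      have "M \<in> ?R `` {M}" using that equiv_class_self[OF equiv] by blast
      then show "{A_of gr \<pi> M} \<subseteq> A_of gr \<pi> ` (?R `` {M})" by blast
    qed
    then show ?thesis by simp
  qed
  have bij: "bij_betw (\<lambda>C. the_elem (A_of gr \<pi> ` C)) (?W // ?R) {I. ideal I (S_Z_ring gr \<pi>)}"
    unfolding bij_betw_def
  proof
    show "inj_on (\<lambda>C. the_elem (A_of gr \<pi> ` C)) (?W // ?R)"
    proof (rule inj_onI)
      fix C C' assume C: "C \<in> ?W // ?R" "C' \<in> ?W // ?R"
        and eq: "the_elem (A_of gr \<pi> ` C) = the_elem (A_of gr \<pi> ` C')"
      obtain M M' where M: "M \<in> ?W" "C = ?R `` {M}" "M' \<in> ?W" "C' = ?R `` {M'}"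
        using C by (auto elim!: quotientE)
      then have "A_of gr \<pi> M = A_of gr \<pi> M'" using eq elem by simp
      then have "(M, M') \<in> ?R" using iso M by simp
      then show "C = C'" using M equiv_class_eq[OF equiv] by simp
    qed
    show "(\<lambda>C. the_elem (A_of gr \<pi> ` C)) ` (?W // ?R) = {I. ideal I (S_Z_ring gr \<pi>)}"
    proof
      show "(\<lambda>C. the_elem (A_of gr \<pi> ` C)) ` (?W // ?R) \<subseteq> {I. ideal I (S_Z_ring gr \<pi>)}"
        using elem A_of_ideal W by (auto elim!: quotientE)
      show "{I. ideal I (S_Z_ring gr \<pi>)} \<subseteq> (\<lambda>C. the_elem (A_of gr \<pi> ` C)) ` (?W // ?R)"
      proof
        fix I assume "I \<in> {I. ideal I (S_Z_ring gr \<pi>)}"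
        then obtain N :: "('g, 'g uea) lie_mod" where N: "N \<in> ?W" "A_of gr \<pi> N = I"
          using ideal_A_of_exists W by (metis mem_Collect_eq)
        then show "I \<in> (\<lambda>C. the_elem (A_of gr \<pi> ` C)) ` (?W // ?R)"
          using elem[OF N(1)] quotientI[OF N(1), of ?R] by force
      qed
    qed
  qed
  have "\<exists>V'\<in>?W. lie_mod_iso V V' \<and> A_of gr \<pi> V' = A_of gr \<pi> V"
    if V: "whittaker_module n \<phi> V" for V :: "('g, 'v) lie_mod"
  proof -
    obtain N :: "('g, 'g uea) lie_mod" where N: "whittaker_module n \<phi> N" "A_of gr \<pi> N = A_of gr \<pi> V"
      by (rule ideal_A_of_exists[OF A_of_ideal[OF V]])
    then show ?thesis using whittaker_module_iso[OF V N(1)] W by (intro bexI[of _ N]) auto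
  qed
  with equiv resp bij show ?thesis by blast
qed

end
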